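(* (i) Let $\epsilon>0$ and set $$\chi_1(x_1)=\int_0^{x_1}\epsilon\,\big|\log|s/4|\big|^{\alpha}\,ds,\qquad 0<\alpha<1/2 .$$ There is $\Psi_1\in H^2(\mathbb{R}^3)$ such that $$\Psi_1(x)=\chi_1(x_1)\quad\text{in } B_0=\{x\in\mathbb{R}^3:(x_1-1)^2+x_2^2+x_3^2<1\}$$ and $$\|\Psi_1\|_{\dot H^2}\le C_\alpha\,\epsilon,$$ $\operatorname{supp}\Psi_1\subset\{x:|x|\le 2\}$ and $\operatorname{sing\,supp}\Psi_1=\{0\}$. (ii) Let $$\chi_2(x_1)=2\int_0^{x_1}\chi_1'(s)^2\,ds=2\int_0^{x_1}\epsilon^2\big|\log|s/4|\big|^{2\alpha}\,ds,\qquad 1/4<\alpha<1/2 .$$ There is $\Psi_{2t}\in\dot H^1(\mathbb{R}^3)$ such that $$\Psi_{2t}(x)=\chi_2(x_1-t)\quad\text{in } B_t=\{x\in\mathbb{R}^3:(x_1-1)^2+x_2^2+x_3^2<(1-t)^2\}.$$ For $0\le t<1$ we have $$\|\Psi_{2t}\|_{\dot H^2(B_t)}=\infty .$$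
   Context: $\dot H^k$ denotes the homogeneous Sobolev (semi)norm, i.e. the $L^2$ norm of the derivatives of order $k$, over $\mathbb{R}^3$ or over the indicated set. $C_\alpha$ is a constant depending on $\alpha$. $\operatorname{sing\,supp}$ denotes the singular support: the complement of the largest open set on which the function is smooth.
   Formalization: In (i), supp Ψ₁ ⊂ {|x| ≤ 2} is impossible, since Ψ₁ would jump from χ₁(2) > 0 to 0 at (2,0,0); the formal statement gives supp Ψ₁ ⊂ {|x| ≤ R} for every R > 2, with the constant C depending on α and R. *)

theory Defs
  imports "HOL-Analysis.Analysis"
begin

section \<open>Smooth functions, supports and singular supports\<close>

definition partial_deriv :: "'n::finite \<Rightarrow> (real^'n \<Rightarrow> real) \<Rightarrow> real^'n \<Rightarrow> real" where
  "partial_deriv i f x = frechet_derivative f (at x) (axis i 1)"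

text \<open>A partial derivative of order \<open>k\<close> is indexed by the list (of length \<open>k\<close>) of its directions.\<close>

primrec iter_partial_deriv :: "'n::finite list \<Rightarrow> (real^'n \<Rightarrow> real) \<Rightarrow> real^'n \<Rightarrow> real" where
  "iter_partial_deriv [] f = f"
| "iter_partial_deriv (i # I) f = partial_deriv i (iter_partial_deriv I f)"

text \<open>Only meaningful for open \<open>U\<close>, where differentiability within \<open>U\<close> is differentiability.\<close>

definition smooth_on :: "(real^'n::finite) set \<Rightarrow> (real^'n \<Rightarrow> real) \<Rightarrow> bool" where
  "smooth_on U f \<longleftrightarrow> (\<forall>I. iter_partial_deriv I f differentiable_on U)"

definition supp :: "(real^'n::finite \<Rightarrow> real) \<Rightarrow> (real^'n) set" where
  "supp f = closure (support_on UNIV f)"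

definition sing_supp :: "(real^'n::finite \<Rightarrow> real) \<Rightarrow> (real^'n) set" where
  "sing_supp f = - \<Union>{U. open U \<and> smooth_on U f}"

section \<open>Weak derivatives and Sobolev spaces on open sets\<close>

definition test_function :: "(real^'n::finite) set \<Rightarrow> (real^'n \<Rightarrow> real) \<Rightarrow> bool" where
  "test_function \<Omega> \<phi> \<longleftrightarrow> smooth_on UNIV \<phi> \<and> compact (supp \<phi>) \<and> supp \<phi> \<subseteq> \<Omega>"

definition locally_integrable_on :: "(real^'n::finite \<Rightarrow> real) \<Rightarrow> (real^'n) set \<Rightarrow> bool" where
  "locally_integrable_on f \<Omega> \<longleftrightarrow> (\<forall>K. compact K \<and> K \<subseteq> \<Omega> \<longrightarrow> f absolutely_integrable_on K)"

definition has_weak_deriv ::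
    "(real^'n::finite) set \<Rightarrow> 'n list \<Rightarrow> (real^'n \<Rightarrow> real) \<Rightarrow> (real^'n \<Rightarrow> real) \<Rightarrow> bool" where
  "has_weak_deriv \<Omega> I f g \<longleftrightarrow>
     locally_integrable_on f \<Omega> \<and> locally_integrable_on g \<Omega> \<and>
     (\<forall>\<phi>. test_function \<Omega> \<phi> \<longrightarrow>
        (LINT x:\<Omega>|lebesgue. f x * iter_partial_deriv I \<phi> x) =
        (- 1) ^ length I * (LINT x:\<Omega>|lebesgue. g x * \<phi> x))"

definition ennreal_sqrt :: "ennreal \<Rightarrow> ennreal" where
  "ennreal_sqrt a = (if a = \<infinity> then \<infinity> else ennreal (sqrt (enn2real a)))"

text \<open>
  The \<open>L\<^sup>2(\<Omega>)\<close> norm of the family of all weak derivatives of order \<open>k\<close>. Weak derivatives are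
  unique up to null sets, so the infimum ranges over at most one value; it is \<open>\<infinity>\<close> if some weak
  derivative of order \<open>k\<close> does not exist as a locally integrable function.
\<close>

definition hom_sobolev_norm ::
    "nat \<Rightarrow> (real^'n::finite) set \<Rightarrow> (real^'n \<Rightarrow> real) \<Rightarrow> ennreal" where
  "hom_sobolev_norm k \<Omega> f =
     (INF G \<in> {G. \<forall>I. length I = k \<longrightarrow> has_weak_deriv \<Omega> I f (G I)}.
        ennreal_sqrt (\<Sum>I | length I = k. \<integral>\<^sup>+x\<in>\<Omega>. ennreal ((G I x)\<^sup>2) \<partial>lebesgue))"

definition hom_sobolev_space :: "nat \<Rightarrow> (real^'n::finite) set \<Rightarrow> (real^'n \<Rightarrow> real) set" where
  "hom_sobolev_space k \<Omega> = {f. hom_sobolev_norm k \<Omega> f < \<infinity>}"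

definition sobolev_space :: "nat \<Rightarrow> (real^'n::finite) set \<Rightarrow> (real^'n \<Rightarrow> real) set" where
  "sobolev_space k \<Omega> = {f. \<forall>j\<le>k. hom_sobolev_norm j \<Omega> f < \<infinity>}"

section \<open>The profiles and the balls\<close>

definition chi1 :: "real \<Rightarrow> real \<Rightarrow> real \<Rightarrow> real" where
  "chi1 \<alpha> \<epsilon> y = (LBINT s=ereal 0..ereal y. \<epsilon> * \<bar>ln \<bar>s / 4\<bar>\<bar> powr \<alpha>)"

text \<open>\<^term>\<open>chi1 \<alpha> \<epsilon>\<close> is not differentiable at \<open>0\<close>; the arbitrary value of \<^const>\<open>deriv\<close> at that
  single point does not affect the integral.\<close>

definition chi2 :: "real \<Rightarrow> real \<Rightarrow> real \<Rightarrow> real" where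
  "chi2 \<alpha> \<epsilon> y = 2 * (LBINT s=ereal 0..ereal y. (deriv (chi1 \<alpha> \<epsilon>) s)\<^sup>2)"

definition B :: "real \<Rightarrow> (real^3) set" where
  "B t = {x. (x $ 1 - 1)\<^sup>2 + (x $ 2)\<^sup>2 + (x $ 3)\<^sup>2 < (1 - t)\<^sup>2}"

text \<open>
  Pitfall: no \<open>\<Psi> \<in> H\<^sup>2(\<real>\<^sup>3)\<close> with \<open>\<Psi>(x) = \<chi>\<^sub>1(x\<^sub>1)\<close> on \<open>B\<^sub>0\<close> is supported in the closed ball of
  radius exactly \<open>2\<close> about \<open>0\<close>. The point \<open>(2,0,0)\<close> lies in the closure of \<open>B\<^sub>0\<close> and on the
  sphere \<open>|x| = 2\<close>, so \<open>\<Psi>\<close> would jump from \<open>\<chi>\<^sub>1(2) > 0\<close> to \<open>0\<close> there, although elements of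
  \<open>H\<^sup>2(\<real>\<^sup>3)\<close> have continuous representatives. The support can be placed in the closed
  ball of any radius \<open>R > 2\<close>, with a constant that also depends on \<open>R\<close>.
\<close>

end

theory Submission
  imports Defs "HOL-Computational_Algebra.Polynomial"
begin

text \<open>
  The ball \<open>B\<^sub>0\<close> is tangent to \<open>{x\<^sub>1 = 0}\<close> at the origin, so its slice \<open>{x\<^sub>1 = s}\<close> has area of
  order \<open>s\<close>. Since \<open>\<chi>\<^sub>1''(s)\<close> is of order \<open>|log s|\<^sup>\<alpha>\<^sup>-\<^sup>1 / s\<close>, its square integrates over the ball like
  \<open>|log s|\<^sup>2\<^sup>\<alpha>\<^sup>-\<^sup>2 / s\<close>, which is finite for \<open>\<alpha> < 1/2\<close>; for \<open>\<chi>\<^sub>2\<close> the exponent is \<open>4\<alpha> - 2 > -1\<close> and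
  the integral diverges. To extend \<open>\<chi>\<^sub>1(x\<^sub>1)\<close> past \<open>B\<^sub>0\<close>, write it as \<open>x\<^sub>1 M(x\<^sub>1)\<close>, where \<open>M(p)\<close> is the mean
  of \<open>\<chi>\<^sub>1'\<close> over \<open>[0, p]\<close>, and replace the argument of \<open>M\<close> by a function that is \<open>x\<^sub>1\<close> on \<open>B\<^sub>0\<close> and a
  multiple of \<open>|x|\<^sup>2\<close> away from it: each derivative of \<open>M\<close> gains a power of the logarithm.
  All integrals are estimated on dyadic boxes. Divergence for \<open>\<chi>\<^sub>2\<close> is obtained by duality, testing
  the second weak derivative against a bump in each of a sequence of disjoint boxes.
\<close>

section \<open>Calculus of smooth functions\<close>

text \<open>The tangency shapes part (i). Near 0 the passage out of the ball happens in the layer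
  where x_1 is comparable to |x|^2, so two derivatives of a cut-off there cost |x|^-4. The factor
  x_1 pays for one power of |x|^2. The logarithm gained by differentiating M, together with the
  volume (of order 4^-k) of the part of the paraboloid with x_1 about 2^-k, pays for the rest: that
  part contributes about k^(2\<alpha>-2) to the squared norm. The extensions are smooth only off a
  point or a plane. Their weak derivatives are identified with the classical ones by cutting out a
  shrinking neighbourhood of that set, where the error is a product of size, gradient and volume
  that tends to 0. In part (ii) the extension must have only one square integrable derivative, and
  cutting off the profile itself achieves that. The constant is uniform in \<epsilon> because the
  extension is linear in \<epsilon>. The origin is singular because the first derivative is
  unbounded along the x_1-axis.\<close>

lemma partial_deriv_eq:
  "(f has_derivative f') (at x) \<Longrightarrow> partial_deriv i f x = f' (axis i 1)"
  unfolding partial_deriv_def using frechet_derivative_at by metis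

lemma partial_deriv_cong:
  assumes "open U" "x \<in> U" "\<And>y. y \<in> U \<Longrightarrow> f y = g y"
  shows "partial_deriv i f x = partial_deriv i g x"
proof -
  have "(f has_derivative D) (at x) \<longleftrightarrow> (g has_derivative D) (at x)" for D
    using assms by (metis has_derivative_transform_within_open)
  then show ?thesis
    unfolding partial_deriv_def frechet_derivative_def by simp
qed

lemma differentiable_cong_open:
  assumes "open U" "x \<in> U" "\<And>y. y \<in> U \<Longrightarrow> f y = g y" "g differentiable (at x)"
  shows "f differentiable (at x)"
  using assms unfolding differentiable_def by (metis has_derivative_transform_within_open)

lemma iter_partial_deriv_cong:
  assumes "open U" "\<And>y. y \<in> U \<Longrightarrow> f y = g y" "x \<in> U"
  shows "iter_partial_deriv I f x = iter_partial_deriv I g x"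
  using assms(3)
proof (induction I arbitrary: x)
  case Nil
  then show ?case using assms by simp
next
  case (Cons i I)
  have "partial_deriv i (iter_partial_deriv I f) x = partial_deriv i (iter_partial_deriv I g) x"
    by (rule partial_deriv_cong[OF assms(1) Cons.prems Cons.IH])
  then show ?case by simp
qed

lemma smooth_on_iff:
  "open U \<Longrightarrow> smooth_on U f \<longleftrightarrow> (\<forall>I. \<forall>x\<in>U. iter_partial_deriv I f differentiable (at x))"
  unfolding smooth_on_def by (simp add: differentiable_on_eq_differentiable_at)

lemma smooth_on_imp_differentiable:
  "smooth_on U f \<Longrightarrow> open U \<Longrightarrow> x \<in> U \<Longrightarrow> f differentiable (at x)"
  using smooth_on_iff by (metis iter_partial_deriv.simps(1))

lemma iter_partial_deriv_snoc:
  "iter_partial_deriv I (partial_deriv i f) = iter_partial_deriv (I @ [i]) f"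
  by (induction I) simp_all

lemma smooth_on_partial_deriv: "smooth_on U f \<Longrightarrow> smooth_on U (partial_deriv i f)"
  by (simp add: smooth_on_def iter_partial_deriv_snoc)

lemma smooth_on_imp_continuous_on: "smooth_on U f \<Longrightarrow> continuous_on U f"
  unfolding smooth_on_def using differentiable_imp_continuous_on
  by (metis iter_partial_deriv.simps(1))

lemma smooth_on_subset: "smooth_on U f \<Longrightarrow> V \<subseteq> U \<Longrightarrow> smooth_on V f"
  unfolding smooth_on_def by (meson differentiable_on_subset)

lemma smooth_on_cong:
  assumes "open U" "\<And>y. y \<in> U \<Longrightarrow> f y = g y" "smooth_on U g"
  shows "smooth_on U f"
  unfolding smooth_on_iff[OF assms(1)]
proof (intro allI ballI)
  fix I x assume x: "x \<in> U"
  have "iter_partial_deriv I g differentiable (at x)"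
    using assms(3) x unfolding smooth_on_iff[OF assms(1)] by blast
  then show "iter_partial_deriv I f differentiable (at x)"
    by (rule differentiable_cong_open[OF assms(1) x iter_partial_deriv_cong[OF assms(1,2)], rotated -1])
qed

lemma smooth_on_Un:
  assumes "open U" "open V" "smooth_on U f" "smooth_on V f"
  shows "smooth_on (U \<union> V) f"
  using assms smooth_on_iff[OF open_Un[OF assms(1,2)]] by (auto simp: smooth_on_iff)

text \<open>Induction on the list of directions shows that every iterated derivative agrees on
  \<open>U\<close> with a member of \<open>F\<close>. Agreement on an open set is enough, since a
  partial derivative sees only the germ.\<close>

lemma smooth_on_coinduct:
  assumes "open U" "f \<in> F"
    and diff: "\<And>f x. f \<in> F \<Longrightarrow> x \<in> U \<Longrightarrow> f differentiable (at x)"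
    and step: "\<And>f i. f \<in> F \<Longrightarrow> \<exists>g\<in>F. \<forall>x\<in>U. partial_deriv i f x = g x"
  shows "smooth_on U f"
proof -
  have *: "\<exists>g\<in>F. \<forall>x\<in>U. iter_partial_deriv I f x = g x" for I
  proof (induction I)
    case Nil
    then show ?case using assms by auto
  next
    case (Cons i I)
    then obtain g where g: "g \<in> F" "\<forall>x\<in>U. iter_partial_deriv I f x = g x" by blast
    obtain h where h: "h \<in> F" "\<forall>x\<in>U. partial_deriv i g x = h x" using step[OF g(1)] by blast
    have "iter_partial_deriv (i # I) f x = h x" if "x \<in> U" for x
    proof -
      have "partial_deriv i (iter_partial_deriv I f) x = partial_deriv i g x"
        by (rule partial_deriv_cong[OF assms(1) that]) (use g(2) in blast)
      then show ?thesis using h(2) that by simp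
    qed
    then show ?case using h(1) by blast
  qed
  show ?thesis
    unfolding smooth_on_iff[OF assms(1)]
  proof (intro allI ballI)
    fix I x assume x: "x \<in> U"
    obtain g where g: "g \<in> F" "\<forall>x\<in>U. iter_partial_deriv I f x = g x" using * by blast
    show "iter_partial_deriv I f differentiable (at x)"
      by (rule differentiable_cong_open[OF assms(1) x _ diff[OF g(1) x]]) (use g(2) in blast)
  qed
qed

lemma has_derivative_frechet:
  "f differentiable (at x) \<Longrightarrow> (f has_derivative frechet_derivative f (at x)) (at x)"
  using frechet_derivative_works by blast

lemma partial_deriv_add:
  assumes "f differentiable (at x)" "g differentiable (at x)"
  shows "partial_deriv i (\<lambda>x. f x + g x) x = partial_deriv i f x + partial_deriv i g x"
  by (rule partial_deriv_eq[OF has_derivative_add[OF assms[THEN has_derivative_frechet]],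
        folded partial_deriv_def])

lemma partial_deriv_mult:
  assumes "f differentiable (at x)" "g differentiable (at x)"
  shows "partial_deriv i (\<lambda>x. f x * g x) x = f x * partial_deriv i g x + partial_deriv i f x * g x"
  by (rule partial_deriv_eq[OF has_derivative_mult[OF assms[THEN has_derivative_frechet]],
        folded partial_deriv_def])

lemma has_derivative_compose_real:
  assumes "g differentiable (at x)" "(\<phi> has_real_derivative d) (at (g x))"
  shows "((\<lambda>x. \<phi> (g x)) has_derivative (\<lambda>h. d * frechet_derivative g (at x) h)) (at x)"
  using has_derivative_compose[OF assms(1)[THEN has_derivative_frechet]
      assms(2)[unfolded has_field_derivative_def]] .

lemma differentiable_compose_real:
  assumes "g differentiable (at x)" "(\<phi> has_real_derivative d) (at (g x))"
  shows "(\<lambda>x. \<phi> (g x)) differentiable (at x)"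
  using has_derivative_compose_real[OF assms] differentiable_def by blast

lemma partial_deriv_compose:
  assumes "g differentiable (at x)" "(\<phi> has_real_derivative d) (at (g x))"
  shows "partial_deriv i (\<lambda>x. \<phi> (g x)) x = d * partial_deriv i g x"
  using partial_deriv_eq[OF has_derivative_compose_real[OF assms]]
  by (simp add: partial_deriv_def)

lemma partial_deriv_const [simp]: "partial_deriv i (\<lambda>_. c) = (\<lambda>_. 0)"
  by (rule ext) (rule partial_deriv_eq[OF has_derivative_const])

lemma has_derivative_vec_nth_real [derivative_intros]:
  "((\<lambda>x::real^'n. x $ j) has_derivative (\<lambda>h. h $ j)) (at x)"
  by (rule bounded_linear_imp_has_derivative[OF bounded_linear_vec_nth])

lemma partial_deriv_nth [simp]:
  "partial_deriv i (\<lambda>x. x $ j) = (\<lambda>_::real^'n::finite. if i = j then 1 else 0)"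
  by (rule ext) (simp add: partial_deriv_eq[OF has_derivative_vec_nth_real] axis_def)

lemma smooth_on_const [simp]: "open U \<Longrightarrow> smooth_on U (\<lambda>_. c)"
  by (rule smooth_on_coinduct[where F = "range (\<lambda>c _. c)"]) auto

lemma smooth_on_nth [simp]: "open U \<Longrightarrow> smooth_on U (\<lambda>x. x $ j)"
  by (rule smooth_on_coinduct[where F = "insert (\<lambda>x. x $ j) (range (\<lambda>c _. c))"])
     (auto intro: has_derivative_vec_nth_real has_derivative_const simp: differentiable_def)

section \<open>Algebras of functions closed under differentiation\<close>

inductive_set alg :: "('a \<Rightarrow> real) set \<Rightarrow> ('a \<Rightarrow> real) set" for A where
  alg_base: "f \<in> A \<Longrightarrow> f \<in> alg A"
| alg_add: "f \<in> alg A \<Longrightarrow> g \<in> alg A \<Longrightarrow> (\<lambda>x. f x + g x) \<in> alg A"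
| alg_mult: "f \<in> alg A \<Longrightarrow> g \<in> alg A \<Longrightarrow> (\<lambda>x. f x * g x) \<in> alg A"

text \<open>An algebra whose generators have their derivatives in the algebra consists of smooth
  functions; all closure properties of \<^const>\<open>smooth_on\<close> are instances of this.\<close>

lemma smooth_on_alg:
  assumes "open U" "f \<in> alg A"
    and diff: "\<And>f x. f \<in> A \<Longrightarrow> x \<in> U \<Longrightarrow> f differentiable (at x)"
    and step: "\<And>f i. f \<in> A \<Longrightarrow> \<exists>g\<in>alg A. \<forall>x\<in>U. partial_deriv i f x = g x"
  shows "smooth_on U f"
proof (rule smooth_on_coinduct[OF assms(1,2)])
  show d: "f differentiable (at x)" if "f \<in> alg A" "x \<in> U" for f x
    using that by induction (auto intro: diff)
  show "\<exists>g\<in>alg A. \<forall>x\<in>U. partial_deriv i f x = g x" if "f \<in> alg A" for f i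
    using that
  proof induction
    case (alg_base f)
    then show ?case by (rule step)
  next
    case (alg_add f g)
    then obtain f' g' where "f' \<in> alg A" "g' \<in> alg A"
      "\<forall>x\<in>U. partial_deriv i f x = f' x" "\<forall>x\<in>U. partial_deriv i g x = g' x" by blast
    with alg_add.hyps show ?case
      by (intro bexI[of _ "\<lambda>x. f' x + g' x"] alg.alg_add) (auto simp: partial_deriv_add d)
  next
    case (alg_mult f g)
    then obtain f' g' where "f' \<in> alg A" "g' \<in> alg A"
      "\<forall>x\<in>U. partial_deriv i f x = f' x" "\<forall>x\<in>U. partial_deriv i g x = g' x" by blast
    with alg_mult.hyps show ?case
      by (intro bexI[of _ "\<lambda>x. f x * g' x + f' x * g x"] alg.alg_add alg.alg_mult)
         (auto simp: partial_deriv_mult d)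
  qed
qed

lemma smooth_on_algebra:
  assumes "open U" "f \<in> alg {f. smooth_on U f}"
  shows "smooth_on U f"
proof (rule smooth_on_alg[OF assms])
  fix f i assume "f \<in> {f. smooth_on U f}"
  then show "\<exists>g\<in>alg {f. smooth_on U f}. \<forall>x\<in>U. partial_deriv i f x = g x"
    by (intro bexI[of _ "partial_deriv i f"] alg_base) (auto intro: smooth_on_partial_deriv)
qed (use assms smooth_on_imp_differentiable in auto)

lemma smooth_on_add:
  "open U \<Longrightarrow> smooth_on U f \<Longrightarrow> smooth_on U g \<Longrightarrow> smooth_on U (\<lambda>x. f x + g x)"
  by (intro smooth_on_algebra) (auto intro: alg.intros)

lemma smooth_on_mult:
  "open U \<Longrightarrow> smooth_on U f \<Longrightarrow> smooth_on U g \<Longrightarrow> smooth_on U (\<lambda>x. f x * g x)"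
  by (intro smooth_on_algebra) (auto intro: alg.intros)

lemma smooth_on_diff:
  assumes "open U" "smooth_on U f" "smooth_on U g"
  shows "smooth_on U (\<lambda>x. f x - g x)"
proof -
  have "smooth_on U (\<lambda>x. f x + (-1) * g x)"
    by (intro smooth_on_add smooth_on_mult) (use assms in auto)
  then show ?thesis by simp
qed

lemma smooth_on_sum:
  assumes "open U" "\<And>i. i \<in> I \<Longrightarrow> smooth_on U (f i)"
  shows "smooth_on U (\<lambda>x. \<Sum>i\<in>I. f i x)"
  using assms(2)
  by (induction I rule: infinite_finite_induct) (simp_all add: assms(1) smooth_on_add)

text \<open>A whole family of outer functions is differentiated at once, because the derivative of
  one member may involve another. This is the case for \<open>flat\<close>; a one-element family
  serves for \<open>inverse\<close>, \<open>ln\<close>, \<open>powr\<close> and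
  \<open>step\<close>.\<close>

lemma smooth_on_compose_family:
  assumes "open U" "smooth_on U g" "\<phi> \<in> F"
    and deriv: "\<And>\<phi>. \<phi> \<in> F \<Longrightarrow>
      \<exists>d. (\<forall>x\<in>U. (\<phi> has_real_derivative d x) (at (g x))) \<and>
          d \<in> alg ({f. smooth_on U f} \<union> (\<lambda>\<phi> x. \<phi> (g x)) ` F)"
  shows "smooth_on U (\<lambda>x. \<phi> (g x))"
proof (rule smooth_on_alg[OF assms(1), where A = "{f. smooth_on U f} \<union> (\<lambda>\<phi> x. \<phi> (g x)) ` F"])
  let ?A = "{f. smooth_on U f} \<union> (\<lambda>\<phi> x. \<phi> (g x)) ` F"
  have g: "g differentiable (at x)" if "x \<in> U" for x
    using assms that smooth_on_imp_differentiable by blast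
  show "f differentiable (at x)" if "f \<in> ?A" "x \<in> U" for f x
    using that(1)
  proof
    assume "f \<in> {f. smooth_on U f}"
    then show ?thesis using smooth_on_imp_differentiable assms(1) that(2) by blast
  next
    assume "f \<in> (\<lambda>\<phi> x. \<phi> (g x)) ` F"
    then obtain \<psi> where \<psi>: "\<psi> \<in> F" "f = (\<lambda>x. \<psi> (g x))" by blast
    obtain d where "\<forall>x\<in>U. (\<psi> has_real_derivative d x) (at (g x))" using deriv[OF \<psi>(1)] by blast
    then show ?thesis unfolding \<psi>(2) using differentiable_compose_real g that(2) by blast
  qed
  show "\<exists>h\<in>alg ?A. \<forall>x\<in>U. partial_deriv i f x = h x" if "f \<in> ?A" for f i
    using that
  proof
    assume "f \<in> {f. smooth_on U f}"
    then show ?thesis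
      by (intro bexI[of _ "partial_deriv i f"] alg_base) (auto intro: smooth_on_partial_deriv)
  next
    assume "f \<in> (\<lambda>\<phi> x. \<phi> (g x)) ` F"
    then obtain \<psi> where \<psi>: "\<psi> \<in> F" "f = (\<lambda>x. \<psi> (g x))" by blast
    obtain d where d: "\<forall>x\<in>U. (\<psi> has_real_derivative d x) (at (g x))" "d \<in> alg ?A"
      using deriv[OF \<psi>(1)] by blast
    have "partial_deriv i g \<in> ?A" using assms smooth_on_partial_deriv by auto
    then have "(\<lambda>x. d x * partial_deriv i g x) \<in> alg ?A" using d(2) by (intro alg_mult) (auto intro: alg_base)
    moreover have "\<forall>x\<in>U. partial_deriv i f x = d x * partial_deriv i g x"
      using d(1) g partial_deriv_compose \<psi>(2) by metis
    ultimately show ?thesis by (intro bexI[of _ "\<lambda>x. d x * partial_deriv i g x"])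
  qed
qed (use assms(3) in \<open>auto intro: alg_base\<close>)

lemma smooth_on_compose:
  assumes "open U" "smooth_on U g"
    and "\<And>x. x \<in> U \<Longrightarrow> (\<phi> has_real_derivative d x) (at (g x))"
    and "d \<in> alg (insert (\<lambda>x. \<phi> (g x)) {f. smooth_on U f})"
  shows "smooth_on U (\<lambda>x. \<phi> (g x))"
  by (rule smooth_on_compose_family[OF assms(1,2), of _ "{\<phi>}"]) (use assms(3,4) in auto)

lemma smooth_on_inverse:
  assumes "open U" "smooth_on U g" "\<And>x. x \<in> U \<Longrightarrow> g x \<noteq> 0"
  shows "smooth_on U (\<lambda>x. inverse (g x))"
proof (rule smooth_on_compose[OF assms(1,2), where d = "\<lambda>x. (-1) * (inverse (g x) * inverse (g x))"])
  show "(inverse has_real_derivative (-1) * (inverse (g x) * inverse (g x))) (at (g x))"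
    if "x \<in> U" for x
    using DERIV_inverse[OF assms(3)[OF that]] by (simp add: power2_eq_square)
  show "(\<lambda>x. (-1) * (inverse (g x) * inverse (g x)))
      \<in> alg (insert (\<lambda>x. inverse (g x)) {f. smooth_on U f})"
    using assms(1) by (intro alg_mult) (auto intro: alg_base)
qed

lemma smooth_on_divide:
  "open U \<Longrightarrow> smooth_on U f \<Longrightarrow> smooth_on U g \<Longrightarrow> (\<And>x. x \<in> U \<Longrightarrow> g x \<noteq> 0) \<Longrightarrow>
    smooth_on U (\<lambda>x. f x / g x)"
  unfolding divide_inverse by (intro smooth_on_mult smooth_on_inverse) auto

lemma smooth_on_ln:
  assumes "open U" "smooth_on U g" "\<And>x. x \<in> U \<Longrightarrow> g x > 0"
  shows "smooth_on U (\<lambda>x. ln (g x))"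
proof (rule smooth_on_compose[OF assms(1,2), where d = "\<lambda>x. inverse (g x)"])
  show "(ln has_real_derivative inverse (g x)) (at (g x))" if "x \<in> U" for x
    using DERIV_ln assms(3)[OF that] by blast
  have "smooth_on U (\<lambda>x. inverse (g x))"
    using assms by (intro smooth_on_inverse) force+
  then show "(\<lambda>x. inverse (g x)) \<in> alg (insert (\<lambda>x. ln (g x)) {f. smooth_on U f})"
    by (intro alg_base) auto
qed

lemma smooth_on_powr:
  assumes "open U" "smooth_on U g" "\<And>x. x \<in> U \<Longrightarrow> g x > 0"
  shows "smooth_on U (\<lambda>x. g x powr a)"
proof (rule smooth_on_compose[OF assms(1,2), where d = "\<lambda>x. a * (g x powr a * inverse (g x))"
      and \<phi> = "\<lambda>z. z powr a"])
  show "((\<lambda>z. z powr a) has_real_derivative a * (g x powr a * inverse (g x))) (at (g x))"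
    if "x \<in> U" for x
    using has_real_derivative_powr[OF assms(3)[OF that], of a] assms(3)[OF that]
    by (simp add: powr_diff divide_inverse)
  have "smooth_on U (\<lambda>x. inverse (g x))"
    using assms by (intro smooth_on_inverse) force+
  then show "(\<lambda>x. a * (g x powr a * inverse (g x)))
      \<in> alg (insert (\<lambda>x. g x powr a) {f. smooth_on U f})"
    using assms(1) by (intro alg_mult alg_base) auto
qed

section \<open>Flat functions, bumps and steps\<close>

text \<open>\<open>flat 1\<close> is the standard smooth function exp(-1/z) that is flat at 0. The
  polynomial factor in 1/z makes the family closed under differentiation.\<close>

definition flat :: "real poly \<Rightarrow> real \<Rightarrow> real" where
  "flat P z = (if z > 0 then poly P (1 / z) * exp (- (1 / z)) else 0)"

lemma poly_times_exp_minus_tendsto_0: "((\<lambda>t::real. poly P t * exp (- t)) \<longlongrightarrow> 0) at_top"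
proof (induction P)
  case (pCons a P)
  have 1: "((\<lambda>t::real. t ^ 0 / exp t) \<longlongrightarrow> 0) at_top" by (rule tendsto_power_div_exp_0)
  have 2: "((\<lambda>t::real. t * (poly P t * exp (- t))) \<longlongrightarrow> 0) at_top"
  proof -
    have "((\<lambda>t::real. coeff P k * (t ^ Suc k / exp t)) \<longlongrightarrow> coeff P k * 0) at_top" for k
      by (intro tendsto_mult tendsto_const tendsto_power_div_exp_0)
    then have "((\<lambda>t::real. \<Sum>k\<le>degree P. coeff P k * (t ^ Suc k / exp t)) \<longlongrightarrow>
        (\<Sum>k\<le>degree P. coeff P k * 0)) at_top"
      by (intro tendsto_sum)
    then show ?thesis
      by (simp add: poly_altdef sum_distrib_left sum_distrib_right exp_minus divide_inverse ac_simps)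
  qed
  have "((\<lambda>t::real. a * (t ^ 0 / exp t) + t * (poly P t * exp (- t))) \<longlongrightarrow> a * 0 + 0) at_top"
    by (intro tendsto_add tendsto_mult tendsto_const 1 2)
  then show ?case by (simp add: exp_minus field_simps)
qed simp

text \<open>This is the difference quotient at 0. Division by z only shifts the coefficients of
  \<open>P\<close>, and exponential decay still wins.\<close>

lemma flat_over_tendsto_0: "((\<lambda>z. flat P z / z) \<longlongrightarrow> 0) (at 0)"
proof (rule filterlim_split_at)
  show "((\<lambda>z. flat P z / z) \<longlongrightarrow> 0) (at_left 0)"
    by (rule Lim_transform_eventually[OF tendsto_const])
       (auto simp: eventually_at_left_field flat_def intro: exI[of _ "-1"])
  have "((\<lambda>z. poly (pCons 0 P) (inverse z) * exp (- inverse z)) \<longlongrightarrow> 0) (at_right (0::real))"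
    using filterlim_compose[OF poly_times_exp_minus_tendsto_0 filterlim_inverse_at_top_right] .
  then show "((\<lambda>z. flat P z / z) \<longlongrightarrow> 0) (at_right 0)"
    by (rule Lim_transform_eventually)
       (auto simp: eventually_at_right_field flat_def divide_inverse intro: exI[of _ 1])
qed

text \<open>With t = 1/z one has dt/dz = -t^2, and differentiating P(t) exp(-t) gives t^2 (P -
  P')(t) exp(-t).\<close>

lemma has_real_derivative_flat:
  "(flat P has_real_derivative flat ([:0, 0, 1:] * (P - pderiv P)) z) (at z)"
proof -
  consider "z > 0" | "z < 0" | "z = 0" by linarith
  then show ?thesis
  proof cases
    case 1
    have "((\<lambda>z. poly P (1 / z) * exp (- (1 / z))) has_real_derivative
        flat ([:0, 0, 1:] * (P - pderiv P)) z) (at z)"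
      using 1 by (auto intro!: derivative_eq_intros DERIV_chain2[OF poly_DERIV]
          simp: flat_def field_simps power2_eq_square)
    then show ?thesis
      by (rule has_field_derivative_transform_within_open[where S = "{0<..}"])
         (use 1 in \<open>auto simp: flat_def\<close>)
  next
    case 2
    have "((\<lambda>z. 0) has_real_derivative flat ([:0, 0, 1:] * (P - pderiv P)) z) (at z)"
      using 2 by (simp add: flat_def)
    then show ?thesis
      by (rule has_field_derivative_transform_within_open[where S = "{..<0}"])
         (use 2 in \<open>auto simp: flat_def\<close>)
  next
    case 3
    then show ?thesis
      using flat_over_tendsto_0[of P] by (simp add: has_field_derivative_iff flat_def)
  qed
qed

lemma smooth_on_flat:
  assumes "open U" "smooth_on U g"
  shows "smooth_on U (\<lambda>x. flat P (g x))"
proof (rule smooth_on_compose_family[OF assms, where F = "range flat"])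
  fix \<phi> assume "\<phi> \<in> range flat"
  then obtain P where P: "\<phi> = flat P" by blast
  show "\<exists>d. (\<forall>x\<in>U. (\<phi> has_real_derivative d x) (at (g x))) \<and>
      d \<in> alg ({f. smooth_on U f} \<union> (\<lambda>\<phi> x. \<phi> (g x)) ` range flat)"
    unfolding P using has_real_derivative_flat[of P]
    by (intro exI[of _ "\<lambda>x. flat ([:0, 0, 1:] * (P - pderiv P)) (g x)"]) (auto intro!: alg_base)
qed auto

lemma flat_1: "flat 1 z = (if z > 0 then exp (- (1 / z)) else 0)"
  by (simp add: flat_def)

definition bump :: "real \<Rightarrow> real" where
  "bump z = flat 1 z * flat 1 (1 - z)"

lemma bump_nonneg: "0 \<le> bump z" and bump_le_1: "bump z \<le> 1"
  and bump_pos: "0 < z \<Longrightarrow> z < 1 \<Longrightarrow> 0 < bump z"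
  and bump_eq_0: "\<not> (0 < z \<and> z < 1) \<Longrightarrow> bump z = 0"
  by (auto simp: bump_def flat_1 mult_le_one)

text \<open>Written out so that it can be bounded: up to \<open>bump_mass\<close> it is the second
  derivative of \<open>step\<close>.\<close>

definition bump' :: "real \<Rightarrow> real" where
  "bump' z = flat [:0, 0, 1:] z * flat 1 (1 - z) - flat 1 z * flat [:0, 0, 1:] (1 - z)"

lemma has_real_derivative_bump: "(bump has_real_derivative bump' z) (at z)"
proof -
  have f: "(flat 1 has_real_derivative flat [:0, 0, 1:] z) (at z)" for z
    using has_real_derivative_flat[of 1 z] by simp
  have g: "((\<lambda>z. flat 1 (1 - z)) has_real_derivative flat [:0, 0, 1:] (1 - z) * (- 1)) (at z)"
    by (rule DERIV_chain2[OF f]) (auto intro!: derivative_eq_intros)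
  show ?thesis
    using DERIV_mult[OF f g] unfolding bump_def[abs_def] bump'_def by (simp add: algebra_simps)
qed

lemma continuous_on_flat: "continuous_on A (flat P)"
  using has_real_derivative_flat DERIV_isCont continuous_at_imp_continuous_on by blast

lemma continuous_on_bump: "continuous_on A bump"
  using has_real_derivative_bump DERIV_isCont continuous_at_imp_continuous_on by blast

lemma continuous_on_bump': "continuous_on A bump'"
  unfolding bump'_def
  by (intro continuous_intros continuous_on_compose2[OF continuous_on_flat[of UNIV]]) auto

lemma bump'_eq_0: "\<not> (0 < z \<and> z < 1) \<Longrightarrow> bump' z = 0"
  by (auto simp: bump'_def flat_def)

lemma smooth_on_bump: "open U \<Longrightarrow> smooth_on U g \<Longrightarrow> smooth_on U (\<lambda>x. bump (g x))"
  unfolding bump_def by (intro smooth_on_mult smooth_on_flat smooth_on_diff) auto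

definition bump_mass :: real where
  "bump_mass = integral {0..1} bump"

lemma bump_mass_pos: "bump_mass > 0"
proof -
  have "bump_mass \<ge> 0" unfolding bump_mass_def
    by (intro integral_nonneg integrable_continuous_interval continuous_on_bump bump_nonneg)
  moreover have "bump_mass \<noteq> 0"
  proof
    assume "bump_mass = 0"
    then have "bump (1/2) = 0"
      unfolding bump_mass_def
      using integral_eq_0_iff[OF continuous_on_bump[of "{0..1}"]] bump_nonneg by auto
    then show False using bump_pos[of "1/2"] by auto
  qed
  ultimately show ?thesis by simp
qed

text \<open>Defining the step as an antiderivative keeps its derivatives explicit.\<close>

definition step :: "real \<Rightarrow> real" where
  "step z = integral {0..z} bump / bump_mass"

lemma step_le_0: "z \<le> 0 \<Longrightarrow> step z = 0"
  unfolding step_def by (cases "z = 0") auto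

lemma integral_bump_split: "0 \<le> a \<Longrightarrow> a \<le> b \<Longrightarrow>
    integral {0..b} bump = integral {0..a} bump + integral {a..b} bump"
  by (rule Henstock_Kurzweil_Integration.integral_combine[symmetric])
     (auto intro: integrable_continuous_interval continuous_on_bump)

lemma step_ge_1: assumes "z \<ge> 1" shows "step z = 1"
proof -
  have "integral {1..z} bump = integral {1..z} (\<lambda>_. 0)"
    by (rule integral_cong) (auto simp: bump_eq_0)
  then show ?thesis
    using integral_bump_split[of 1 z] assms bump_mass_pos
    by (simp add: step_def bump_mass_def)
qed

lemma has_real_derivative_step: "(step has_real_derivative bump z / bump_mass) (at z)"
proof (cases "z < 0")
  case True
  have "((\<lambda>_. 0) has_real_derivative bump z / bump_mass) (at z)" using True by (simp add: bump_eq_0)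
  then show ?thesis
    by (rule has_field_derivative_transform_within_open[where S = "{..<0}"])
       (use True in \<open>auto simp: step_le_0\<close>)
next
  case False
  \<comment> \<open>Moving the base point from 0 to -1, where \<open>bump\<close> adds no mass,
    makes z = 0 an interior point and the derivative two-sided.\<close>
  have eq: "step y = integral {-1..y} bump / bump_mass" if "y > -1" for y
  proof (cases "y \<ge> 0")
    case True
    have "integral {-1..y} bump = integral {-1..0} bump + integral {0..y} bump"
      by (rule Henstock_Kurzweil_Integration.integral_combine[symmetric])
        (use True in \<open>auto intro: integrable_continuous_interval continuous_on_bump\<close>)
    moreover have "integral {-1..0} bump = integral {-1..0::real} (\<lambda>_. 0)"
      by (rule integral_cong) (auto simp: bump_eq_0)
    ultimately show ?thesis by (simp add: step_def)
  next
    case False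
    then have "integral {-1..y} bump = integral {-1..y} (\<lambda>_. 0)"
      by (intro integral_cong) (auto simp: bump_eq_0)
    then show ?thesis using False by (simp add: step_le_0)
  qed
  have "((\<lambda>y. integral {-1..y} bump) has_real_derivative bump z) (at z within {-1..z+1})"
    by (rule integral_has_real_derivative[OF continuous_on_bump]) (use False in auto)
  then have "((\<lambda>y. integral {-1..y} bump) has_real_derivative bump z) (at z)"
    using False by (metis at_within_Icc_at less_add_one linorder_not_less neg_less_0_iff_less
        order_less_le_trans zero_less_one)
  then have "((\<lambda>y. integral {-1..y} bump / bump_mass) has_real_derivative bump z / bump_mass) (at z)"
    by (rule DERIV_cdivide)
  then show ?thesis
    by (rule has_field_derivative_transform_within_open[where S = "{-1<..}"])
       (use False in \<open>auto simp: eq\<close>)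
qed

lemma step_mono: "y \<le> z \<Longrightarrow> step y \<le> step z"
  using DERIV_nonneg_imp_nondecreasing[of y z step] has_real_derivative_step bump_nonneg bump_mass_pos
  by (meson divide_nonneg_pos)

lemma step_nonneg: "0 \<le> step z" and step_le_1: "step z \<le> 1"
  using step_mono[of "min z 0" z] step_mono[of z "max z 1"]
  by (simp_all add: step_le_0 step_ge_1)

lemma smooth_on_step:
  assumes "open U" "smooth_on U g"
  shows "smooth_on U (\<lambda>x. step (g x))"
proof (rule smooth_on_compose[OF assms, where d = "\<lambda>x. bump (g x) * inverse bump_mass"])
  show "(step has_real_derivative bump (g x) * inverse bump_mass) (at (g x))" for x
    using has_real_derivative_step by (simp add: divide_inverse)
qed (use assms in \<open>auto intro!: alg_base smooth_on_mult smooth_on_bump\<close>)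

text \<open>The two quotients are the first and second derivatives of \<open>step\<close>. They are
  bounded because \<open>bump'\<close> is continuous and vanishes outside the unit interval.\<close>

lemma step_derivs_bounded:
  obtains K where "K \<ge> 1" "\<And>z. \<bar>bump z / bump_mass\<bar> \<le> K" "\<And>z. \<bar>bump' z / bump_mass\<bar> \<le> K"
proof -
  have "compact (bump' ` {0..1})"
    by (intro compact_continuous_image continuous_on_bump') auto
  then obtain B where B: "\<And>z. z \<in> {0..1} \<Longrightarrow> \<bar>bump' z\<bar> \<le> B"
    using compact_imp_bounded bounded_iff by (metis imageI real_norm_def)
  then have B': "\<bar>bump' z\<bar> \<le> \<bar>B\<bar>" for z
    using bump'_eq_0[of z] by (cases "z \<in> {0..1}") (force, auto)
  show ?thesis
  proof
    show "\<bar>bump z / bump_mass\<bar> \<le> (1 + \<bar>B\<bar>) / bump_mass + 1" for z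
      using bump_nonneg[of z] bump_le_1[of z] bump_mass_pos
      by (auto simp: field_simps abs_if)
    show "\<bar>bump' z / bump_mass\<bar> \<le> (1 + \<bar>B\<bar>) / bump_mass + 1" for z
      using B'[of z] bump_mass_pos by (simp add: field_simps abs_mult)
  qed (use bump_mass_pos in auto)
qed

section \<open>Integration by parts\<close>

lemma has_real_derivative_along_axis:
  fixes F :: "real^'n::finite \<Rightarrow> real"
  assumes "F differentiable (at (x + s *\<^sub>R axis i 1))"
  shows "((\<lambda>s. F (x + s *\<^sub>R axis i 1)) has_real_derivative
    partial_deriv i F (x + s *\<^sub>R axis i 1)) (at s)"
proof -
  let ?D = "frechet_derivative F (at (x + s *\<^sub>R axis i 1))"
  have F: "(F has_derivative ?D) (at (x + s *\<^sub>R axis i 1))"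
    using assms by (rule has_derivative_frechet)
  have "((\<lambda>s. x + s *\<^sub>R axis i 1) has_derivative (\<lambda>h. h *\<^sub>R axis i (1::real))) (at s)"
    by (auto intro!: derivative_eq_intros)
  from has_derivative_compose[OF this F]
  have "((\<lambda>s. F (x + s *\<^sub>R axis i 1)) has_derivative (\<lambda>h. ?D (h *\<^sub>R axis i 1))) (at s)" .
  moreover have "?D (h *\<^sub>R axis i 1) = partial_deriv i F (x + s *\<^sub>R axis i 1) * h" for h
    using linear_cmul[OF has_derivative_linear[OF F], of h]
    by (simp add: partial_deriv_def mult.commute)
  ultimately show ?thesis
    by (simp add: has_field_derivative_def)
qed

lemma partial_deriv_diff_quotient_bound:
  fixes F :: "real^'n::finite \<Rightarrow> real"
  assumes "\<And>x. F differentiable (at x)" "\<And>x. \<bar>partial_deriv i F x\<bar> \<le> K" "h > 0"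
  shows "\<bar>(F (x + h *\<^sub>R axis i 1) - F x) / h\<bar> \<le> K"
proof -
  obtain z where "F (x + h *\<^sub>R axis i 1) - F (x + 0 *\<^sub>R axis i 1)
      = (h - 0) * partial_deriv i F (x + z *\<^sub>R axis i 1)"
    using MVT2[OF assms(3), of "\<lambda>s. F (x + s *\<^sub>R axis i 1)"
        "\<lambda>s. partial_deriv i F (x + s *\<^sub>R axis i 1)"] has_real_derivative_along_axis[OF assms(1)]
    by blast
  then show ?thesis using assms(2,3) by simp
qed

lemma integrable_continuous_compact_support:
  fixes F :: "real^'n::finite \<Rightarrow> real"
  assumes "continuous_on UNIV F" "\<And>x. r < norm x \<Longrightarrow> F x = 0"
  shows "integrable lborel F"
proof -
  have "integrable lborel (\<lambda>x. indicator (cball 0 r) x *\<^sub>R F x)"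
    by (intro borel_integrable_compact continuous_on_subset[OF assms(1)]) auto
  moreover have "(\<lambda>x. indicator (cball 0 r) x *\<^sub>R F x) = F"
    using assms(2) by (auto simp: fun_eq_iff indicator_def)
  ultimately show ?thesis by simp
qed

lemma partial_deriv_eq_0_outside:
  assumes "\<And>x. r < norm x \<Longrightarrow> F x = 0" "r < norm x"
  shows "partial_deriv i F x = 0"
proof -
  have "open {x::real^'n. r < norm x}"
    by (intro open_Collect_less continuous_intros)
  then show ?thesis
    using partial_deriv_cong[of "{x. r < norm x}" x F "\<lambda>_. 0" i] assms by simp
qed

lemma continuous_compact_support_bounded:
  fixes F :: "real^'n::finite \<Rightarrow> real"
  assumes "continuous_on UNIV F" "\<And>x. r < norm x \<Longrightarrow> F x = 0"
  shows "\<exists>K\<ge>0. \<forall>x. \<bar>F x\<bar> \<le> K"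
proof -
  have "compact (F ` cball 0 r)"
    by (intro compact_continuous_image continuous_on_subset[OF assms(1)]) auto
  then obtain B where B: "\<And>x. x \<in> cball 0 r \<Longrightarrow> \<bar>F x\<bar> \<le> B"
    using compact_imp_bounded bounded_iff by (metis imageI real_norm_def)
  have "\<bar>F x\<bar> \<le> \<bar>B\<bar>" for x
    using B[of x] assms(2)[of x] by (cases "x \<in> cball 0 r") auto
  then show ?thesis by (intro exI[of _ "\<bar>B\<bar>"]) auto
qed

text \<open>The difference quotients of \<open>F\<close> integrate to \<open>0\<close> by translation invariance.\<close>

lemma integral_partial_deriv_eq_0:
  fixes F :: "real^'n::finite \<Rightarrow> real"
  assumes diff: "\<And>x. F differentiable (at x)"
    and cont: "continuous_on UNIV (partial_deriv i F)"
    and supp: "\<And>x. r < norm x \<Longrightarrow> F x = 0"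
  shows "integral\<^sup>L lebesgue (partial_deriv i F) = 0"
proof -
  have contF: "continuous_on UNIV F"
    using diff by (simp add: continuous_at_imp_continuous_on differentiable_imp_continuous_within)
  have supp': "r < norm x \<Longrightarrow> partial_deriv i F x = 0" for x
    by (rule partial_deriv_eq_0_outside[OF supp])
  obtain K where K: "K \<ge> 0" "\<And>x. \<bar>partial_deriv i F x\<bar> \<le> K"
    using continuous_compact_support_bounded[OF cont, of r] supp' by auto
  have intF: "integrable lborel F" by (rule integrable_continuous_compact_support[OF contF supp])
  define h where "h n = inverse (real (Suc n))" for n
  have h: "h n > 0" "h n \<le> 1" for n by (auto simp: h_def field_simps)
  have h0: "h \<longlonglongrightarrow> 0" unfolding h_def by (rule LIMSEQ_inverse_real_of_nat)
  define D where "D n x = (F (x + h n *\<^sub>R axis i 1) - F x) / h n" for n x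
  have shift: "integrable lborel (\<lambda>x. F (x + c))" "(\<integral>x. F (x + c) \<partial>lborel) = (\<integral>x. F x \<partial>lborel)" for c
  proof -
    have "integrable (distr lborel borel ((+) c)) F" using intF by (simp add: lborel_distr_plus)
    then show "integrable lborel (\<lambda>x. F (x + c))"
      by (subst (asm) integrable_distr_eq) (use intF in \<open>auto simp: add.commute\<close>)
    have "(\<integral>x. F x \<partial>distr lborel borel ((+) c)) = (\<integral>x. F (c + x) \<partial>lborel)"
      by (rule integral_distr) (use intF in auto)
    then show "(\<integral>x. F (x + c) \<partial>lborel) = (\<integral>x. F x \<partial>lborel)"
      by (simp add: lborel_distr_plus add.commute)
  qed
  have D0: "integral\<^sup>L lborel (D n) = 0" for n
    unfolding D_def using shift intF by simp
  \<comment> \<open>Dominated convergence: the quotients are at most \<open>K\<close> by the mean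
    value theorem, and \<open>h n \<le> 1\<close> makes them vanish outside the ball of radius
    \<open>r + 1\<close>.\<close>
  have "(\<lambda>n. integral\<^sup>L lborel (D n)) \<longlonglongrightarrow> integral\<^sup>L lborel (partial_deriv i F)"
  proof (rule integral_dominated_convergence[where w = "\<lambda>x. indicator (cball 0 (r + 1)) x *\<^sub>R K"])
    show "partial_deriv i F \<in> borel_measurable lborel"
      using cont by (simp add: borel_measurable_continuous_onI)
    show "D n \<in> borel_measurable lborel" for n
      unfolding D_def using shift intF by (intro borel_measurable_divide borel_measurable_diff) auto
    show "integrable lborel (\<lambda>x. indicator (cball 0 (r + 1)) x *\<^sub>R K)"
      by (intro borel_integrable_compact) auto
    have "(\<lambda>n. D n x) \<longlonglongrightarrow> partial_deriv i F x" for x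
    proof -
      have "((\<lambda>s. (F (x + s *\<^sub>R axis i 1) - F x) / s) \<longlongrightarrow> partial_deriv i F x) (at 0)"
        using has_real_derivative_along_axis[of F x 0 i] diff
        by (simp add: has_field_derivative_iff)
      moreover have "filterlim h (at 0) sequentially"
        using h0 h(1) by (simp add: filterlim_at less_imp_neq[symmetric])
      ultimately show ?thesis
        unfolding D_def by (rule filterlim_compose)
    qed
    then show "AE x in lborel. (\<lambda>n. D n x) \<longlonglongrightarrow> partial_deriv i F x" by simp
    have "norm (D n x) \<le> indicator (cball 0 (r + 1)) x *\<^sub>R K" for n x
    proof (cases "norm x \<le> r + 1")
      case True
      then show ?thesis
        using partial_deriv_diff_quotient_bound[OF diff K(2) h(1)] by (simp add: D_def)
    next
      case False
      have "norm x \<le> norm (x + h n *\<^sub>R axis i 1) + norm (h n *\<^sub>R axis i (1::real) :: real^'n)"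
        by (metis add_diff_cancel norm_triangle_ineq4)
      also have "norm (h n *\<^sub>R axis i (1::real) :: real^'n) \<le> 1" using h[of n] by simp
      finally have "r < norm (x + h n *\<^sub>R axis i 1)" using False by simp
      then show ?thesis using False supp by (simp add: D_def)
    qed
    then show "AE x in lborel. norm (D n x) \<le> indicator (cball 0 (r + 1)) x *\<^sub>R K" for n by simp
  qed
  then have "integral\<^sup>L lborel (partial_deriv i F) = 0"
    using D0 by (simp add: LIMSEQ_const_iff)
  then show ?thesis
    using cont by (simp add: integral_completion borel_measurable_continuous_onI)
qed

section \<open>Weak derivatives of functions with small singular sets\<close>

lemma closed_supp: "closed (supp f)" and supp_eq_0: "x \<notin> supp f \<Longrightarrow> f x = 0"
  unfolding supp_def using closure_subset[of "support_on UNIV f"] by (auto simp: support_on_def)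

lemma supp_subset: "closed C \<Longrightarrow> (\<And>x. x \<notin> C \<Longrightarrow> f x = 0) \<Longrightarrow> supp f \<subseteq> C"
  unfolding supp_def by (rule closure_minimal) (auto simp: support_on_def)

lemma test_functionI:
  assumes "smooth_on UNIV \<phi>" "compact K" "K \<subseteq> \<Omega>" "\<And>x. x \<notin> K \<Longrightarrow> \<phi> x = 0"
  shows "test_function \<Omega> \<phi>"
proof -
  have "supp \<phi> \<subseteq> K" using assms by (intro supp_subset compact_imp_closed)
  then show ?thesis
    unfolding test_function_def using assms closed_supp
    by (metis compact_Int_closed dual_order.trans inf.absorb_iff2)
qed

lemma test_function_partial_deriv:
  assumes "test_function \<Omega> \<phi>"
  shows "test_function \<Omega> (partial_deriv i \<phi>)"
proof (rule test_functionI[where K = "supp \<phi>"])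
  have "open (- supp \<phi>)" using closed_supp by auto
  then have "partial_deriv i \<phi> x = partial_deriv i (\<lambda>_. 0) x" if "x \<notin> supp \<phi>" for x
    by (rule partial_deriv_cong) (use supp_eq_0 that in auto)
  then show "partial_deriv i \<phi> x = 0" if "x \<notin> supp \<phi>" for x
    using that by simp
qed (use assms in \<open>auto simp: test_function_def smooth_on_partial_deriv\<close>)

lemma test_function_outside:
  assumes "test_function \<Omega> \<phi>"
  obtains r where "\<And>x. r < norm x \<Longrightarrow> \<phi> x = 0"
proof -
  obtain r where "\<And>x. x \<in> supp \<phi> \<Longrightarrow> norm x \<le> r"
    using assms compact_imp_bounded bounded_iff unfolding test_function_def by metis
  then show ?thesis using that supp_eq_0 by (metis linorder_not_less)
qed

lemma borel_measurable_lebesgue_continuous: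
  "continuous_on UNIV (F :: real^'n::finite \<Rightarrow> real) \<Longrightarrow> F \<in> borel_measurable lebesgue"
  by (simp add: borel_measurable_continuous_onI measurable_completion)

lemma integrable_locally_integrable_mult:
  fixes f \<phi> :: "real^'n::finite \<Rightarrow> real"
  assumes "locally_integrable_on f UNIV" "continuous_on UNIV \<phi>" "\<And>x. r < norm x \<Longrightarrow> \<phi> x = 0"
  shows "integrable lebesgue (\<lambda>x. f x * \<phi> x)"
proof -
  have f: "integrable lebesgue (\<lambda>x. indicator (cball 0 r) x *\<^sub>R f x)"
    using assms(1) unfolding locally_integrable_on_def set_integrable_def by auto
  obtain B where B: "\<And>x. \<bar>\<phi> x\<bar> \<le> B" "B \<ge> 0"
    using continuous_compact_support_bounded[OF assms(2), of r] assms(3) by auto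
  have eq: "f x * \<phi> x = (indicator (cball 0 r) x *\<^sub>R f x) * \<phi> x" for x
    using assms(3)[of x] by (auto simp: indicator_def)
  show ?thesis
  proof (rule Bochner_Integration.integrable_bound)
    show "integrable lebesgue (\<lambda>x. (indicator (cball 0 r) x *\<^sub>R f x) * B)"
      using f by (rule integrable_mult_left)
    show "(\<lambda>x. f x * \<phi> x) \<in> borel_measurable lebesgue"
      unfolding eq using f borel_measurable_lebesgue_continuous[OF assms(2)]
      by (intro borel_measurable_times) auto
    show "AE x in lebesgue. norm (f x * \<phi> x) \<le> norm ((indicator (cball 0 r) x *\<^sub>R f x) * B)"
      unfolding eq using B by (intro AE_I2) (auto simp: abs_mult intro: mult_left_mono)
  qed
qed

lemma LINT_UNIV: "(LINT x:UNIV|M. h x) = (LINT x|M. h x)"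
  by (simp add: set_lebesgue_integral_def)

text \<open>The set \<open>{q = 0}\<close> is cut out by \<open>step (n\<^sup>2 q - 1)\<close>, whose gradient is of size \<open>n\<close> and
  lives where \<open>1 \<le> n\<^sup>2 q \<le> 2\<close>.\<close>

lemma has_weak_deriv_off_zeros:
  fixes q f g :: "real^'n::finite \<Rightarrow> real"
  assumes q: "smooth_on UNIV q" "\<And>x. 0 \<le> q x" "\<And>x. \<bar>partial_deriv i q x\<bar> \<le> 2 * sqrt (q x)"
    and f: "\<And>x. q x > 0 \<Longrightarrow> f differentiable (at x)"
    and fg: "\<And>x. q x > 0 \<Longrightarrow> partial_deriv i f x = g x"
    and g: "continuous_on {x. q x > 0} g"
    and null: "negligible {x. q x = 0}"
    and int: "locally_integrable_on f UNIV" "locally_integrable_on g UNIV"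
    and decay: "\<And>r. \<exists>s. (\<forall>n::nat. \<forall>x. norm x \<le> r \<longrightarrow> 1 \<le> (real n)\<^sup>2 * q x \<longrightarrow>
          (real n)\<^sup>2 * q x \<le> 2 \<longrightarrow> \<bar>f x\<bar> \<le> s n) \<and>
        (\<lambda>n. real n * s n * measure lebesgue {x. norm x \<le> r \<and> (real n)\<^sup>2 * q x \<le> 2}) \<longlonglongrightarrow> 0"
  shows "has_weak_deriv UNIV [i] f g"
  unfolding has_weak_deriv_def LINT_UNIV
proof (intro conjI int allI impI)
  fix \<phi> :: "real^'n \<Rightarrow> real" assume \<phi>: "test_function UNIV \<phi>"
  then have \<phi>s: "smooth_on UNIV \<phi>" by (simp add: test_function_def)
  obtain r where r: "\<And>x. r < norm x \<Longrightarrow> \<phi> x = 0" using test_function_outside[OF \<phi>] by blast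
  have r': "\<And>x. r < norm x \<Longrightarrow> partial_deriv i \<phi> x = 0"
    by (rule partial_deriv_eq_0_outside[OF r])
  note smooth_cont = smooth_on_imp_continuous_on[of UNIV]
  obtain B where B: "B \<ge> 0" "\<And>x. \<bar>\<phi> x\<bar> \<le> B"
    using continuous_compact_support_bounded[OF smooth_cont[OF \<phi>s], of r] r by auto
  obtain K where K: "K \<ge> 1" "\<And>z. \<bar>bump z / bump_mass\<bar> \<le> K" using step_derivs_bounded by metis
  obtain s where s: "\<And>(n::nat) x. norm x \<le> r \<Longrightarrow> 1 \<le> (real n)\<^sup>2 * q x \<Longrightarrow>
          (real n)\<^sup>2 * q x \<le> 2 \<Longrightarrow> \<bar>f x\<bar> \<le> s n"
    and lim: "(\<lambda>n. real n * s n * measure lebesgue {x. norm x \<le> r \<and> (real n)\<^sup>2 * q x \<le> 2}) \<longlonglongrightarrow> 0"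
    using decay[of r] by auto
  define \<zeta> where "\<zeta> n x = step ((real n)\<^sup>2 * q x - 1)" for n :: nat and x
  define \<zeta>' where "\<zeta>' n x = bump ((real n)\<^sup>2 * q x - 1) / bump_mass * ((real n)\<^sup>2 * partial_deriv i q x)"
    for n :: nat and x
  have dq: "q differentiable (at x)" for x using smooth_on_imp_differentiable[OF q(1)] by auto
  have d\<phi>: "\<phi> differentiable (at x)" for x using smooth_on_imp_differentiable[OF \<phi>s] by auto
  have s\<zeta>: "smooth_on UNIV (\<zeta> n)" for n
    unfolding \<zeta>_def by (intro smooth_on_step smooth_on_diff smooth_on_mult q) auto
  have d\<zeta>: "\<zeta> n differentiable (at x)" for n x using smooth_on_imp_differentiable[OF s\<zeta>] by auto
  have p\<zeta>: "partial_deriv i (\<zeta> n) x = \<zeta>' n x" for n x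
  proof -
    have "((\<lambda>z. step ((real n)\<^sup>2 * z - 1)) has_real_derivative
        bump ((real n)\<^sup>2 * q x - 1) / bump_mass * (real n)\<^sup>2) (at (q x))"
      by (rule DERIV_chain2[OF has_real_derivative_step]) (auto intro!: derivative_eq_intros)
    from partial_deriv_compose[OF dq this] show ?thesis
      unfolding \<zeta>_def \<zeta>'_def by (simp add: mult.assoc)
  qed
  have c\<zeta>': "continuous_on UNIV (\<zeta>' n)" for n
    using smooth_cont[OF smooth_on_partial_deriv[OF s\<zeta>, of i]] p\<zeta> by (simp cong: continuous_on_cong)
  define \<psi> where "\<psi> n x = \<phi> x * \<zeta> n x" for n x
  define \<psi>' where "\<psi>' n x = \<phi> x * \<zeta>' n x + partial_deriv i \<phi> x * \<zeta> n x" for n x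
  have p\<psi>: "partial_deriv i (\<psi> n) x = \<psi>' n x" for n x
    unfolding \<psi>_def \<psi>'_def using partial_deriv_mult[OF d\<phi> d\<zeta>] p\<zeta> by simp
  have s\<psi>: "smooth_on UNIV (\<psi> n)" for n unfolding \<psi>_def by (intro smooth_on_mult s\<zeta> \<phi>s) auto
  have d\<psi>: "\<psi> n differentiable (at x)" for n x using smooth_on_imp_differentiable[OF s\<psi>] by auto
  have c\<psi>': "continuous_on UNIV (\<psi>' n)" for n
    using smooth_cont[OF smooth_on_partial_deriv[OF s\<psi>, of i]] p\<psi> by (simp cong: continuous_on_cong)
  have z: "\<psi> n x = 0" "\<psi>' n x = 0" if "(real n)\<^sup>2 * q x < 1" for n x
    using that by (auto simp: \<psi>_def \<psi>'_def \<zeta>_def \<zeta>'_def step_le_0 bump_eq_0)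
  have contq: "continuous_on UNIV q" by (rule smooth_cont[OF q(1)])
  have H0: "(\<integral>x. f x * \<psi>' n x + g x * \<psi> n x \<partial>lebesgue) = 0" for n :: nat
  proof -
    define F where "F x = f x * \<psi> n x" for x
    have V: "open {x. (real n)\<^sup>2 * q x < 1}" by (intro open_Collect_less continuous_intros contq)
    have P: "open {x. q x > 0}" by (intro open_Collect_less continuous_intros contq)
    \<comment> \<open>Near a zero of \<open>q\<close> the cut-off is 0, so \<open>F\<close> is
      differentiable there whatever \<open>f\<close> does; elsewhere \<open>f\<close> is
      differentiable.\<close>
    have cover: "{x. q x > 0} \<union> {x. (real n)\<^sup>2 * q x < 1} = UNIV"
    proof -
      have "q x > 0 \<or> (real n)\<^sup>2 * q x < 1" for x using q(2)[of x] by (cases "q x = 0") auto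
      then show ?thesis by auto
    qed
    have 1: "F differentiable (at x) \<and> partial_deriv i F x = f x * \<psi>' n x + g x * \<psi> n x" for x
    proof (cases "q x > 0")
      case True
      then show ?thesis
        unfolding F_def using f[OF True] d\<psi> fg[OF True] p\<psi>
        by (simp add: partial_deriv_mult)
    next
      case False
      then have "q x = 0" using q(2)[of x] by auto
      then have x: "x \<in> {x. (real n)\<^sup>2 * q x < 1}" by simp
      have "F differentiable (at x)"
        by (rule differentiable_cong_open[OF V x, of _ "\<lambda>_. 0"]) (auto simp: F_def z)
      moreover have "partial_deriv i F x = partial_deriv i (\<lambda>_. 0) x"
        by (rule partial_deriv_cong[OF V x]) (auto simp: F_def z)
      ultimately show ?thesis using x z by simp
    qed
    have "continuous_on {x. q x > 0} f"
      using f by (simp add: continuous_at_imp_continuous_on differentiable_imp_continuous_within)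
    then have "continuous_on {x. q x > 0} (\<lambda>x. f x * \<psi>' n x + g x * \<psi> n x)"
      using g continuous_on_subset[OF c\<psi>'] continuous_on_subset[OF smooth_cont[OF s\<psi>]]
      by (intro continuous_intros) auto
    moreover have "continuous_on {x. (real n)\<^sup>2 * q x < 1} (\<lambda>x. f x * \<psi>' n x + g x * \<psi> n x)"
      by (rule continuous_on_eq[OF continuous_on_const[of _ 0]]) (auto simp: z)
    ultimately have "continuous_on ({x. q x > 0} \<union> {x. (real n)\<^sup>2 * q x < 1})
        (\<lambda>x. f x * \<psi>' n x + g x * \<psi> n x)"
      by (rule continuous_on_open_Un[OF P V])
    moreover have pF: "partial_deriv i F = (\<lambda>x. f x * \<psi>' n x + g x * \<psi> n x)" using 1 by blast
    ultimately have "continuous_on UNIV (partial_deriv i F)" unfolding cover by simp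
    then have "integral\<^sup>L lebesgue (partial_deriv i F) = 0"
      by (rule integral_partial_deriv_eq_0[rotated, where r = r]) (use 1 r in \<open>auto simp: F_def \<psi>_def\<close>)
    then show ?thesis unfolding pF .
  qed
  note int_f = integrable_locally_integrable_mult[OF int(1)]
  note int_g = integrable_locally_integrable_mult[OF int(2)]
  have c\<phi>: "continuous_on UNIV \<phi>" "continuous_on UNIV (partial_deriv i \<phi>)"
    using smooth_cont \<phi>s smooth_on_partial_deriv by auto
  have c\<zeta>: "continuous_on UNIV (\<zeta> n)" for n by (rule smooth_cont[OF s\<zeta>])
  have i1: "integrable lebesgue (\<lambda>x. g x * (\<phi> x * \<zeta> n x))"
    and i2: "integrable lebesgue (\<lambda>x. f x * (partial_deriv i \<phi> x * \<zeta> n x))"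
    and i3: "integrable lebesgue (\<lambda>x. f x * (\<phi> x * \<zeta>' n x))" for n
    by (auto intro!: int_f[where r = r] int_g[where r = r] continuous_on_mult c\<phi> c\<zeta> c\<zeta>' simp: r r')
  have sum0: "(\<integral>x. g x * (\<phi> x * \<zeta> n x) \<partial>lebesgue) + (\<integral>x. f x * (partial_deriv i \<phi> x * \<zeta> n x) \<partial>lebesgue)
      + (\<integral>x. f x * (\<phi> x * \<zeta>' n x) \<partial>lebesgue) = 0" for n
    using H0[of n] i1[of n] i2[of n] i3[of n]
    by (simp add: \<psi>_def \<psi>'_def distrib_left algebra_simps)
  have "AE x in lebesgue. q x \<noteq> 0"
    using null unfolding negligible_iff_null_sets
    by (intro AE_I'[of "{x. q x = 0}"]) auto
  then have conv: "AE x in lebesgue. (\<lambda>n. \<zeta> n x) \<longlonglongrightarrow> 1"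
  proof eventually_elim
    case (elim x)
    have "eventually (\<lambda>n. \<zeta> n x = 1) sequentially"
    proof -
      have "filterlim (\<lambda>n. (real n)\<^sup>2) at_top sequentially"
        by (intro filterlim_pow_at_top filterlim_real_sequentially) auto
      then have "eventually (\<lambda>n. (real n)\<^sup>2 \<ge> 2 / q x) sequentially"
        by (simp add: filterlim_at_top)
      then show ?thesis
      proof eventually_elim
        case (elim n)
        then have "(real n)\<^sup>2 * q x \<ge> 2" using \<open>q x \<noteq> 0\<close> q(2)[of x] by (simp add: field_simps)
        then show ?case by (simp add: \<zeta>_def step_ge_1)
      qed
    qed
    then show ?case by (rule tendsto_eventually)
  qed
  have lim1: "(\<lambda>n. \<integral>x. h x * (k x * \<zeta> n x) \<partial>lebesgue) \<longlonglongrightarrow> (\<integral>x. h x * k x \<partial>lebesgue)"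
    if hk: "integrable lebesgue (\<lambda>x. h x * k x)" for h k
  proof (rule integral_dominated_convergence[where w = "\<lambda>x. \<bar>h x * k x\<bar>"])
    show "AE x in lebesgue. (\<lambda>n. h x * (k x * \<zeta> n x)) \<longlonglongrightarrow> h x * k x"
      using conv
    proof eventually_elim
      case (elim x)
      have "(\<lambda>n. h x * (k x * \<zeta> n x)) \<longlonglongrightarrow> h x * (k x * 1)" by (intro tendsto_intros elim)
      then show ?case by simp
    qed
    show "AE x in lebesgue. norm (h x * (k x * \<zeta> n x)) \<le> \<bar>h x * k x\<bar>" for n
      by (intro AE_I2) (auto simp: \<zeta>_def abs_mult step_nonneg step_le_1 mult_left_le mult.assoc[symmetric])
    show "(\<lambda>x. h x * (k x * \<zeta> n x)) \<in> borel_measurable lebesgue" for n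
      unfolding mult.assoc[symmetric]
      by (rule borel_measurable_times[OF borel_measurable_integrable[OF hk]
            borel_measurable_lebesgue_continuous[OF c\<zeta>]])
  qed (use hk in auto)
  let ?S = "\<lambda>n. {x. norm x \<le> r \<and> (real n)\<^sup>2 * q x \<le> 2}"
  have S: "?S n \<in> lmeasurable" for n
  proof -
    have "closed {x. (real n)\<^sup>2 * q x \<le> 2}" by (intro closed_Collect_le continuous_intros contq)
    then have "compact (cball 0 r \<inter> {x. (real n)\<^sup>2 * q x \<le> 2})" by (intro compact_Int_closed) auto
    then have "cball 0 r \<inter> {x. (real n)\<^sup>2 * q x \<le> 2} \<in> lmeasurable" by (rule lmeasurable_compact)
    moreover have "cball 0 r \<inter> {x. (real n)\<^sup>2 * q x \<le> 2} = ?S n" by auto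
    ultimately show ?thesis by simp
  qed
  \<comment> \<open>The error made by the cut-off: its integrand is at most a multiple of
    \<open>n * s n\<close> and lives on \<open>?S n\<close>, which is the product controlled by
    \<open>decay\<close>.\<close>
  have lim3: "(\<lambda>n. \<integral>x. f x * (\<phi> x * \<zeta>' n x) \<partial>lebesgue) \<longlonglongrightarrow> 0"
  proof (rule Lim_null_comparison)
    have "(\<lambda>n. B * 3 * K * \<bar>real n * s n * measure lebesgue (?S n)\<bar>) \<longlonglongrightarrow> B * 3 * K * 0"
      by (intro tendsto_mult tendsto_const tendsto_rabs_zero lim)
    then show "(\<lambda>n. B * 3 * K * \<bar>real n * s n * measure lebesgue (?S n)\<bar>) \<longlonglongrightarrow> 0" by simp
    have "norm (\<integral>x. f x * (\<phi> x * \<zeta>' n x) \<partial>lebesgue) \<le> B * 3 * K * \<bar>real n * s n * measure lebesgue (?S n)\<bar>" for n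
    proof -
      have b: "norm (f x * (\<phi> x * \<zeta>' n x)) \<le> indicator (?S n) x *\<^sub>R (B * 3 * K * real n * \<bar>s n\<bar>)" for x
      proof (cases "norm x \<le> r \<and> 1 \<le> (real n)\<^sup>2 * q x \<and> (real n)\<^sup>2 * q x \<le> 2")
        case True
        have f: "\<bar>f x\<bar> \<le> \<bar>s n\<bar>" using s[of x n] True by linarith
        \<comment> \<open>\<open>3/2\<close> is a rational bound for the square root of 2. With the
          gradient hypothesis on \<open>q\<close> it bounds n^2 times the partial derivative of
          \<open>q\<close> by 3n.\<close>
        have "sqrt ((real n)\<^sup>2 * q x) \<le> sqrt ((3/2)\<^sup>2)"
          using True by (intro real_sqrt_le_mono) (simp add: power2_eq_square)
        then have "real n * sqrt (q x) \<le> 3/2" by (simp add: real_sqrt_mult)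
        then have "real n * (real n * sqrt (q x)) \<le> real n * (3/2)" by (intro mult_left_mono) auto
        moreover have "(real n)\<^sup>2 * \<bar>partial_deriv i q x\<bar> \<le> (real n)\<^sup>2 * (2 * sqrt (q x))"
          by (intro mult_left_mono q(3)) auto
        ultimately have "(real n)\<^sup>2 * \<bar>partial_deriv i q x\<bar> \<le> 3 * real n"
          by (simp add: power2_eq_square)
        then have "\<bar>\<zeta>' n x\<bar> \<le> K * (3 * real n)"
          unfolding \<zeta>'_def abs_mult[of "bump _ / _"] using K by (intro mult_mono) (auto simp: abs_mult)
        then have "\<bar>f x\<bar> * (\<bar>\<phi> x\<bar> * \<bar>\<zeta>' n x\<bar>) \<le> \<bar>s n\<bar> * (B * (K * (3 * real n)))"
          using f B K by (intro mult_mono) auto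
        then show ?thesis using True by (simp add: abs_mult ac_simps)
      next
        case False
        then have "\<phi> x = 0 \<or> \<zeta>' n x = 0"
          using r[of x] by (auto simp: \<zeta>'_def bump_eq_0)
        then show ?thesis using B K by (auto simp: indicator_def)
      qed
      have "norm (\<integral>x. f x * (\<phi> x * \<zeta>' n x) \<partial>lebesgue)
          \<le> (\<integral>x. indicator (?S n) x *\<^sub>R (B * 3 * K * real n * \<bar>s n\<bar>) \<partial>lebesgue)"
      proof (rule Bochner_Integration.integral_norm_bound_integral[OF i3 _ b])
        have "integrable lebesgue (indicator (?S n) :: _ \<Rightarrow> real)"
          using S[of n] by (intro integrable_real_indicator) (auto simp: fmeasurable_def)
        then show "integrable lebesgue (\<lambda>x. indicator (?S n) x *\<^sub>R (B * 3 * K * real n * \<bar>s n\<bar>))"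
          by (rule integrable_scaleR_left)
      qed
      also have "\<dots> = measure lebesgue (?S n) * (B * 3 * K * real n * \<bar>s n\<bar>)"
        by simp
      also have "\<dots> = B * 3 * K * \<bar>real n * s n * measure lebesgue (?S n)\<bar>"
        by (simp add: abs_mult)
      finally show ?thesis .
    qed
    then show "\<forall>\<^sub>F n in sequentially. norm (\<integral>x. f x * (\<phi> x * \<zeta>' n x) \<partial>lebesgue)
        \<le> B * 3 * K * \<bar>real n * s n * measure lebesgue (?S n)\<bar>" by simp
  qed
  have "(\<lambda>n. (\<integral>x. g x * (\<phi> x * \<zeta> n x) \<partial>lebesgue) + (\<integral>x. f x * (partial_deriv i \<phi> x * \<zeta> n x) \<partial>lebesgue)
      + (\<integral>x. f x * (\<phi> x * \<zeta>' n x) \<partial>lebesgue)) \<longlonglongrightarrow>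
      (\<integral>x. g x * \<phi> x \<partial>lebesgue) + (\<integral>x. f x * partial_deriv i \<phi> x \<partial>lebesgue) + 0"
    by (intro tendsto_add lim1 lim3 int_f[OF c\<phi>(2) r'] int_g[OF c\<phi>(1) r])
  then have "(\<integral>x. g x * \<phi> x \<partial>lebesgue) + (\<integral>x. f x * partial_deriv i \<phi> x \<partial>lebesgue) + 0 = 0"
    unfolding sum0 by (simp add: LIMSEQ_const_iff)
  then show "(\<integral>x. f x * iter_partial_deriv [i] \<phi> x \<partial>lebesgue) =
      (- 1) ^ length [i] * (\<integral>x. g x * \<phi> x \<partial>lebesgue)"
    by simp
qed

section \<open>Composition, scaling and integrability criteria for weak derivatives\<close>

lemma has_weak_deriv_Cons:
  assumes "has_weak_deriv UNIV [i] f g" "has_weak_deriv UNIV I g h"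
  shows "has_weak_deriv UNIV (i # I) f h"
  unfolding has_weak_deriv_def
proof (intro conjI allI impI)
  fix \<phi> :: "real^'a \<Rightarrow> real" assume \<phi>: "test_function UNIV \<phi>"
  have "test_function UNIV (iter_partial_deriv I \<phi>)"
    by (induction I) (auto intro: \<phi> test_function_partial_deriv)
  then show "(LINT x:UNIV|lebesgue. f x * iter_partial_deriv (i # I) \<phi> x) =
         (- 1) ^ length (i # I) * (LINT x:UNIV|lebesgue. h x * \<phi> x)"
    using assms \<phi> unfolding has_weak_deriv_def by simp
qed (use assms in \<open>auto simp: has_weak_deriv_def\<close>)

lemma has_weak_deriv_Nil: "locally_integrable_on f \<Omega> \<Longrightarrow> has_weak_deriv \<Omega> [] f f"
  by (simp add: has_weak_deriv_def)

lemma has_weak_deriv_cmult: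
  assumes "has_weak_deriv \<Omega> I f g"
  shows "has_weak_deriv \<Omega> I (\<lambda>x. c * f x) (\<lambda>x. c * g x)"
  using assms unfolding has_weak_deriv_def locally_integrable_on_def
  by (auto simp: mult.assoc set_integrable_mult_right)

lemma locally_integrable_on_square_integrable:
  fixes f :: "real^'n::finite \<Rightarrow> real"
  assumes "f \<in> borel_measurable lebesgue" "(\<integral>\<^sup>+x. ennreal ((f x)\<^sup>2) \<partial>lebesgue) < \<infinity>"
  shows "locally_integrable_on f UNIV"
  unfolding locally_integrable_on_def set_integrable_def
proof (intro allI impI)
  fix K :: "(real^'n) set" assume K: "compact K \<and> K \<subseteq> UNIV"
  have sq: "integrable lebesgue (\<lambda>x. (f x)\<^sup>2)"
    using assms by (intro integrableI_nonneg) auto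
  have iK: "integrable lebesgue (indicator K :: _ \<Rightarrow> real)"
    using lmeasurable_compact K by (intro integrable_real_indicator) (auto simp: fmeasurable_def)
  show "integrable lebesgue (\<lambda>x. indicator K x *\<^sub>R f x)"
  proof (rule Bochner_Integration.integrable_bound)
    show "integrable lebesgue (\<lambda>x. indicator K x + (f x)\<^sup>2)" using sq iK by auto
    show "(\<lambda>x. indicator K x *\<^sub>R f x) \<in> borel_measurable lebesgue"
      using iK assms(1) by (intro borel_measurable_scaleR) auto
    have "\<bar>y\<bar> \<le> 1 + y\<^sup>2" for y :: real
      using zero_le_power2[of "\<bar>y\<bar> - 1"] abs_ge_zero[of y] by (simp add: power2_diff)
    then show "AE x in lebesgue. norm (indicator K x *\<^sub>R f x) \<le> norm (indicator K x + (f x)\<^sup>2)"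
      by (intro AE_I2) (auto simp: indicator_def)
  qed
qed

text \<open>The function is dominated by a sum of multiples of indicators. The pieces may overlap,
  since only an upper bound is wanted. Square integrability of the model singularities is reduced in
  this way to a series of height times volume.\<close>

lemma nn_integral_finite_cover:
  assumes "\<And>k. A k \<in> sets M" "\<And>k x. x \<in> A k \<Longrightarrow> f x \<le> ennreal (a k)"
    and "AE x in M. (\<exists>k::nat. x \<in> A k) \<or> f x = 0"
    and "\<And>k. emeasure M (A k) \<le> ennreal (b k)" "\<And>k. 0 \<le> a k" "\<And>k. 0 \<le> b k"
    and "summable (\<lambda>k. a k * b k)"
  shows "(\<integral>\<^sup>+x. f x \<partial>M) < \<infinity>"
proof -
  have "(\<integral>\<^sup>+x. f x \<partial>M) \<le> (\<integral>\<^sup>+x. (\<Sum>k. ennreal (a k) * indicator (A k) x) \<partial>M)"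
  proof (rule nn_integral_mono_AE)
    show "AE x in M. f x \<le> (\<Sum>k. ennreal (a k) * indicator (A k) x)"
      using assms(3)
    proof eventually_elim
      case (elim x)
      then show ?case
      proof
        assume "\<exists>k. x \<in> A k"
        then obtain k where k: "x \<in> A k" by blast
        have "f x \<le> ennreal (a k) * indicator (A k) x" using assms(2)[OF k] k by simp
        also have "\<dots> = (\<Sum>j\<in>{k}. ennreal (a j) * indicator (A j) x)"
          by (rule sym, subst sum.insert)
            (simp_all only: finite.emptyI empty_iff not_False_eq_True sum.empty add_0_right)
        also have "\<dots> \<le> (\<Sum>k. ennreal (a k) * indicator (A k) x)"
          by (intro sum_le_suminf) auto
        finally show ?thesis .
      qed auto
    qed
  qed
  also have "\<dots> = (\<Sum>k. ennreal (a k) * emeasure M (A k))"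
    using assms(1) by (subst nn_integral_suminf) (auto simp: nn_integral_cmult_indicator)
  also have "\<dots> \<le> (\<Sum>k. ennreal (a k * b k))"
    using assms(4-6) by (intro suminf_le) (auto simp: ennreal_mult intro: mult_left_mono)
  also have "\<dots> < \<infinity>"
    using assms(5-7) by (subst suminf_ennreal2) auto
  finally show ?thesis .
qed

lemma emeasure_box3:
  assumes "a1 \<le> b1" "a2 \<le> b2" "a3 \<le> b3"
  shows "emeasure lebesgue {x::real^3. a1 \<le> x$1 \<and> x$1 \<le> b1 \<and> a2 \<le> x$2 \<and> x$2 \<le> b2 \<and> a3 \<le> x$3 \<and> x$3 \<le> b3}
    = ennreal ((b1 - a1) * (b2 - a2) * (b3 - a3))"
    (is "emeasure _ ?S = _")
  and "compact {x::real^3. a1 \<le> x$1 \<and> x$1 \<le> b1 \<and> a2 \<le> x$2 \<and> x$2 \<le> b2 \<and> a3 \<le> x$3 \<and> x$3 \<le> b3}"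
proof -
  let ?a = "vector [a1, a2, a3] :: real^3" and ?b = "vector [b1, b2, b3] :: real^3"
  have S: "?S = cbox ?a ?b" by (auto simp: mem_box_cart forall_3)
  then show "compact ?S" by simp
  have ne: "cbox ?a ?b \<noteq> {}" using assms by (auto simp: interval_ne_empty_cart forall_3)
  have "emeasure lebesgue (cbox ?a ?b) = ennreal (measure lebesgue (cbox ?a ?b))"
    by (rule emeasure_eq_measure2[OF lmeasurable_cbox])
  also have "measure lebesgue (cbox ?a ?b) = (b1 - a1) * (b2 - a2) * (b3 - a3)"
  proof -
    have "prod f (UNIV :: 3 set) = f 1 * f 2 * f 3" for f :: "3 \<Rightarrow> real"
      unfolding UNIV_3 by (simp add: mult.assoc)
    then show ?thesis using content_cbox_cart[OF ne] by simp
  qed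
  finally show "emeasure lebesgue ?S = ennreal ((b1 - a1) * (b2 - a2) * (b3 - a3))" unfolding S .
qed

section \<open>The logarithmic profiles\<close>

text \<open>The exponent is kept general: \<beta> = \<alpha> gives the derivative of \<chi>_1 and
  \<beta> = 2\<alpha> that of \<chi>_2, up to constant factors.\<close>

definition logw :: "real \<Rightarrow> real \<Rightarrow> real" where
  "logw \<beta> s = \<bar>ln \<bar>s / 4\<bar>\<bar> powr \<beta>"

definition logW :: "real \<Rightarrow> real \<Rightarrow> real" where
  "logW \<beta> y = (LBINT s=ereal 0..ereal y. logw \<beta> s)"

lemma logw_nonneg: "0 \<le> logw \<beta> s" and logw_minus: "logw \<beta> (- s) = logw \<beta> s"
  by (auto simp: logw_def)

lemma borel_measurable_logw: "logw \<beta> \<in> borel_measurable borel"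
  unfolding logw_def by measurable

text \<open>For y < 1 this compares the logarithm with a power of 1/y. For 1 \<le> y \<le> R the
  growth \<open>y powr a\<close> is traded for \<open>y powr (- a)\<close> at the price of
  \<open>R powr (2 * a)\<close>, so one negative power covers the whole range.\<close>

lemma abs_ln_le:
  fixes y R a :: real
  assumes "0 < y" "y \<le> R" "0 < a"
  shows "\<bar>ln y\<bar> \<le> (1 + R powr (2 * a)) / a * y powr (- a)"
proof -
  have R: "R powr (2 * a) \<ge> 0" by simp
  show ?thesis
  proof (cases "y \<ge> 1")
    case True
    have "y powr a = y powr (2 * a) * y powr (- a)" by (simp flip: powr_add)
    also have "\<dots> \<le> R powr (2 * a) * y powr (- a)"
      using assms True by (intro mult_right_mono powr_mono2) auto
    also have "\<dots> \<le> (1 + R powr (2 * a)) * y powr (- a)" by (intro mult_right_mono) auto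
    finally have "y powr a / a \<le> (1 + R powr (2 * a)) * y powr (- a) / a"
      using assms by (intro divide_right_mono) auto
    then show ?thesis using ln_powr_bound[OF True assms(3)] True by simp
  next
    case False
    have "ln (1 / y) \<le> (1 / y) powr a / a" using False assms by (intro ln_powr_bound) auto
    also have "(1 / y) powr a = 1 * y powr (- a)" by (simp add: powr_divide powr_minus field_simps assms)
    also have "1 * y powr (- a) / a \<le> (1 + R powr (2 * a)) * y powr (- a) / a"
      using assms by (intro divide_right_mono mult_right_mono) auto
    finally show ?thesis using assms False by (simp add: ln_div)
  qed
qed

text \<open>The comparison for the logarithm is used with exponent \<gamma>/\<beta> and then raised
  to the power \<beta>. An arbitrary radius is allowed because the profile of part (ii) is
  translated by an arbitrary t.\<close>

lemma logw_bound:
  assumes "0 < \<beta>" "0 < \<gamma>" "0 < R"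
  shows "\<exists>C\<ge>0. \<forall>s. 0 < \<bar>s\<bar> \<and> \<bar>s\<bar> \<le> R \<longrightarrow> logw \<beta> s \<le> C * \<bar>s\<bar> powr (- \<gamma>)"
proof -
  define a where "a = \<gamma> / \<beta>"
  have a: "a > 0" using assms by (simp add: a_def)
  define K where "K = (1 + (R / 4) powr (2 * a)) / a"
  have K: "K \<ge> 0" using a by (simp add: K_def add_nonneg_nonneg)
  show ?thesis
  proof (intro exI[of _ "K powr \<beta> * 4 powr \<gamma>"] conjI allI impI)
    fix s assume s: "0 < \<bar>s\<bar> \<and> \<bar>s\<bar> \<le> R"
    have "\<bar>ln \<bar>s / 4\<bar>\<bar> \<le> K * \<bar>s / 4\<bar> powr (- a)"
      unfolding K_def using s a by (intro abs_ln_le) auto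
    then have "logw \<beta> s \<le> (K * \<bar>s / 4\<bar> powr (- a)) powr \<beta>"
      unfolding logw_def using assms by (intro powr_mono2) auto
    also have "\<dots> = K powr \<beta> * (\<bar>s\<bar> / 4) powr (- \<gamma>)"
      using K assms by (simp add: powr_mult powr_powr a_def)
    also have "(\<bar>s\<bar> / 4) powr (- \<gamma>) = 4 powr \<gamma> * \<bar>s\<bar> powr (- \<gamma>)"
      by (simp add: powr_divide powr_minus field_simps)
    finally show "logw \<beta> s \<le> K powr \<beta> * 4 powr \<gamma> * \<bar>s\<bar> powr (- \<gamma>)" by (simp add: mult.assoc)
  qed auto
qed

text \<open>A consequence of \<open>ln 0 = 0\<close>. A negative power of 0 is 0 too, so the power
  bounds for \<open>logw\<close> also hold at the singular point.\<close>

lemma logw_0: "logw \<beta> 0 = 0"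
  by (simp add: logw_def)

lemma logw_set_integrable:
  assumes "0 < \<beta>" "0 \<le> R"
  shows "set_integrable lborel {0..R} (logw \<beta>)"
proof -
  obtain C where C: "C \<ge> 0" "\<And>s. 0 < \<bar>s\<bar> \<Longrightarrow> \<bar>s\<bar> \<le> R + 1 \<Longrightarrow> logw \<beta> s \<le> C * \<bar>s\<bar> powr (- (1/2))"
    using logw_bound[OF assms(1), of "1/2" "R + 1"] assms(2) by auto
  have "(\<lambda>s::real. s powr (- (1/2))) integrable_on {0..R}"
    using has_integral_powr_from_0[of "- (1/2)" R] assms by (auto simp: integrable_on_def)
  then have "(\<lambda>s::real. C * s powr (- (1/2))) absolutely_integrable_on {0..R}"
    using C(1) by (intro nonnegative_absolutely_integrable_1 integrable_on_mult_right) auto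
  then have "set_integrable lborel {0..R} (\<lambda>s::real. C * s powr (- (1/2)))"
    unfolding set_integrable_def by (subst (asm) integrable_completion) auto
  then show ?thesis
  proof (rule set_integrable_bound)
    show "set_borel_measurable lborel {0..R} (logw \<beta>)"
      unfolding set_borel_measurable_def using borel_measurable_logw by measurable
    have "norm (logw \<beta> s) \<le> norm (C * s powr (- (1/2)))" if "s \<in> {0..R}" for s
      using that C(1) C(2)[of s] logw_nonneg[of \<beta> s] by (cases "s = 0") (auto simp: logw_0)
    then show "AE x in lborel. x \<in> {0..R} \<longrightarrow> norm (logw \<beta> x) \<le> norm (C * x powr (- (1/2)))" by auto
  qed
qed

lemma logW_eq_integral: "0 < \<beta> \<Longrightarrow> 0 \<le> y \<Longrightarrow> logW \<beta> y = integral {0..y} (logw \<beta>)"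
  unfolding logW_def by (intro interval_integral_eq_integral logw_set_integrable) auto

lemma logw_integrable_on: "0 < \<beta> \<Longrightarrow> 0 \<le> R \<Longrightarrow> logw \<beta> integrable_on {0..R}"
  using set_borel_integral_eq_integral(1)[OF logw_set_integrable] .

lemma logW_minus: "logW \<beta> (- y) = - logW \<beta> y"
proof -
  have "logW \<beta> y = (LBINT s=-ereal y..-ereal 0. logw \<beta> (- s))"
    unfolding logW_def by (rule interval_integral_reflect)
  also have "\<dots> = - (LBINT s=ereal 0..ereal (- y). logw \<beta> s)"
    by (subst interval_integral_endpoints_reverse) (simp add: logw_minus)
  finally show ?thesis by (simp add: logW_def)
qed

text \<open>At \<bar>y\<bar> = 4 the logarithm vanishes, and continuity of the power there comes
  from \<beta> > 0.\<close>

lemma isCont_logw: "y \<noteq> 0 \<Longrightarrow> 0 < \<beta> \<Longrightarrow> isCont (logw \<beta>) y"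
  unfolding logw_def isCont_def by (intro tendsto_powr' tendsto_intros) auto

lemma has_real_derivative_logW:
  assumes "0 < \<beta>" "y \<noteq> 0"
  shows "(logW \<beta> has_real_derivative logw \<beta> y) (at y)"
proof -
  have pos: "(logW \<beta> has_real_derivative logw \<beta> y) (at y)" if y: "y > 0" for y
  proof -
    have "((\<lambda>u. integral {0..u} (logw \<beta>)) has_vector_derivative logw \<beta> y) (at y within ({0..y+1} - {}))"
      using y assms(1) isCont_logw[of y \<beta>]
      by (intro integral_has_vector_derivative_continuous_at logw_integrable_on)
         (auto intro: continuous_at_imp_continuous_at_within)
    then have "((\<lambda>u. integral {0..u} (logw \<beta>)) has_real_derivative logw \<beta> y) (at y)"
      using y by (simp add: has_real_derivative_iff_has_vector_derivative at_within_Icc_at)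
    then show ?thesis
      by (rule has_field_derivative_transform_within_open[where S = "{0<..}"])
         (use y assms(1) in \<open>auto simp: logW_eq_integral\<close>)
  qed
  show ?thesis
  proof (cases "y > 0")
    case False
    then have "- y > 0" using assms by simp
    have "((\<lambda>y. - logW \<beta> (- y)) has_real_derivative - (logw \<beta> (- y) * (- 1))) (at y)"
      by (intro DERIV_minus DERIV_chain2[where f = "logW \<beta>" and g = uminus, OF pos[OF \<open>- y > 0\<close>]] derivative_eq_intros) auto
    then show ?thesis by (simp add: logW_minus logw_minus)
  qed (rule pos)
qed

text \<open>Integrates the bound of \<open>logw\<close> by the power -1/2. Combined with
  \<open>height x \<ge> (x \<bullet> x) / 4\<close>, the square root yields the bound by
  \<open>1 / norm x\<close> for the mean; it also gives the decay near the plane in part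
  (ii).\<close>

lemma logW_bound:
  assumes "0 < \<beta>" "0 < R"
  shows "\<exists>C\<ge>0. \<forall>y. \<bar>y\<bar> \<le> R \<longrightarrow> \<bar>logW \<beta> y\<bar> \<le> C * \<bar>y\<bar> powr (1/2)"
proof -
  obtain C where C: "C \<ge> 0" "\<And>s. 0 < \<bar>s\<bar> \<Longrightarrow> \<bar>s\<bar> \<le> R \<Longrightarrow> logw \<beta> s \<le> C * \<bar>s\<bar> powr (- (1/2))"
    using logw_bound[OF assms(1), of "1/2" R] assms(2) by auto
  have pos: "\<bar>logW \<beta> y\<bar> \<le> 2 * C * \<bar>y\<bar> powr (1/2)" if y: "0 \<le> y" "y \<le> R" for y
  proof -
    have i: "((\<lambda>s. C * s powr (- (1/2))) has_integral C * (y powr (1/2) / (1/2))) {0..y}"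
      using has_integral_mult_right[OF has_integral_powr_from_0[of "- (1/2)" y], of C] y by simp
    have "norm (integral {0..y} (logw \<beta>)) \<le> integral {0..y} (\<lambda>s. C * s powr (- (1/2)))"
    proof (rule integral_norm_bound_integral)
      show "norm (logw \<beta> s) \<le> C * s powr (- (1/2))" if "s \<in> {0..y}" for s
        using that C(1) C(2)[of s] logw_nonneg[of \<beta> s] y by (cases "s = 0") (auto simp: logw_0)
    qed (use logw_integrable_on[OF assms(1)] y i in \<open>auto simp: integrable_on_def\<close>)
    then have "\<bar>integral {0..y} (logw \<beta>)\<bar> \<le> C * (y powr (1/2) / (1/2))"
      unfolding integral_unique[OF i] by simp
    then show ?thesis
      using logW_eq_integral[OF assms(1) y(1)] y by (simp add: mult_ac)
  qed
  have "\<bar>logW \<beta> y\<bar> \<le> 2 * C * \<bar>y\<bar> powr (1/2)" if "\<bar>y\<bar> \<le> R" for y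
    using pos[of y] pos[of "- y"] that by (cases "0 \<le> y") (auto simp: logW_minus)
  then show ?thesis using C(1) by (intro exI[of _ "2 * C"]) auto
qed

lemma chi1_eq: "chi1 \<alpha> \<epsilon> y = \<epsilon> * logW \<alpha> y"
  unfolding chi1_def logW_def logw_def by simp

lemma chi2_eq:
  assumes "0 < \<alpha>"
  shows "chi2 \<alpha> \<epsilon> y = 2 * (\<epsilon>\<^sup>2 * logW (2 * \<alpha>) y)"
proof -
  have "(LBINT s=ereal 0..ereal y. (deriv (chi1 \<alpha> \<epsilon>) s)\<^sup>2) =
      (LBINT s=ereal 0..ereal y. \<epsilon>\<^sup>2 * logw (2 * \<alpha>) s)"
  proof (rule interval_integral_cong)
    fix s assume "s \<in> einterval (min (ereal 0) (ereal y)) (max (ereal 0) (ereal y))"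
    \<comment> \<open>The open interval between 0 and y omits 0, so the value that
      \<open>deriv\<close> takes there never enters.\<close>
    then have s: "s \<noteq> 0" by (auto simp: einterval_def min_def max_def split: if_splits)
    have "(chi1 \<alpha> \<epsilon> has_real_derivative \<epsilon> * logw \<alpha> s) (at s)"
      unfolding chi1_eq[abs_def] by (intro DERIV_cmult has_real_derivative_logW assms s)
    then have "deriv (chi1 \<alpha> \<epsilon>) s = \<epsilon> * logw \<alpha> s" by (rule DERIV_imp_deriv)
    moreover have "(logw \<alpha> s)\<^sup>2 = logw (2 * \<alpha>) s"
      by (simp add: logw_def power2_eq_square flip: powr_add)
    ultimately show "(deriv (chi1 \<alpha> \<epsilon>) s)\<^sup>2 = \<epsilon>\<^sup>2 * logw (2 * \<alpha>) s" by (simp add: power_mult_distrib)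
  qed
  then show ?thesis unfolding chi2_def logW_def by simp
qed

lemma logw_eq: "0 < s \<Longrightarrow> s < 4 \<Longrightarrow> logw \<beta> s = ln (4 / s) powr \<beta>"
  by (simp add: logw_def ln_div)

lemma has_real_derivative_logw:
  assumes "0 < s" "s < 4"
  shows "(logw \<beta> has_real_derivative - (\<beta> * ln (4 / s) powr (\<beta> - 1) / s)) (at s)"
proof -
  have "((\<lambda>s. ln (4 / s) powr \<beta>) has_real_derivative - (\<beta> * ln (4 / s) powr (\<beta> - 1) / s)) (at s)"
    using assms by (auto intro!: derivative_eq_intros simp: field_simps powr_diff power2_eq_square)
  then show ?thesis
    by (rule has_field_derivative_transform_within_open[where S = "{0<..<4}"])
       (use assms in \<open>auto simp: logw_eq\<close>)
qed

text \<open>The mean \<open>logW \<beta> p / p\<close> of \<^term>\<open>logw \<beta>\<close> over \<open>[0, p]\<close> differs from the endpoint value by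
  a full power of the logarithm less than its size.\<close>

lemma logW_minus_logw_bounds:
  assumes "0 < \<beta>" "\<beta> < 1" "0 < p" "p < 4"
  shows "0 \<le> logW \<beta> p - p * logw \<beta> p" "logW \<beta> p - p * logw \<beta> p \<le> p * ln (4 / p) powr (\<beta> - 1)"
proof -
  define D where "D s = logW \<beta> s - s * logw \<beta> s" for s
  \<comment> \<open>The two copies of \<open>logw\<close> cancel. What remains is -s times the
    derivative of \<open>logw\<close>, and the factor s cancels its 1/s.\<close>
  have D': "(D has_real_derivative \<beta> * ln (4 / s) powr (\<beta> - 1)) (at s)" if "0 < s" "s < 4" for s
    unfolding D_def using that assms
    by (auto intro!: derivative_eq_intros has_real_derivative_logW has_real_derivative_logw)
  \<comment> \<open>The derivative is available only for positive s, so the increment is estimated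
    from \<eta> on and \<eta> then tends to 0. Monotonicity uses the negative exponent \<beta> -
    1.\<close>
  have inc: "0 \<le> D p - D \<eta> \<and> D p - D \<eta> \<le> p * ln (4 / p) powr (\<beta> - 1)" if \<eta>: "0 < \<eta>" "\<eta> < p" for \<eta>
  proof -
    obtain z where z: "\<eta> < z" "z < p" "D p - D \<eta> = (p - \<eta>) * (\<beta> * ln (4 / z) powr (\<beta> - 1))"
      using MVT2[OF \<eta>(2), of D "\<lambda>s. \<beta> * ln (4 / s) powr (\<beta> - 1)"] D' \<eta> assms by force
    have "ln (4 / z) powr (\<beta> - 1) \<le> ln (4 / p) powr (\<beta> - 1)"
      using z \<eta> assms by (intro powr_mono2') (auto simp: field_simps)
    then have le: "\<beta> * ln (4 / z) powr (\<beta> - 1) \<le> 1 * ln (4 / p) powr (\<beta> - 1)"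
      using assms by (intro mult_mono) auto
    have "(p - \<eta>) * (\<beta> * ln (4 / z) powr (\<beta> - 1)) \<le> p * (1 * ln (4 / p) powr (\<beta> - 1))"
      by (rule mult_mono[OF _ le]) (use \<eta> assms in auto)
    then show ?thesis using z(3) \<eta> assms by auto
  qed
  have D0: "(D \<longlongrightarrow> 0) (at_right 0)"
  proof -
    obtain C where C: "\<And>y. \<bar>y\<bar> \<le> 4 \<Longrightarrow> \<bar>logW \<beta> y\<bar> \<le> C * \<bar>y\<bar> powr (1/2)"
      using logW_bound[OF assms(1), of 4] by auto
    obtain C' where C': "\<And>s. 0 < \<bar>s\<bar> \<Longrightarrow> \<bar>s\<bar> \<le> 4 \<Longrightarrow> logw \<beta> s \<le> C' * \<bar>s\<bar> powr (- (1/2))"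
      using logw_bound[OF assms(1), of "1/2" 4] by auto
    have "eventually (\<lambda>s. norm (D s) \<le> (C + C') * s powr (1/2)) (at_right 0)"
      unfolding eventually_at_right_field
    proof (intro exI[of _ 4] conjI allI impI)
      fix s :: real assume s: "0 < s" "s < 4"
      have "s * logw \<beta> s \<le> s * (C' * s powr (- (1/2)))"
        using C'[of s] s by (intro mult_left_mono) auto
      also have "\<dots> = C' * (s powr 1 * s powr (- (1/2)))" using s by simp
      also have "s powr 1 * s powr (- (1/2)) = s powr (1/2)" by (simp only: powr_add[symmetric]) simp
      finally have 1: "s * logw \<beta> s \<le> C' * s powr (1/2)" .
      have "norm (D s) \<le> \<bar>logW \<beta> s\<bar> + \<bar>s * logw \<beta> s\<bar>" by (simp add: D_def)
      also have "\<bar>s * logw \<beta> s\<bar> = s * logw \<beta> s" using s logw_nonneg by simp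
      finally show "norm (D s) \<le> (C + C') * s powr (1/2)"
        using 1 C[of s] s by (simp add: distrib_right)
    qed auto
    moreover have "((\<lambda>s. (C + C') * s powr (1/2)) \<longlongrightarrow> 0) (at_right 0)"
    proof -
      have "((\<lambda>s::real. s powr (1/2)) \<longlongrightarrow> 0 powr (1/2)) (at_right 0)"
        by (intro tendsto_powr') (auto simp: eventually_at_right_field intro: tendsto_intros exI[of _ 1])
      then have "((\<lambda>s. (C + C') * s powr (1/2)) \<longlongrightarrow> (C + C') * 0 powr (1/2)) (at_right 0)"
        by (intro tendsto_mult tendsto_const)
      then show ?thesis by simp
    qed
    ultimately show ?thesis by (rule Lim_null_comparison)
  qed
  then have lim: "((\<lambda>\<eta>. D p - D \<eta>) \<longlongrightarrow> D p - 0) (at_right 0)" by (intro tendsto_intros)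
  have ev: "eventually (\<lambda>\<eta>. 0 \<le> D p - D \<eta> \<and> D p - D \<eta> \<le> p * ln (4 / p) powr (\<beta> - 1)) (at_right 0)"
    unfolding eventually_at_right_field using inc assms(3) by blast
  have "0 \<le> D p - 0"
    by (rule tendsto_lowerbound[OF lim]) (use ev in \<open>auto elim: eventually_mono\<close>)
  then show "0 \<le> logW \<beta> p - p * logw \<beta> p" by (simp add: D_def)
  have "D p - 0 \<le> p * ln (4 / p) powr (\<beta> - 1)"
    by (rule tendsto_upperbound[OF lim]) (use ev in \<open>auto elim: eventually_mono\<close>)
  then show "logW \<beta> p - p * logw \<beta> p \<le> p * ln (4 / p) powr (\<beta> - 1)" by (simp add: D_def)
qed

section \<open>Pointwise bounds for second-order jets\<close>

lemma partial_deriv2_mult: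
  assumes "open U" "x \<in> U" "smooth_on U f" "smooth_on U g"
  shows "partial_deriv i (partial_deriv j (\<lambda>x. f x * g x)) x =
    f x * partial_deriv i (partial_deriv j g) x + partial_deriv i f x * partial_deriv j g x +
    partial_deriv j f x * partial_deriv i g x + partial_deriv i (partial_deriv j f) x * g x"
proof -
  note d = smooth_on_imp_differentiable[OF _ assms(1)]
  have "partial_deriv i (partial_deriv j (\<lambda>x. f x * g x)) x =
      partial_deriv i (\<lambda>x. f x * partial_deriv j g x + partial_deriv j f x * g x) x"
    by (rule partial_deriv_cong[OF assms(1,2)])
       (simp add: partial_deriv_mult d[OF assms(3)] d[OF assms(4)])
  also have "\<dots> = (f x * partial_deriv i (partial_deriv j g) x + partial_deriv i f x * partial_deriv j g x)
      + (partial_deriv j f x * partial_deriv i g x + partial_deriv i (partial_deriv j f) x * g x)"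
    using d[OF assms(3,2)] d[OF assms(4,2)] d[OF smooth_on_partial_deriv[OF assms(3)] assms(2)]
      d[OF smooth_on_partial_deriv[OF assms(4)] assms(2)]
    by (simp add: partial_deriv_add partial_deriv_mult)
  finally show ?thesis by simp
qed

lemma partial_deriv2_add:
  assumes "open U" "x \<in> U" "smooth_on U f" "smooth_on U g"
  shows "partial_deriv i (partial_deriv j (\<lambda>x. f x + g x)) x =
    partial_deriv i (partial_deriv j f) x + partial_deriv i (partial_deriv j g) x"
proof -
  note d = smooth_on_imp_differentiable[OF _ assms(1)]
  have "partial_deriv i (partial_deriv j (\<lambda>x. f x + g x)) x =
      partial_deriv i (\<lambda>x. partial_deriv j f x + partial_deriv j g x) x"
    by (rule partial_deriv_cong[OF assms(1,2)])
       (simp add: partial_deriv_add d[OF assms(3)] d[OF assms(4)])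
  also have "\<dots> = partial_deriv i (partial_deriv j f) x + partial_deriv i (partial_deriv j g) x"
    using d[OF smooth_on_partial_deriv[OF assms(3)] assms(2)]
      d[OF smooth_on_partial_deriv[OF assms(4)] assms(2)]
    by (simp add: partial_deriv_add)
  finally show ?thesis .
qed

lemma partial_deriv2_compose:
  assumes "open U" "x \<in> U" "smooth_on U g"
    and F: "\<And>x. x \<in> U \<Longrightarrow> (F has_real_derivative F' (g x)) (at (g x))"
    and F': "(F' has_real_derivative F'') (at (g x))"
  shows "partial_deriv i (partial_deriv j (\<lambda>x. F (g x))) x =
    F' (g x) * partial_deriv i (partial_deriv j g) x + F'' * partial_deriv i g x * partial_deriv j g x"
proof -
  note d = smooth_on_imp_differentiable[OF _ assms(1)]
  have "partial_deriv i (partial_deriv j (\<lambda>x. F (g x))) x =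
      partial_deriv i (\<lambda>x. F' (g x) * partial_deriv j g x) x"
    by (rule partial_deriv_cong[OF assms(1,2)])
       (simp add: partial_deriv_compose[OF d[OF assms(3)] F])
  also have "\<dots> = F' (g x) * partial_deriv i (partial_deriv j g) x
      + partial_deriv i (\<lambda>x. F' (g x)) x * partial_deriv j g x"
    by (rule partial_deriv_mult)
       (use differentiable_compose_real[OF d[OF assms(3,2)] F'] d[OF smooth_on_partial_deriv[OF assms(3)] assms(2)]
         in auto)
  also have "partial_deriv i (\<lambda>x. F' (g x)) x = F'' * partial_deriv i g x"
    by (rule partial_deriv_compose[OF d[OF assms(3,2)] F'])
  finally show ?thesis .
qed

text \<open>Says that \<open>f\<close> has size \<open>A\<close> and varies on the length scale
  \<tau>: each derivative costs at most 1/\<tau>. In this weighted form the bounds are stable under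
  products and compositions, so sizes can be tracked without handling individual
  derivatives.\<close>

definition jet_bound :: "(real^'n::finite \<Rightarrow> real) \<Rightarrow> real^'n \<Rightarrow> real \<Rightarrow> real \<Rightarrow> bool" where
  "jet_bound f x \<tau> A \<longleftrightarrow> \<bar>f x\<bar> \<le> A \<and> (\<forall>i. \<bar>partial_deriv i f x\<bar> * \<tau> \<le> A) \<and>
    (\<forall>i j. \<bar>partial_deriv i (partial_deriv j f) x\<bar> * \<tau>\<^sup>2 \<le> A)"

lemma jet_bound_mono: "jet_bound f x \<tau> A \<Longrightarrow> A \<le> A' \<Longrightarrow> jet_bound f x \<tau> A'"
  unfolding jet_bound_def by (meson order_trans)

lemma jet_bound_const: "jet_bound (\<lambda>_. c) x \<tau> \<bar>c\<bar>"
  by (simp add: jet_bound_def)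

lemma jet_bound_add:
  assumes "open U" "x \<in> U" "smooth_on U f" "smooth_on U g"
    and "jet_bound f x \<tau> A" "jet_bound g x \<tau> A'" "\<tau> \<ge> 0"
  shows "jet_bound (\<lambda>x. f x + g x) x \<tau> (A + A')"
proof -
  note d = smooth_on_imp_differentiable[OF _ assms(1,2)]
  have tri: "\<bar>a + b\<bar> * t \<le> c + c'" if "\<bar>a\<bar> * t \<le> c" "\<bar>b\<bar> * t \<le> c'" "t \<ge> 0" for a b t c c' :: real
  proof -
    have "\<bar>a + b\<bar> * t \<le> (\<bar>a\<bar> + \<bar>b\<bar>) * t" using that by (intro mult_right_mono) auto
    then show ?thesis using that by (simp add: distrib_right)
  qed
  show ?thesis
    unfolding jet_bound_def partial_deriv_add[OF d[OF assms(3)] d[OF assms(4)]]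
      partial_deriv2_add[OF assms(1-4)]
  proof (intro conjI allI)
    show "\<bar>f x + g x\<bar> \<le> A + A'" using assms(5,6) unfolding jet_bound_def by linarith
  qed (intro tri; use assms(5-7) in \<open>simp add: jet_bound_def\<close>)+
qed

text \<open>A second derivative of a product has four Leibniz terms, and in each of them the weight
  \<tau>^2 splits between the two factors.\<close>

lemma jet_bound_mult:
  assumes "open U" "x \<in> U" "smooth_on U f" "smooth_on U g"
    and f: "jet_bound f x \<tau> A" and g: "jet_bound g x \<tau> A'" and \<tau>: "\<tau> \<ge> 0"
  shows "jet_bound (\<lambda>x. f x * g x) x \<tau> (4 * A * A')"
proof -
  note d = smooth_on_imp_differentiable[OF _ assms(1,2)]
  have A: "A \<ge> 0" "A' \<ge> 0" using f g unfolding jet_bound_def by (smt (verit) abs_ge_zero)+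
  have f0: "\<bar>f x\<bar> \<le> A" and f1: "\<And>i. \<bar>partial_deriv i f x\<bar> * \<tau> \<le> A"
    and f2: "\<And>i j. \<bar>partial_deriv i (partial_deriv j f) x\<bar> * \<tau>\<^sup>2 \<le> A"
    using f unfolding jet_bound_def by auto
  have g0: "\<bar>g x\<bar> \<le> A'" and g1: "\<And>i. \<bar>partial_deriv i g x\<bar> * \<tau> \<le> A'"
    and g2: "\<And>i j. \<bar>partial_deriv i (partial_deriv j g) x\<bar> * \<tau>\<^sup>2 \<le> A'"
    using g unfolding jet_bound_def by auto
  have AA: "0 \<le> A * A'" using A by simp
  have mm: "a * b \<le> A * A'" if "a \<le> A" "b \<le> A'" "0 \<le> b" for a b
    using that A by (intro mult_mono) auto
  show ?thesis
    unfolding jet_bound_def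
  proof (intro conjI allI)
    have "\<bar>f x\<bar> * \<bar>g x\<bar> \<le> A * A'" using f0 g0 A by (intro mult_mono) auto
    then show "\<bar>f x * g x\<bar> \<le> 4 * A * A'" using AA by (simp add: abs_mult)
    fix i
    have "\<bar>f x\<bar> * (\<bar>partial_deriv i g x\<bar> * \<tau>) \<le> A * A'" "(\<bar>partial_deriv i f x\<bar> * \<tau>) * \<bar>g x\<bar> \<le> A * A'"
      by (rule mm; use f0 g0 f1 g1 \<tau> in simp)+
    then have "(\<bar>f x\<bar> * \<bar>partial_deriv i g x\<bar> + \<bar>partial_deriv i f x\<bar> * \<bar>g x\<bar>) * \<tau> \<le> 2 * (A * A')"
      by (simp add: algebra_simps)
    moreover have "\<bar>partial_deriv i (\<lambda>x. f x * g x) x\<bar> * \<tau> \<le>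
        (\<bar>f x\<bar> * \<bar>partial_deriv i g x\<bar> + \<bar>partial_deriv i f x\<bar> * \<bar>g x\<bar>) * \<tau>"
      unfolding partial_deriv_mult[OF d[OF assms(3)] d[OF assms(4)]] abs_mult[symmetric]
      using \<tau> by (intro mult_right_mono abs_triangle_ineq) auto
    ultimately show "\<bar>partial_deriv i (\<lambda>x. f x * g x) x\<bar> * \<tau> \<le> 4 * A * A'" using AA by simp
    fix j
    have 1: "\<bar>f x\<bar> * (\<bar>partial_deriv i (partial_deriv j g) x\<bar> * \<tau>\<^sup>2) \<le> A * A'"
      "(\<bar>partial_deriv i f x\<bar> * \<tau>) * (\<bar>partial_deriv j g x\<bar> * \<tau>) \<le> A * A'"
      "(\<bar>partial_deriv j f x\<bar> * \<tau>) * (\<bar>partial_deriv i g x\<bar> * \<tau>) \<le> A * A'"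
      "(\<bar>partial_deriv i (partial_deriv j f) x\<bar> * \<tau>\<^sup>2) * \<bar>g x\<bar> \<le> A * A'"
      by (rule mm; use f0 g0 f1 g1 f2 g2 \<tau> in simp)+
    have "\<bar>partial_deriv i (partial_deriv j (\<lambda>x. f x * g x)) x\<bar> * \<tau>\<^sup>2 \<le>
        (\<bar>f x\<bar> * \<bar>partial_deriv i (partial_deriv j g) x\<bar> + \<bar>partial_deriv i f x\<bar> * \<bar>partial_deriv j g x\<bar>
        + \<bar>partial_deriv j f x\<bar> * \<bar>partial_deriv i g x\<bar> + \<bar>partial_deriv i (partial_deriv j f) x\<bar> * \<bar>g x\<bar>) * \<tau>\<^sup>2"
      unfolding partial_deriv2_mult[OF assms(1-4)] abs_mult[symmetric]
      by (rule mult_right_mono) (linarith, simp)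
    also have "\<dots> \<le> 4 * (A * A')"
      using 1 by (simp add: algebra_simps power2_eq_square)
    finally show "\<bar>partial_deriv i (partial_deriv j (\<lambda>x. f x * g x)) x\<bar> * \<tau>\<^sup>2 \<le> 4 * A * A'" by simp
  qed
qed

text \<open>In the second derivative \<open>F'\<close> meets one jet of \<open>g\<close> and
  \<open>F''\<close> meets two, hence the weights \<open>A\<close> and its square; the two terms
  account for the factor 2.\<close>

lemma jet_bound_compose:
  assumes "open U" "x \<in> U" "smooth_on U g"
    and F: "\<And>x. x \<in> U \<Longrightarrow> (F has_real_derivative F' (g x)) (at (g x))"
    and F': "(F' has_real_derivative F'') (at (g x))"
    and g: "jet_bound g x \<tau> A" and \<tau>: "\<tau> \<ge> 0"
    and bds: "\<bar>F (g x)\<bar> \<le> b" "\<bar>F' (g x)\<bar> * A \<le> b" "\<bar>F''\<bar> * A\<^sup>2 \<le> b"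
  shows "jet_bound (\<lambda>x. F (g x)) x \<tau> (2 * b)"
proof -
  note d = smooth_on_imp_differentiable[OF assms(3,1,2)]
  have b: "b \<ge> 0" using bds(1) by linarith
  have g1: "\<And>i. \<bar>partial_deriv i g x\<bar> * \<tau> \<le> A"
    and g2: "\<And>i j. \<bar>partial_deriv i (partial_deriv j g) x\<bar> * \<tau>\<^sup>2 \<le> A"
    using g unfolding jet_bound_def by auto
  show ?thesis
    unfolding jet_bound_def
  proof (intro conjI allI)
    show "\<bar>F (g x)\<bar> \<le> 2 * b" using bds b by simp
    fix i
    have "\<bar>F' (g x)\<bar> * (\<bar>partial_deriv i g x\<bar> * \<tau>) \<le> \<bar>F' (g x)\<bar> * A"
      by (intro mult_left_mono g1) auto
    then show "\<bar>partial_deriv i (\<lambda>x. F (g x)) x\<bar> * \<tau> \<le> 2 * b"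
      unfolding partial_deriv_compose[OF d F[OF assms(2)]] using bds b by (simp add: abs_mult mult_ac)
    fix j
    have 1: "\<bar>F' (g x)\<bar> * (\<bar>partial_deriv i (partial_deriv j g) x\<bar> * \<tau>\<^sup>2) \<le> \<bar>F' (g x)\<bar> * A"
      by (intro mult_left_mono g2) auto
    have "(\<bar>partial_deriv i g x\<bar> * \<tau>) * (\<bar>partial_deriv j g x\<bar> * \<tau>) \<le> A * A"
      using g1[of i] g1[of j] \<tau> by (intro mult_mono) (auto intro: order_trans[OF mult_nonneg_nonneg[OF abs_ge_zero \<tau>] g1[of i]])
    then have "\<bar>F''\<bar> * ((\<bar>partial_deriv i g x\<bar> * \<tau>) * (\<bar>partial_deriv j g x\<bar> * \<tau>)) \<le> \<bar>F''\<bar> * A\<^sup>2"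
      unfolding power2_eq_square by (intro mult_left_mono) auto
    with 1 bds have 2: "(\<bar>F' (g x)\<bar> * \<bar>partial_deriv i (partial_deriv j g) x\<bar>
        + \<bar>F''\<bar> * \<bar>partial_deriv i g x\<bar> * \<bar>partial_deriv j g x\<bar>) * \<tau>\<^sup>2 \<le> 2 * b"
      by (simp add: algebra_simps power2_eq_square)
    have "\<bar>partial_deriv i (partial_deriv j (\<lambda>x. F (g x))) x\<bar> * \<tau>\<^sup>2 \<le>
        (\<bar>F' (g x)\<bar> * \<bar>partial_deriv i (partial_deriv j g) x\<bar>
        + \<bar>F''\<bar> * \<bar>partial_deriv i g x\<bar> * \<bar>partial_deriv j g x\<bar>) * \<tau>\<^sup>2"
    proof (rule mult_right_mono)
      have "partial_deriv i (partial_deriv j (\<lambda>x. F (g x))) x = F' (g x) * partial_deriv i (partial_deriv j g) x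
          + F'' * partial_deriv i g x * partial_deriv j g x"
        by (rule partial_deriv2_compose[OF assms(1-3)]) (use F F' in auto)
      then show "\<bar>partial_deriv i (partial_deriv j (\<lambda>x. F (g x))) x\<bar> \<le>
          \<bar>F' (g x)\<bar> * \<bar>partial_deriv i (partial_deriv j g) x\<bar>
          + \<bar>F''\<bar> * \<bar>partial_deriv i g x\<bar> * \<bar>partial_deriv j g x\<bar>"
        unfolding abs_mult[symmetric] by (simp only: abs_triangle_ineq)
    qed simp
    then show "\<bar>partial_deriv i (partial_deriv j (\<lambda>x. F (g x))) x\<bar> * \<tau>\<^sup>2 \<le> 2 * b" using 2 by simp
  qed
qed

lemma smooth_on_inner_self: "open U \<Longrightarrow> smooth_on U (\<lambda>x::real^'n::finite. x \<bullet> x)"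
  unfolding inner_vec_def inner_real_def by (intro smooth_on_sum smooth_on_mult smooth_on_nth)

lemma partial_deriv_inner_self: "partial_deriv i (\<lambda>x. x \<bullet> x) = (\<lambda>x::real^'n::finite. 2 * x $ i)"
proof
  fix x :: "real^'n"
  have "((\<lambda>x. x \<bullet> x) has_derivative (\<lambda>h. x \<bullet> h + h \<bullet> x)) (at x)"
    by (rule has_derivative_inner[OF has_derivative_ident has_derivative_ident])
  from partial_deriv_eq[OF this] show "partial_deriv i (\<lambda>x. x \<bullet> x) x = 2 * x $ i"
    by (simp add: inner_axis inner_commute[of "axis i 1"])
qed

lemma partial_deriv_cmult_nth: "partial_deriv i (\<lambda>x. c * x $ j) = (\<lambda>_::real^'n::finite. if i = j then c else 0)"
proof
  fix x :: "real^'n"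
  have "((\<lambda>x::real^'n. c * x $ j) has_derivative (\<lambda>h. c * h $ j)) (at x)"
    by (rule has_derivative_mult_right[OF has_derivative_vec_nth_real])
  from partial_deriv_eq[OF this] show "partial_deriv i (\<lambda>x. c * x $ j) x = (if i = j then c else 0)"
    by (auto simp: axis_def)
qed

section \<open>The extension of the profile\<close>

text \<open>On the ball \<open>|x|\<^sup>2 < 2 x\<^sub>1\<close> the function \<open>height\<close> is \<open>x\<^sub>1\<close>, and outside \<open>|x|\<^sup>2 < 4 x\<^sub>1\<close> it is
  \<open>|x|\<^sup>2 / 4\<close>. It replaces \<open>x\<^sub>1\<close> only in the slowly varying factor of
  \<open>\<chi>\<^sub>1(x\<^sub>1) = x\<^sub>1 (\<chi>\<^sub>1(x\<^sub>1) / x\<^sub>1)\<close>: a cut-off of \<open>\<chi>\<^sub>1(x\<^sub>1)\<close> itself would not be in \<open>H\<^sup>2\<close>.\<close>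

definition gap :: "real^3 \<Rightarrow> real" where
  "gap x = x $ 1 + (- (1/4)) * (x \<bullet> x)"

definition height :: "real^3 \<Rightarrow> real" where
  "height x = (1/4) * (x \<bullet> x) + gap x * step (4 * (gap x * inverse (x \<bullet> x)))"

lemma height_inner: "gap x \<ge> (x \<bullet> x) / 4 \<Longrightarrow> x \<noteq> 0 \<Longrightarrow> height x = x $ 1"
  by (auto simp: height_def gap_def step_ge_1 field_simps)

lemma height_outer: "gap x \<le> 0 \<Longrightarrow> height x = (1/4) * (x \<bullet> x)"
  by (auto simp: height_def step_le_0 mult_nonpos_nonneg)

lemma height_ge: "(x \<bullet> x) / 4 \<le> height x"
proof (cases "gap x \<le> 0")
  case False
  then have "0 \<le> gap x * step (4 * (gap x * inverse (x \<bullet> x)))"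
    by (intro mult_nonneg_nonneg step_nonneg) auto
  then show ?thesis by (simp add: height_def)
qed (simp add: height_outer)

lemma height_le: "gap x \<ge> 0 \<Longrightarrow> height x \<le> x $ 1"
  using mult_left_le[OF step_le_1, of "gap x" "4 * (gap x * inverse (x \<bullet> x))"]
  by (simp add: height_def gap_def)

text \<open>Used with r = 4 it keeps \<open>ln (4 / height x)\<close> positive; used with r = 7/2 it
  keeps it away from 0.\<close>

lemma height_less:
  assumes "norm x < r" "r \<le> 4" "0 < r"
  shows "height x < r"
proof (cases "gap x \<ge> 0")
  case True
  then show ?thesis using height_le[OF True] component_le_norm_cart[of x 1] assms by linarith
next
  case False
  have "(norm x)\<^sup>2 < r\<^sup>2" using assms by (intro power_strict_mono) auto
  moreover have "r\<^sup>2 \<le> 4 * r" using assms unfolding power2_eq_square by (intro mult_right_mono) auto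
  ultimately have "x \<bullet> x < 4 * r" unfolding power2_norm_eq_inner by linarith
  then show ?thesis using False by (simp add: height_outer)
qed

lemma height_pos: "x \<noteq> 0 \<Longrightarrow> 0 < height x"
  using height_ge[of x] inner_gt_zero_iff[of x] by linarith

lemma smooth_on_gap: "open U \<Longrightarrow> smooth_on U gap"
  unfolding gap_def by (intro smooth_on_add smooth_on_nth smooth_on_mult smooth_on_const smooth_on_inner_self)

lemma smooth_on_height:
  assumes "open U" "0 \<notin> U"
  shows "smooth_on U height"
  unfolding height_def using assms
  by (intro smooth_on_add smooth_on_mult smooth_on_const smooth_on_inner_self smooth_on_step
      smooth_on_gap smooth_on_inverse) auto

lemma height_jet_inner:
  assumes "x \<bullet> x < 2 * x $ 1"
  shows "partial_deriv i height x = (if i = 1 then 1 else 0)"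
    and "partial_deriv i (partial_deriv j height) x = 0"
proof -
  let ?U = "{x::real^3. x \<bullet> x < 2 * x $ 1}"
  have U: "open ?U" by (intro open_Collect_less continuous_intros)
  have eq: "height y = y $ 1" if "y \<in> ?U" for y
    using that by (intro height_inner) (auto simp: gap_def)
  have x: "x \<in> ?U" using assms by simp
  show "partial_deriv i height x = (if i = 1 then 1 else 0)"
    using iter_partial_deriv_cong[OF U eq x, where I = "[i]"] by simp
  show "partial_deriv i (partial_deriv j height) x = 0"
    using iter_partial_deriv_cong[OF U eq x, where I = "[i, j]"] by simp
qed

lemma height_jet_outer:
  assumes "gap x < 0"
  shows "partial_deriv i height x = x $ i / 2"
    and "partial_deriv i (partial_deriv j height) x = (if i = j then 1/2 else 0)"
proof -
  let ?U = "{x. gap x < 0}"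
  have "continuous_on UNIV gap" by (rule smooth_on_imp_continuous_on[OF smooth_on_gap]) simp
  then have U: "open ?U" by (intro open_Collect_less continuous_intros)
  have eq: "height y = (1/4) * (y \<bullet> y)" if "y \<in> ?U" for y
    using that by (intro height_outer) auto
  have x: "x \<in> ?U" using assms by simp
  have d: "(\<lambda>x::real^3. x \<bullet> x) differentiable (at x)" for x
    by (rule smooth_on_imp_differentiable[OF smooth_on_inner_self[OF open_UNIV]]) auto
  have 1: "partial_deriv i (\<lambda>x::real^3. (1/4) * (x \<bullet> x)) = (\<lambda>x. (1/2) * x $ i)" for i
    by (rule ext, subst partial_deriv_mult) (use d in \<open>auto simp: partial_deriv_inner_self\<close>)
  show "partial_deriv i height x = x $ i / 2"
    using iter_partial_deriv_cong[OF U eq x, where I = "[i]"] 1 by simp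
  show "partial_deriv i (partial_deriv j height) x = (if i = j then 1/2 else 0)"
    using iter_partial_deriv_cong[OF U eq x, where I = "[i, j]"] 1 partial_deriv_cmult_nth[of i "1/2" j] by simp
qed

text \<open>In this layer x_1 lies between |x|^2/4 and |x|^2/2, so |x|^2 is the natural length
  scale. On it \<open>x $ 1\<close>, \<open>gap\<close> and \<open>x \<bullet> x\<close> have jets
  of order |x|^2 and the inverse of \<open>x \<bullet> x\<close> has jets of order |x|^-2. The
  argument of \<open>step\<close> then has bounded jets.\<close>

lemma height_jet_transition:
  obtains C where "C \<ge> 1" "\<And>x. x \<noteq> 0 \<Longrightarrow> norm x \<le> 3 \<Longrightarrow> 0 \<le> gap x \<Longrightarrow> 2 * x $ 1 \<le> x \<bullet> x \<Longrightarrow>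
    jet_bound height x (x \<bullet> x) (C * height x)"
proof -
  obtain K where K: "K \<ge> 1" "\<And>z. \<bar>bump z / bump_mass\<bar> \<le> K" "\<And>z. \<bar>bump' z / bump_mass\<bar> \<le> K"
    using step_derivs_bounded by metis
  \<comment> \<open>\<open>A\<close> is the jet bound of the argument of \<open>step\<close>: 4 * 4
    * 4 * 19 * 1296, with 19 from \<open>gap\<close>, 1296 from the inverse of |x|^2, and the rest
    from two products and the scalar 4. In \<open>C\<close>, 680 = 4 * (18 + 152), the 4 coming from
    \<open>height x \<ge> (x \<bullet> x) / 4\<close>.\<close>
  define A :: real where "A = 1575936"
  define C where "C = 680 * (K * A\<^sup>2)"
  have A: "A \<ge> 1" by (simp add: A_def)
  have KA: "K * A\<^sup>2 \<ge> 1" using K(1) A by (simp add: one_le_power mult_ge1_I)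
  have "jet_bound height x (x \<bullet> x) (C * height x)"
    if x: "x \<noteq> 0" "norm x \<le> 3" "0 \<le> gap x" "2 * x $ 1 \<le> x \<bullet> x" for x :: "real^3"
  proof -
    define q where "q = x \<bullet> x"
    have q: "q > 0" using x by (simp add: q_def)
    have q9: "q \<le> 9"
    proof -
      have "(norm x)\<^sup>2 \<le> 3\<^sup>2" using x by (intro power_mono) auto
      then show ?thesis by (simp add: q_def power2_norm_eq_inner)
    qed
    let ?U = "- {0::real^3}"
    have U: "open ?U" "x \<in> ?U" using x by auto
    have ne: "y \<bullet> y \<noteq> 0" if "y \<in> ?U" for y using that by simp
    have sm: "smooth_on ?U (\<lambda>x. x \<bullet> x)" "smooth_on ?U gap" "smooth_on ?U (\<lambda>x. x $ 1)"
      using U smooth_on_inner_self smooth_on_gap smooth_on_nth by blast+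
    have si: "smooth_on ?U (\<lambda>x. inverse (x \<bullet> x))" by (rule smooth_on_inverse[OF U(1) sm(1) ne])
    have x1: "\<bar>x $ 1\<bar> \<le> q" using x q unfolding gap_def q_def[symmetric] by linarith
    have j1: "jet_bound (\<lambda>x. x $ 1) x q q"
      using x1 q by (simp add: jet_bound_def)
    have qq: "jet_bound (\<lambda>x. x \<bullet> x) x q (18 * q)"
    proof -
      have "\<bar>x $ i\<bar> \<le> 9" for i using component_le_norm_cart[of x i] x by linarith
      moreover have "2 * q\<^sup>2 \<le> 18 * q" unfolding power2_eq_square using q q9 by simp
      ultimately show ?thesis
        unfolding jet_bound_def partial_deriv_inner_self partial_deriv_cmult_nth q_def[symmetric]
        using q by (auto simp: abs_mult)
    qed
    have jg: "jet_bound gap x q (19 * q)"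
    proof -
      have "jet_bound (\<lambda>x. (- (1/4)) * (x \<bullet> x)) x q (4 * \<bar>- (1/4)\<bar> * (18 * q))"
        by (rule jet_bound_mult[OF U smooth_on_const[OF U(1)] sm(1) jet_bound_const qq]) (use q in simp)
      from jet_bound_add[OF U sm(3) smooth_on_mult[OF U(1) smooth_on_const[OF U(1)] sm(1)] j1 this]
      show ?thesis using q unfolding gap_def[abs_def] by simp
    qed
    \<comment> \<open>648 = 2 * 18^2: the second derivative 2/q^3 of the inverse meets the squared
      jet bound 18 q.\<close>
    have ji: "jet_bound (\<lambda>x. inverse (x \<bullet> x)) x q (2 * (648 / q))"
    proof (rule jet_bound_compose[OF U sm(1) _ _ qq])
      show "(inverse has_real_derivative - (inverse (y \<bullet> y) ^ 2)) (at (y \<bullet> y))" if "y \<in> ?U" for y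
        using DERIV_inverse[OF ne[OF that]] by (simp add: numeral_2_eq_2)
      show "((\<lambda>z. - (inverse z ^ 2)) has_real_derivative 2 / q ^ 3) (at (x \<bullet> x))"
        using q unfolding q_def[symmetric]
        by (auto intro!: derivative_eq_intros simp: field_simps power2_eq_square power3_eq_cube)
    qed (use q in \<open>auto simp: q_def[symmetric] field_simps power2_eq_square power3_eq_cube\<close>)
    have jz: "jet_bound (\<lambda>x. gap x * inverse (x \<bullet> x)) x q (4 * (19 * q) * (2 * (648 / q)))"
      by (rule jet_bound_mult[OF U sm(2) si jg ji]) (use q in simp)
    have jz': "jet_bound (\<lambda>x. 4 * (gap x * inverse (x \<bullet> x))) x q (4 * \<bar>4\<bar> * (4 * (19 * q) * (2 * (648 / q))))"
      by (rule jet_bound_mult[OF U smooth_on_const[OF U(1)] smooth_on_mult[OF U(1) sm(2) si] jet_bound_const jz])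
         (use q in simp)
    then have jz'': "jet_bound (\<lambda>x. 4 * (gap x * inverse (x \<bullet> x))) x q A"
      by (rule jet_bound_mono) (use q in \<open>simp add: A_def\<close>)
    have sz: "smooth_on ?U (\<lambda>x. 4 * (gap x * inverse (x \<bullet> x)))"
      by (intro smooth_on_mult smooth_on_const U sm si)
    have b: "t * A \<le> K * A\<^sup>2" "t * A\<^sup>2 \<le> K * A\<^sup>2" if "t \<le> K" for t
    proof -
      have "A \<le> A\<^sup>2" using A by (simp add: power2_eq_square)
      then show "t * A \<le> K * A\<^sup>2" using that K(1) A by (intro mult_mono) auto
      show "t * A\<^sup>2 \<le> K * A\<^sup>2" using that by (intro mult_right_mono) auto
    qed
    have js: "jet_bound (\<lambda>x. step (4 * (gap x * inverse (x \<bullet> x)))) x q (2 * (K * A\<^sup>2))"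
    proof (rule jet_bound_compose[OF U sz has_real_derivative_step _ jz''])
      show "((\<lambda>z. bump z / bump_mass) has_real_derivative bump' z / bump_mass) (at z)" for z
        by (rule DERIV_cdivide[OF has_real_derivative_bump])
      show "\<bar>step z\<bar> \<le> K * A\<^sup>2" for z
        using step_nonneg[of z] step_le_1[of z] KA by linarith
      show "\<bar>bump z / bump_mass\<bar> * A \<le> K * A\<^sup>2" "\<bar>bump' z / bump_mass\<bar> * A\<^sup>2 \<le> K * A\<^sup>2" for z
        by (rule b(1)[OF K(2)] b(2)[OF K(3)])+
    qed (use q in simp)
    have jgs: "jet_bound (\<lambda>x. gap x * step (4 * (gap x * inverse (x \<bullet> x)))) x q (4 * (19 * q) * (2 * (K * A\<^sup>2)))"
      by (rule jet_bound_mult[OF U sm(2) smooth_on_step[OF U(1) sz] jg js]) (use q in simp)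
    have jq: "jet_bound (\<lambda>x. (1/4) * (x \<bullet> x)) x q (4 * \<bar>1/4\<bar> * (18 * q))"
      by (rule jet_bound_mult[OF U smooth_on_const[OF U(1)] sm(1) jet_bound_const qq]) (use q in simp)
    have "jet_bound height x q (4 * \<bar>1/4\<bar> * (18 * q) + 4 * (19 * q) * (2 * (K * A\<^sup>2)))"
      unfolding height_def[abs_def]
      by (rule jet_bound_add[OF U smooth_on_mult[OF U(1) smooth_on_const[OF U(1)] sm(1)]
            smooth_on_mult[OF U(1) sm(2) smooth_on_step[OF U(1) sz]] jq jgs]) (use q in simp)
    moreover have "4 * \<bar>1/4\<bar> * (18 * q) + 4 * (19 * q) * (2 * (K * A\<^sup>2)) \<le> C * height x"
    proof -
      have "18 * q \<le> 18 * (q * (K * A\<^sup>2))" using q KA by simp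
      then have "4 * \<bar>1/4\<bar> * (18 * q) + 4 * (19 * q) * (2 * (K * A\<^sup>2)) \<le> C * (q / 4)"
        by (simp add: C_def algebra_simps)
      also have "\<dots> \<le> C * height x"
        using height_ge[of x] KA by (intro mult_left_mono) (auto simp: q_def C_def)
      finally show ?thesis .
    qed
    ultimately show ?thesis unfolding q_def by (rule jet_bound_mono)
  qed
  moreover have "C \<ge> 1" using KA by (simp add: C_def)
  ultimately show ?thesis using that by blast
qed

text \<open>The scale \<tau> is x_1 where |x|^2 < 2 x_1, |x|^2 in the transition layer and |x|
  outside the paraboloid. It always dominates \<bar>x_1\<bar>, so a factor x_1 can pay for one
  derivative. The closing disjunction records that \<tau> can fall below |x| only inside the
  paraboloid |x|^2 \<le> 4 x_1, where \<open>height x \<le> x $ 1\<close>.\<close>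

lemma height_derivs:
  obtains C where "C \<ge> 1" "\<And>x. x \<noteq> 0 \<Longrightarrow> norm x \<le> 3 \<Longrightarrow> \<exists>\<tau>>0. \<bar>x $ 1\<bar> \<le> \<tau> \<and>
    (\<forall>i. \<bar>partial_deriv i height x\<bar> * \<tau> \<le> C * height x) \<and>
    (\<forall>i j. \<bar>partial_deriv i (partial_deriv j height) x\<bar> * \<tau>\<^sup>2 \<le> C * height x) \<and>
    (norm x \<le> \<tau> \<or> (x \<bullet> x \<le> 4 * x $ 1 \<and> x $ 1 \<le> \<tau> \<and> height x \<le> x $ 1))"
proof -
  obtain C where C: "C \<ge> 1" "\<And>x. x \<noteq> 0 \<Longrightarrow> norm x \<le> 3 \<Longrightarrow> 0 \<le> gap x \<Longrightarrow> 2 * x $ 1 \<le> x \<bullet> x \<Longrightarrow>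
    jet_bound height x (x \<bullet> x) (C * height x)"
    using height_jet_transition by metis
  have "\<exists>\<tau>>0. \<bar>x $ 1\<bar> \<le> \<tau> \<and>
    (\<forall>i. \<bar>partial_deriv i height x\<bar> * \<tau> \<le> (C + 2) * height x) \<and>
    (\<forall>i j. \<bar>partial_deriv i (partial_deriv j height) x\<bar> * \<tau>\<^sup>2 \<le> (C + 2) * height x) \<and>
    (norm x \<le> \<tau> \<or> (x \<bullet> x \<le> 4 * x $ 1 \<and> x $ 1 \<le> \<tau> \<and> height x \<le> x $ 1))"
    if x: "x \<noteq> 0" "norm x \<le> 3" for x :: "real^3"
  proof -
    have q: "x \<bullet> x > 0" using x by simp
    have h: "height x > 0" using height_pos x by blast
    consider "x \<bullet> x < 2 * x $ 1" | "gap x < 0" | "0 \<le> gap x" "2 * x $ 1 \<le> x \<bullet> x" by linarith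
    then show ?thesis
    proof cases
      case 1
      have e: "height x = x $ 1" using 1 x by (intro height_inner) (auto simp: gap_def)
      have x1: "x $ 1 > 0" using 1 q by linarith
      have "x $ 1 \<le> (C + 2) * x $ 1" using C(1) x1 by (simp add: mult_le_cancel_right1)
      moreover have "x \<bullet> x \<le> 4 * x $ 1" using 1 x1 by linarith
      ultimately show ?thesis
        using x1 by (intro exI[of _ "x $ 1"]) (auto simp: height_jet_inner[OF 1] e)
    next
      case 2
      have n: "norm x * norm x = x \<bullet> x" using power2_norm_eq_inner[of x] by (simp add: power2_eq_square)
      have le: "x \<bullet> x / 2 \<le> (C + 2) * height x"
      proof -
        have "2 * height x \<le> (C + 2) * height x" using C(1) h by (intro mult_right_mono) auto
        then show ?thesis using height_ge[of x] by linarith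
      qed
      have "\<bar>x $ i / 2\<bar> * norm x \<le> (C + 2) * height x" for i
      proof -
        have "\<bar>x $ i\<bar> * norm x \<le> norm x * norm x"
          by (intro mult_right_mono component_le_norm_cart) auto
        then show ?thesis using le n by simp
      qed
      then show ?thesis
        using x le component_le_norm_cart[of x 1] h C(1)
        by (intro exI[of _ "norm x"]) (auto simp: height_jet_outer[OF 2] power2_norm_eq_inner)
    next
      case 3
      have "jet_bound height x (x \<bullet> x) ((C + 2) * height x)"
        using C(2)[OF x 3] by (rule jet_bound_mono) (use h in simp)
      then show ?thesis
        using 3 q height_le[OF 3(1)] by (intro exI[of _ "x \<bullet> x"]) (auto simp: jet_bound_def gap_def)
    qed
  qed
  then show ?thesis using that[of "C + 2"] C(1) by auto
qed

section \<open>The mean of the profile and its composition with the height\<close>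

definition logM :: "real \<Rightarrow> real \<Rightarrow> real" where
  "logM \<beta> p = logW \<beta> p / p"

lemma has_real_derivative_logM:
  assumes "0 < \<beta>" "0 < p"
  shows "(logM \<beta> has_real_derivative (logw \<beta> p - logM \<beta> p) / p) (at p)"
  unfolding logM_def[abs_def] using assms
  by (auto intro!: derivative_eq_intros has_real_derivative_logW simp: field_simps)

lemma has_real_derivative_logM':
  assumes "0 < \<beta>" "0 < p" "p < 4"
  shows "((\<lambda>p. (logw \<beta> p - logM \<beta> p) / p) has_real_derivative
    (- (\<beta> * ln (4 / p) powr (\<beta> - 1)) - 2 * (logw \<beta> p - logM \<beta> p)) / p\<^sup>2) (at p)"
  using assms
  by (auto intro!: derivative_eq_intros has_real_derivative_logw has_real_derivative_logM
      simp: field_simps power2_eq_square)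

lemma logw_minus_logM:
  assumes "0 < \<beta>" "\<beta> < 1" "0 < p" "p < 4"
  shows "\<bar>logw \<beta> p - logM \<beta> p\<bar> \<le> ln (4 / p) powr (\<beta> - 1)"
proof -
  have "logM \<beta> p - logw \<beta> p = (logW \<beta> p - p * logw \<beta> p) / p"
    using assms by (simp add: logM_def field_simps)
  moreover have "0 \<le> (logW \<beta> p - p * logw \<beta> p) / p"
    using logW_minus_logw_bounds(1)[OF assms] assms by simp
  moreover have "(logW \<beta> p - p * logw \<beta> p) / p \<le> ln (4 / p) powr (\<beta> - 1)"
    using logW_minus_logw_bounds(2)[OF assms] assms by (simp add: divide_le_eq mult.commute)
  ultimately show ?thesis by (simp add: abs_le_iff)
qed

lemma logM_derivs_bound:
  assumes "0 < \<beta>" "\<beta> < 1" "0 < p" "p < 4"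
  shows "\<bar>(logw \<beta> p - logM \<beta> p) / p\<bar> \<le> ln (4 / p) powr (\<beta> - 1) / p"
    and "\<bar>(- (\<beta> * ln (4 / p) powr (\<beta> - 1)) - 2 * (logw \<beta> p - logM \<beta> p)) / p\<^sup>2\<bar> \<le>
      3 * ln (4 / p) powr (\<beta> - 1) / p\<^sup>2"
proof -
  note b = logw_minus_logM[OF assms]
  have aux: "\<bar>- a - 2 * d\<bar> \<le> 3 * l" if "0 \<le> a" "a \<le> l" "\<bar>d\<bar> \<le> l" for a d l :: real
    using that by linarith
  show "\<bar>(logw \<beta> p - logM \<beta> p) / p\<bar> \<le> ln (4 / p) powr (\<beta> - 1) / p"
    using b assms by (simp add: divide_right_mono)
  have "0 \<le> \<beta> * ln (4 / p) powr (\<beta> - 1)" "\<beta> * ln (4 / p) powr (\<beta> - 1) \<le> 1 * ln (4 / p) powr (\<beta> - 1)"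
    using assms by (auto intro!: mult_right_mono)
  then have "\<bar>- (\<beta> * ln (4 / p) powr (\<beta> - 1)) - 2 * (logw \<beta> p - logM \<beta> p)\<bar> \<le> 3 * ln (4 / p) powr (\<beta> - 1)"
    using b aux by simp
  then show "\<bar>(- (\<beta> * ln (4 / p) powr (\<beta> - 1)) - 2 * (logw \<beta> p - logM \<beta> p)) / p\<^sup>2\<bar> \<le>
      3 * ln (4 / p) powr (\<beta> - 1) / p\<^sup>2"
    by (simp add: divide_right_mono)
qed

lemma smooth_on_logM_height:
  assumes "0 < \<beta>" "open U" "\<And>x. x \<in> U \<Longrightarrow> x \<noteq> 0 \<and> norm x < 4"
  shows "smooth_on U (\<lambda>x. logM \<beta> (height x))"
proof -
  have h: "0 < height x" "height x < 4" if "x \<in> U" for x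
    using assms(3)[OF that] height_pos[of x] height_less[of x 4] by auto
  have sh: "smooth_on U height" using assms by (intro smooth_on_height) auto
  have sw: "smooth_on U (\<lambda>x. logw \<beta> (height x))"
  proof (rule smooth_on_cong[OF assms(2)])
    show "logw \<beta> (height y) = ln (4 / height y) powr \<beta>" if "y \<in> U" for y
      using h[OF that] by (rule logw_eq)
    have "0 < ln (4 / height y)" "0 < 4 / height y" "height y \<noteq> 0" if "y \<in> U" for y
      using h[OF that] by auto
    then show "smooth_on U (\<lambda>x. ln (4 / height x) powr \<beta>)"
      by (intro smooth_on_powr smooth_on_ln smooth_on_divide smooth_on_const assms(2) sh) auto
  qed
  show ?thesis
  proof (rule smooth_on_compose[OF assms(2) sh,
        where d = "\<lambda>x. (logw \<beta> (height x) + (-1) * logM \<beta> (height x)) * inverse (height x)"])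
    show "(logM \<beta> has_real_derivative (logw \<beta> (height x) + (-1) * logM \<beta> (height x)) * inverse (height x))
        (at (height x))" if "x \<in> U" for x
      using has_real_derivative_logM[OF assms(1) h(1)[OF that]] by (simp add: divide_inverse)
    have "smooth_on U (\<lambda>x. inverse (height x))"
      using h by (intro smooth_on_inverse assms(2) sh) force
    then show "(\<lambda>x. (logw \<beta> (height x) + (-1) * logM \<beta> (height x)) * inverse (height x))
        \<in> alg (insert (\<lambda>x. logM \<beta> (height x)) {f. smooth_on U f})"
      using sw assms(2) by (intro alg_mult alg_add) (auto intro: alg_base)
  qed
qed

text \<open>The borderline part of the second derivatives of the extension. Its paraboloid contains
  both the ball and the transition layer.\<close>

definition singular_part :: "real \<Rightarrow> real^3 \<Rightarrow> real" where
  "singular_part \<beta> x = (if x \<bullet> x \<le> 4 * x $ 1 then ln (4 / x $ 1) powr (\<beta> - 1) / x $ 1 else 0)"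

lemma singular_part_nonneg: "0 \<le> singular_part \<beta> x"
proof (cases "x \<bullet> x \<le> 4 * x $ 1")
  case True
  then have "0 \<le> x $ 1" using inner_ge_zero[of x] by linarith
  then show ?thesis by (simp add: singular_part_def)
qed (simp add: singular_part_def)

text \<open>By the chain rule each derivative costs 1/\<tau>, and differentiating at all replaces
  the size of the mean by l = ln(4/height)^(\<beta>-1). In the second derivative the factor
  \<open>x $ 1\<close> absorbs one 1/\<tau>. The remaining l/\<tau> is at most a multiple of
  \<open>1 / norm x\<close>, or at most \<open>singular_part\<close>, according to the disjunction
  in \<open>height_derivs\<close>.\<close>

lemma logM_height_bounds:
  assumes "0 < \<beta>" "\<beta> < 1"
  obtains C where "C \<ge> 0" "\<And>x. x \<noteq> 0 \<Longrightarrow> norm x \<le> 3 \<Longrightarrow>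
    \<bar>logM \<beta> (height x)\<bar> \<le> C / norm x \<and>
    (\<forall>i. \<bar>x $ 1 * partial_deriv i (\<lambda>x. logM \<beta> (height x)) x\<bar> \<le> C / norm x) \<and>
    (\<forall>i. \<bar>partial_deriv i (\<lambda>x. logM \<beta> (height x)) x\<bar> \<le> C * (1 / norm x + singular_part \<beta> x)) \<and>
    (\<forall>i j. \<bar>x $ 1 * partial_deriv i (partial_deriv j (\<lambda>x. logM \<beta> (height x))) x\<bar>
      \<le> C * (1 / norm x + singular_part \<beta> x))"
proof -
  obtain D where D: "D \<ge> 1" "\<And>x. x \<noteq> 0 \<Longrightarrow> norm x \<le> 3 \<Longrightarrow> \<exists>\<tau>>0. \<bar>x $ 1\<bar> \<le> \<tau> \<and>
    (\<forall>i. \<bar>partial_deriv i height x\<bar> * \<tau> \<le> D * height x) \<and>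
    (\<forall>i j. \<bar>partial_deriv i (partial_deriv j height) x\<bar> * \<tau>\<^sup>2 \<le> D * height x) \<and>
    (norm x \<le> \<tau> \<or> (x \<bullet> x \<le> 4 * x $ 1 \<and> x $ 1 \<le> \<tau> \<and> height x \<le> x $ 1))"
    using height_derivs by metis
  obtain C1 where C1: "C1 \<ge> 0" "\<And>y. \<bar>y\<bar> \<le> 4 \<Longrightarrow> \<bar>logW \<beta> y\<bar> \<le> C1 * \<bar>y\<bar> powr (1/2)"
    using logW_bound[OF assms(1), of 4] by auto
  \<comment> \<open>For \<open>norm x \<le> 3\<close> the height is below 7/2, so the logarithm of
    4/height exceeds ln (8/7), and the negative exponent turns this into an upper bound.\<close>
  define c0 where "c0 = ln (8/7) powr (\<beta> - 1)"
  have c0: "c0 \<ge> 0" by (simp add: c0_def)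
  define C where "C = 2 * C1 + 4 * D\<^sup>2 * (3 * c0 + 1)"
  have D2: "D \<le> D\<^sup>2" using D(1) by (simp add: power2_eq_square)
  have main: "\<bar>logM \<beta> (height x)\<bar> \<le> C / norm x \<and>
    (\<forall>i. \<bar>x $ 1 * partial_deriv i (\<lambda>x. logM \<beta> (height x)) x\<bar> \<le> C / norm x) \<and>
    (\<forall>i. \<bar>partial_deriv i (\<lambda>x. logM \<beta> (height x)) x\<bar> \<le> C * (1 / norm x + singular_part \<beta> x)) \<and>
    (\<forall>i j. \<bar>x $ 1 * partial_deriv i (partial_deriv j (\<lambda>x. logM \<beta> (height x))) x\<bar>
      \<le> C * (1 / norm x + singular_part \<beta> x))"
    if x: "x \<noteq> 0" "norm x \<le> 3" for x :: "real^3"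
  proof -
    let ?N = "\<lambda>x. logM \<beta> (height x)" and ?U = "{x::real^3. x \<noteq> 0 \<and> norm x < 4}"
    define h where "h = height x"
    define l where "l = ln (4 / h) powr (\<beta> - 1)"
    define n where "n = norm x"
    define s where "s = singular_part \<beta> x"
    have s0: "s \<ge> 0" unfolding s_def by (rule singular_part_nonneg)
    have n: "0 < n" "n \<le> 3" using x by (auto simp: n_def)
    have h: "0 < h" "h < 7/2"
      using height_pos[OF x(1)] height_less[of x "7/2"] x by (auto simp: h_def)
    have l: "0 \<le> l" "l \<le> c0"
      unfolding l_def c0_def using h assms by (auto intro!: powr_mono2' simp: field_simps)
    obtain \<tau> where \<tau>: "\<tau> > 0" "\<bar>x $ 1\<bar> \<le> \<tau>"
      and h1: "\<And>i. \<bar>partial_deriv i height x\<bar> * \<tau> \<le> D * h"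
      and h2: "\<And>i j. \<bar>partial_deriv i (partial_deriv j height) x\<bar> * \<tau>\<^sup>2 \<le> D * h"
      and alt: "n \<le> \<tau> \<or> (x \<bullet> x \<le> 4 * x $ 1 \<and> x $ 1 \<le> \<tau> \<and> h \<le> x $ 1)"
      using D(2)[OF x] unfolding h_def n_def by blast
    have U: "open ?U" "x \<in> ?U"
      using x by (auto intro!: open_Collect_conj open_Collect_neq open_Collect_less continuous_intros)
    have sh: "smooth_on ?U height" by (rule smooth_on_height[OF U(1)]) auto
    have dh: "height differentiable (at x)" by (rule smooth_on_imp_differentiable[OF sh U])
    have hU: "0 < height y" "height y < 4" if "y \<in> ?U" for y
      using that height_pos[of y] height_less[of y 4] by auto
    have h4: "h < 4" using h by simp
    note M1 = logM_derivs_bound[OF assms h(1) h4, folded l_def]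
    have N1: "\<bar>partial_deriv i ?N x\<bar> * \<tau> \<le> D * l" for i
    proof -
      have "partial_deriv i ?N x = (logw \<beta> h - logM \<beta> h) / h * partial_deriv i height x"
        unfolding h_def by (rule partial_deriv_compose[OF dh has_real_derivative_logM])
          (use assms hU U in auto)
      then have "\<bar>partial_deriv i ?N x\<bar> * \<tau> = \<bar>(logw \<beta> h - logM \<beta> h) / h\<bar> * (\<bar>partial_deriv i height x\<bar> * \<tau>)"
        by (simp add: abs_mult)
      also have "\<dots> \<le> (l / h) * (D * h)"
        by (intro mult_mono M1 h1) (use \<tau> l h in auto)
      also have "\<dots> = D * l" using h by simp
      finally show ?thesis .
    qed
    have N2: "\<bar>partial_deriv i (partial_deriv j ?N) x\<bar> * \<tau>\<^sup>2 \<le> 4 * D\<^sup>2 * l" for i j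
    proof -
      let ?m = "(logw \<beta> h - logM \<beta> h) / h"
        and ?m' = "(- (\<beta> * ln (4 / h) powr (\<beta> - 1)) - 2 * (logw \<beta> h - logM \<beta> h)) / h\<^sup>2"
      have "partial_deriv i (partial_deriv j ?N) x =
          ?m * partial_deriv i (partial_deriv j height) x +
          ?m' * partial_deriv i height x * partial_deriv j height x"
        unfolding h_def
        by (rule partial_deriv2_compose[OF U sh has_real_derivative_logM has_real_derivative_logM'])
           (use assms hU U in auto)
      then have "\<bar>partial_deriv i (partial_deriv j ?N) x\<bar> \<le>
          \<bar>?m\<bar> * \<bar>partial_deriv i (partial_deriv j height) x\<bar> +
          \<bar>?m'\<bar> * \<bar>partial_deriv i height x\<bar> * \<bar>partial_deriv j height x\<bar>"
        unfolding abs_mult[symmetric] by (simp only: abs_triangle_ineq)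
      then have "\<bar>partial_deriv i (partial_deriv j ?N) x\<bar> * \<tau>\<^sup>2 \<le>
          (\<bar>?m\<bar> * \<bar>partial_deriv i (partial_deriv j height) x\<bar> +
          \<bar>?m'\<bar> * \<bar>partial_deriv i height x\<bar> * \<bar>partial_deriv j height x\<bar>) * \<tau>\<^sup>2"
        by (rule mult_right_mono) simp
      also have "\<dots> = \<bar>?m\<bar> * (\<bar>partial_deriv i (partial_deriv j height) x\<bar> * \<tau>\<^sup>2) +
          \<bar>?m'\<bar> * ((\<bar>partial_deriv i height x\<bar> * \<tau>) * (\<bar>partial_deriv j height x\<bar> * \<tau>))"
        by (simp only: power2_eq_square distrib_right distrib_left mult_ac)
      also have "\<dots> \<le> (l / h) * (D * h) + (3 * l / h\<^sup>2) * ((D * h) * (D * h))"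
      proof (rule add_mono)
        show "\<bar>?m\<bar> * (\<bar>partial_deriv i (partial_deriv j height) x\<bar> * \<tau>\<^sup>2) \<le> (l / h) * (D * h)"
          by (rule mult_mono[OF M1(1) h2]) (use l h in auto)
        have "\<bar>?m'\<bar> \<le> 3 * l / h\<^sup>2"
          using logM_derivs_bound(2)[OF assms h(1) h4] by (simp only: l_def)
        moreover have "(\<bar>partial_deriv i height x\<bar> * \<tau>) * (\<bar>partial_deriv j height x\<bar> * \<tau>) \<le> (D * h) * (D * h)"
          by (rule mult_mono[OF h1 h1]) (use \<tau> h D(1) in auto)
        ultimately show "\<bar>?m'\<bar> * ((\<bar>partial_deriv i height x\<bar> * \<tau>) * (\<bar>partial_deriv j height x\<bar> * \<tau>))
            \<le> (3 * l / h\<^sup>2) * ((D * h) * (D * h))"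
          by (rule mult_mono) (use \<tau> l in auto)
      qed
      also have "\<dots> = D * l + 3 * D\<^sup>2 * l" using h by (simp add: power2_eq_square)
      also have "\<dots> \<le> D\<^sup>2 * l + 3 * D\<^sup>2 * l" using D2 l by (intro add_mono mult_right_mono) auto
      finally show ?thesis by (simp add: mult_ac)
    qed
    have ls: "l / \<tau> \<le> (c0 + 1) * (1 / n + s)"
    proof -
      have "l / \<tau> \<le> c0 / n \<or> l / \<tau> \<le> s"
      proof (cases "n \<le> \<tau>")
        case True
        then have "l / \<tau> \<le> c0 / n" using l n by (intro frac_le) auto
        then show ?thesis ..
      next
        case False
        then have a: "x \<bullet> x \<le> 4 * x $ 1" "x $ 1 \<le> \<tau>" "h \<le> x $ 1" using alt by auto
        have x13: "x $ 1 \<le> 3" using component_le_norm_cart[of x 1] x by linarith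
        \<comment> \<open>The exponent is negative, so the smaller argument
          \<open>h \<le> x $ 1\<close> gives the smaller value.\<close>
        have "l \<le> ln (4 / x $ 1) powr (\<beta> - 1)"
          unfolding l_def using a h x13 assms by (intro powr_mono2') (auto simp: field_simps)
        then have "l / \<tau> \<le> ln (4 / x $ 1) powr (\<beta> - 1) / x $ 1"
          using a h l by (intro frac_le) auto
        then show ?thesis using a(1) by (simp add: s_def singular_part_def)
      qed
      moreover have "c0 / n \<le> (c0 + 1) * (1 / n + s)" "s \<le> (c0 + 1) * (1 / n + s)"
      proof -
        have "0 \<le> 1 / n" "0 \<le> c0 * s" "0 \<le> c0 / n" using n c0 s0 by auto
        moreover have "(c0 + 1) * (1 / n + s) = c0 / n + 1 / n + c0 * s + s"
          by (simp add: algebra_simps add_divide_distrib)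
        ultimately show "c0 / n \<le> (c0 + 1) * (1 / n + s)" "s \<le> (c0 + 1) * (1 / n + s)"
          using s0 by linarith+
      qed
      ultimately show ?thesis by linarith
    qed
    have ns: "0 \<le> 1 / n + s" using n s0 by simp
    have "\<bar>?N x\<bar> \<le> C / n"
    proof -
      \<comment> \<open>The mean is at most a multiple of the square root of h divided by h, and the
        square root of h is at least \<open>n / 2\<close>.\<close>
      have "h powr (1/2) = sqrt h" using h by (simp add: powr_half_sqrt)
      then have "\<bar>logW \<beta> h\<bar> \<le> C1 * sqrt h" using C1(2)[of h] h by simp
      then have "\<bar>?N x\<bar> \<le> C1 * sqrt h / h"
        using h by (simp add: logM_def h_def[symmetric] divide_right_mono)
      also have "\<dots> = C1 / sqrt h" using h by (simp add: field_simps)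
      also have "\<dots> \<le> C1 / (n / 2)"
      proof -
        have "sqrt ((n / 2)\<^sup>2) \<le> sqrt h"
          using height_ge[of x] by (intro real_sqrt_le_mono) (simp add: h_def n_def power_divide power2_norm_eq_inner)
        then have "n / 2 \<le> sqrt h" using n by simp
        then show ?thesis using n h C1(1) by (intro divide_left_mono) auto
      qed
      also have "\<dots> = 2 * C1 / n" by simp
      also have "\<dots> \<le> C / n" using n c0 by (intro divide_right_mono) (auto simp: C_def)
      finally show ?thesis .
    qed
    moreover have "\<bar>x $ 1 * partial_deriv i ?N x\<bar> \<le> C / n" for i
    proof -
      have "\<bar>x $ 1 * partial_deriv i ?N x\<bar> \<le> \<tau> * \<bar>partial_deriv i ?N x\<bar>"
        unfolding abs_mult using \<tau> by (intro mult_right_mono) auto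
      also have "\<dots> \<le> D * l" using N1[of i] by (simp add: mult.commute)
      also have "\<dots> \<le> D\<^sup>2 * c0" using D D2 l c0 by (intro mult_mono) auto
      \<comment> \<open>A bounded quantity is written as a multiple of \<open>1 / n\<close>, using
        \<open>n \<le> 3\<close>, to give all lower-order bounds one shape.\<close>
      also have "\<dots> \<le> D\<^sup>2 * c0 * (3 / n)" 
        using mult_left_mono[of 1 "3 / n" "D\<^sup>2 * c0"] n c0 by simp
      also have "\<dots> = 3 * D\<^sup>2 * c0 / n" by simp
      also have "\<dots> \<le> C / n"
      proof (rule divide_right_mono)
        have "0 \<le> D\<^sup>2 * c0" using c0 by simp
        then show "3 * D\<^sup>2 * c0 \<le> C" using C1(1) by (simp add: C_def algebra_simps add_nonneg_nonneg)
      qed (use n in simp)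
      finally show ?thesis .
    qed
    moreover have "\<bar>partial_deriv i ?N x\<bar> \<le> C * (1 / n + s)" for i
    proof -
      have "\<bar>partial_deriv i ?N x\<bar> \<le> D * l / \<tau>" using N1[of i] \<tau> by (simp add: pos_le_divide_eq)
      also have "\<dots> = D * (l / \<tau>)" by simp
      also have "\<dots> \<le> D * ((c0 + 1) * (1 / n + s))" using D(1) ls by (intro mult_left_mono) auto
      also have "\<dots> = (D * (c0 + 1)) * (1 / n + s)" by simp
      also have "\<dots> \<le> C * (1 / n + s)"
      proof (rule mult_right_mono[OF _ ns])
        have "D * (c0 + 1) \<le> D\<^sup>2 * (3 * c0 + 1)" using D2 c0 by (intro mult_mono) auto
        moreover have "0 \<le> D\<^sup>2 * (3 * c0 + 1)" using c0 by simp
        ultimately show "D * (c0 + 1) \<le> C" using C1(1) unfolding C_def by linarith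
      qed
      finally show ?thesis .
    qed
    moreover have "\<bar>x $ 1 * partial_deriv i (partial_deriv j ?N) x\<bar> \<le> C * (1 / n + s)" for i j
    proof -
      have "\<bar>x $ 1 * partial_deriv i (partial_deriv j ?N) x\<bar> \<le> \<tau> * \<bar>partial_deriv i (partial_deriv j ?N) x\<bar>"
        unfolding abs_mult using \<tau> by (intro mult_right_mono) auto
      also have "\<dots> = \<bar>partial_deriv i (partial_deriv j ?N) x\<bar> * \<tau>\<^sup>2 / \<tau>"
        using \<tau> by (simp add: power2_eq_square)
      also have "\<dots> \<le> 4 * D\<^sup>2 * l / \<tau>" using \<tau> by (intro divide_right_mono N2) auto
      also have "\<dots> = 4 * D\<^sup>2 * (l / \<tau>)" by simp
      also have "\<dots> \<le> 4 * D\<^sup>2 * ((c0 + 1) * (1 / n + s))" using ls by (intro mult_left_mono) auto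
      also have "\<dots> = (4 * D\<^sup>2 * (c0 + 1)) * (1 / n + s)" by simp
      also have "\<dots> \<le> C * (1 / n + s)"
      proof (rule mult_right_mono[OF _ ns])
        have "4 * D\<^sup>2 * (c0 + 1) \<le> 4 * D\<^sup>2 * (3 * c0 + 1)" using c0 by (intro mult_left_mono) auto
        then show "4 * D\<^sup>2 * (c0 + 1) \<le> C" using C1(1) unfolding C_def by linarith
      qed
      finally show ?thesis .
    qed
    ultimately show ?thesis unfolding n_def s_def by blast
  qed
  show ?thesis
  proof (rule that[of C])
    show "C \<ge> 0" using C1(1) c0 by (simp add: C_def)
  qed (rule main)
qed

section \<open>Square integrability\<close>

text \<open>The least n with S/2^n < s is positive because s \<le> S; its predecessor is the
  scale.\<close>

lemma dyadic_scale:
  fixes s S :: real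
  assumes "0 < s" "s \<le> S"
  obtains k :: nat where "S / 2 ^ Suc k < s" "s \<le> S / 2 ^ k"
proof -
  obtain n where "(1/2) ^ n < s / S"
    using real_arch_pow_inv[of "s / S" "1/2"] assms by auto
  then have "S / 2 ^ n < s" using assms by (simp add: power_divide field_simps)
  then obtain m where m: "S / 2 ^ m < s" "\<And>i. i < m \<Longrightarrow> \<not> S / 2 ^ i < s"
    using ex_least_nat_le[of "\<lambda>n. S / 2 ^ n < s" n] by blast
  then obtain k where "m = Suc k" using assms by (cases m) auto
  then show ?thesis using that[of k] m(1) m(2)[of k] by auto
qed

lemma inner_self_eq3: "x \<bullet> x = (x $ 1)\<^sup>2 + (x $ 2)\<^sup>2 + (x $ 3)\<^sup>2" for x :: "real^3"
  by (simp add: inner_vec_def sum_3 power2_eq_square)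

abbreviation box3 :: "real \<Rightarrow> real \<Rightarrow> (real^3) set" where
  "box3 a b \<equiv> {x. - a \<le> x $ 1 \<and> x $ 1 \<le> a \<and> - b \<le> x $ 2 \<and> x $ 2 \<le> b \<and> - b \<le> x $ 3 \<and> x $ 3 \<le> b}"

lemma emeasure_subset_box3:
  assumes "A \<subseteq> box3 a b" "0 \<le> a" "0 \<le> b"
  shows "emeasure lebesgue A \<le> ennreal (8 * a * b\<^sup>2)"
proof -
  have "box3 a b \<in> sets lebesgue"
    by (rule fmeasurableD[OF lmeasurable_compact[OF emeasure_box3(2)]]) (use assms in auto)
  then have "emeasure lebesgue A \<le> emeasure lebesgue (box3 a b)"
    by (rule emeasure_mono[OF assms(1)])
  also have "\<dots> = ennreal (8 * a * b\<^sup>2)"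
    by (subst emeasure_box3(1)) (use assms in \<open>auto simp: power2_eq_square algebra_simps\<close>)
  finally show ?thesis .
qed

lemma norm_le_imp_box3: "norm x \<le> a \<Longrightarrow> x \<in> box3 a a"
  using component_le_norm_cart[of x 1] component_le_norm_cart[of x 2] component_le_norm_cart[of x 3]
  by (simp add: abs_le_iff)

lemma AE_lebesgue_neq: "AE x in lebesgue. x \<noteq> (c :: 'a::euclidean_space)"
  by (rule AE_I'[of "{c}"]) (auto simp: negligible_iff_null_sets[symmetric])

text \<open>On the shell of radius about 2^-k the integrand is of order 4^k and the volume of order
  8^-k.\<close>

lemma inverse_norm_square_integrable:
  "(\<integral>\<^sup>+x. ennreal (if norm (x::real^3) \<le> 3 then (1 / norm x)\<^sup>2 else 0) \<partial>lebesgue) < \<infinity>"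
proof (rule nn_integral_finite_cover[where
      A = "\<lambda>k. {x. 3 / 2 ^ Suc k \<le> norm x \<and> norm x \<le> 3 / 2 ^ k}" and
      a = "\<lambda>k. (2 ^ Suc k / 3)\<^sup>2" and b = "\<lambda>k. 8 * (3 / 2 ^ k) * (3 / 2 ^ k)\<^sup>2"])
  fix k :: nat
  have "closed {x::real^3. 3 / 2 ^ Suc k \<le> norm x \<and> norm x \<le> 3 / 2 ^ k}"
    by (intro closed_Collect_conj closed_Collect_le continuous_intros)
  then show "{x::real^3. 3 / 2 ^ Suc k \<le> norm x \<and> norm x \<le> 3 / 2 ^ k} \<in> sets lebesgue" by auto
  show "emeasure lebesgue {x::real^3. 3 / 2 ^ Suc k \<le> norm x \<and> norm x \<le> 3 / 2 ^ k}
      \<le> ennreal (8 * (3 / 2 ^ k) * (3 / 2 ^ k)\<^sup>2)"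
    using norm_le_imp_box3[of _ "3 / 2 ^ k"] by (intro emeasure_subset_box3) auto
next
  fix k :: nat and x :: "real^3"
  assume "x \<in> {x. 3 / 2 ^ Suc k \<le> norm x \<and> norm x \<le> 3 / 2 ^ k}"
  then have x: "3 / 2 ^ Suc k \<le> norm x" by simp
  have "0 < norm x" using x by (rule less_le_trans[rotated]) simp
  then have "1 / norm x \<le> 1 / (3 / 2 ^ Suc k)" using x by (intro divide_left_mono mult_pos_pos) auto
  then have "(1 / norm x)\<^sup>2 \<le> (2 ^ Suc k / 3)\<^sup>2" by (intro power_mono) auto
  then show "ennreal (if norm x \<le> 3 then (1 / norm x)\<^sup>2 else 0) \<le> ennreal ((2 ^ Suc k / 3)\<^sup>2)"
    by (intro ennreal_leI) auto
next
  show "AE x in lebesgue. (\<exists>k. x \<in> {x::real^3. 3 / 2 ^ Suc k \<le> norm x \<and> norm x \<le> 3 / 2 ^ k}) \<or>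
      ennreal (if norm x \<le> 3 then (1 / norm x)\<^sup>2 else 0) = 0"
    using AE_lebesgue_neq[of 0]
  proof eventually_elim
    case (elim x)
    show ?case
    proof (cases "norm x \<le> 3")
      case True
      then obtain k :: nat where "3 / 2 ^ Suc k < norm x" "norm x \<le> 3 / 2 ^ k"
        using dyadic_scale[of "norm x" 3] elim by auto
      then show ?thesis by (intro disjI1 exI[of _ k]) auto
    qed simp
  qed
next
  have "(2 ^ Suc k / 3)\<^sup>2 * (8 * (3 / 2 ^ k) * (3 / 2 ^ k)\<^sup>2) = 96 * (1/2 :: real) ^ k" for k :: nat
    by (simp add: power2_eq_square power_divide)
  moreover have "summable (\<lambda>k. 96 * (1/2) ^ k :: real)" by (intro summable_mult summable_geometric) auto
  ultimately show "summable (\<lambda>k::nat. (2 ^ Suc k / 3)\<^sup>2 * (8 * (3 / 2 ^ k) * (3 / 2 ^ k)\<^sup>2 :: real))" by simp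
qed auto

text \<open>The part of the paraboloid with x_1 about 2^-k has lateral radius of order 2^(-k/2),
  hence volume of order 4^-k, which cancels the square of 1/x_1. The series of (k+1)^(2\<beta>-2) is
  left, and it converges since \<beta> < 1/2.\<close>

lemma singular_part_square_integrable:
  assumes "\<beta> < 1/2"
  shows "(\<integral>\<^sup>+x. ennreal (if norm x \<le> 3 then (singular_part \<beta> x)\<^sup>2 else 0) \<partial>lebesgue) < \<infinity>"
proof -
  define c where "c = ln (4/3 :: real)"
  have c: "c > 0" by (simp add: c_def)
  define A where "A k = {x::real^3. 3 / 2 ^ Suc k \<le> x $ 1 \<and> x $ 1 \<le> 3 / 2 ^ k \<and> x \<bullet> x \<le> 4 * x $ 1}" for k :: nat
  define a where "a k = ((c * real (Suc k)) powr (\<beta> - 1) * (2 ^ Suc k / 3))\<^sup>2" for k :: nat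
  define b where "b k = 8 * (3 / 2 ^ k) * (sqrt (12 / 2 ^ k))\<^sup>2" for k :: nat
  show ?thesis
  proof (rule nn_integral_finite_cover[where A = A and a = a and b = b])
    fix k :: nat
    have "closed (A k)" unfolding A_def
      by (intro closed_Collect_conj closed_Collect_le continuous_intros)
    then show "A k \<in> sets lebesgue" by auto
    have "A k \<subseteq> box3 (3 / 2 ^ k) (sqrt (12 / 2 ^ k))"
    proof
      fix x assume x: "x \<in> A k"
      then have q: "x \<bullet> x \<le> 12 / 2 ^ k" by (auto simp: A_def)
      have "(x $ 2)\<^sup>2 \<le> 12 / 2 ^ k" "(x $ 3)\<^sup>2 \<le> 12 / 2 ^ k"
        using q unfolding inner_self_eq3 by (smt (verit) zero_le_power2)+
      then have "\<bar>x $ 2\<bar> \<le> sqrt (12 / 2 ^ k)" "\<bar>x $ 3\<bar> \<le> sqrt (12 / 2 ^ k)"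
        by (simp_all add: real_le_rsqrt)
      moreover have "0 \<le> 3 / (2::real) ^ Suc k" by simp
      ultimately show "x \<in> box3 (3 / 2 ^ k) (sqrt (12 / 2 ^ k))"
        using x by (auto simp: A_def abs_le_iff)
    qed
    then show "emeasure lebesgue (A k) \<le> ennreal (b k)"
      unfolding b_def by (rule emeasure_subset_box3) auto
  next
    fix k :: nat and x :: "real^3" assume "x \<in> A k"
    then have x: "3 / 2 ^ Suc k \<le> x $ 1" "x $ 1 \<le> 3 / 2 ^ k" "x \<bullet> x \<le> 4 * x $ 1" by (auto simp: A_def)
    have x1: "0 < x $ 1" using x(1) by (rule less_le_trans[rotated]) simp
    \<comment> \<open>4/x_1 is at least (4/3) 2^k, and ln (4/3) \<le> ln 2. Starting the dyadic
      scale at 3 rather than 4 makes the logarithm at least \<open>c\<close> already for k = 0,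
      which matches \<open>Suc k\<close>.\<close>
    have "c * real (Suc k) \<le> ln (4 / x $ 1)"
    proof -
      have "c \<le> ln 2" unfolding c_def by simp
      then have "c * real (Suc k) \<le> c + real k * ln 2" 
        using mult_left_mono[of c "ln 2" "real k"] by (simp add: algebra_simps)
      also have "\<dots> = ln (4 / (3 / 2 ^ k))" by (simp add: c_def ln_div ln_mult ln_realpow)
      also have "\<dots> \<le> ln (4 / x $ 1)"
        using x x1 by (intro ln_mono divide_left_mono) auto
      finally show ?thesis .
    qed
    then have "ln (4 / x $ 1) powr (\<beta> - 1) \<le> (c * real (Suc k)) powr (\<beta> - 1)"
      using c assms by (intro powr_mono2') auto
    then have "ln (4 / x $ 1) powr (\<beta> - 1) / x $ 1 \<le> (c * real (Suc k)) powr (\<beta> - 1) / (3 / 2 ^ Suc k)"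
      using x by (intro frac_le) auto
    then have "singular_part \<beta> x \<le> (c * real (Suc k)) powr (\<beta> - 1) * (2 ^ Suc k / 3)"
      using x by (simp add: singular_part_def)
    then have "(singular_part \<beta> x)\<^sup>2 \<le> a k"
      unfolding a_def using singular_part_nonneg by (intro power_mono) auto
    then show "ennreal (if norm x \<le> 3 then (singular_part \<beta> x)\<^sup>2 else 0) \<le> ennreal (a k)"
      by (intro ennreal_leI) (auto simp: a_def)
  next
    show "AE x in lebesgue. (\<exists>k. x \<in> A k) \<or>
        ennreal (if norm x \<le> 3 then (singular_part \<beta> x)\<^sup>2 else 0) = 0"
      using AE_lebesgue_neq[of 0]
    proof eventually_elim
      case (elim x)
      show ?case
      proof (cases "norm x \<le> 3 \<and> x \<bullet> x \<le> 4 * x $ 1")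
        case True
        have "x \<bullet> x > 0" using elim by simp
        then have "0 < x $ 1" using True by linarith
        moreover have "x $ 1 \<le> 3" using True component_le_norm_cart[of x 1] by linarith
        ultimately obtain k :: nat where "3 / 2 ^ Suc k < x $ 1" "x $ 1 \<le> 3 / 2 ^ k"
          using dyadic_scale[of "x $ 1" 3] by auto
        then show ?thesis using True by (intro disjI1 exI[of _ k]) (auto simp: A_def)
      qed (auto simp: singular_part_def)
    qed
  next
    have "a k * b k = 128 * c powr (2 * \<beta> - 2) * real (Suc k) powr (2 * \<beta> - 2)" for k
    proof -
      have "((c * real (Suc k)) powr (\<beta> - 1))\<^sup>2 = (c * real (Suc k)) powr (2 * \<beta> - 2)"
        unfolding power2_eq_square powr_add[symmetric] by simp
      also have "\<dots> = c powr (2 * \<beta> - 2) * real (Suc k) powr (2 * \<beta> - 2)"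
        using c by (simp add: powr_mult)
      finally show ?thesis
        unfolding a_def b_def power_mult_distrib by (simp add: power2_eq_square)
    qed
    moreover have "summable (\<lambda>k. real (Suc k) powr (2 * \<beta> - 2))"
      using assms summable_real_powr_iff[of "2 * \<beta> - 2"] by (subst summable_Suc_iff) auto
    ultimately show "summable (\<lambda>k. a k * b k)" by (simp add: summable_mult)
  qed (auto simp: a_def b_def)
qed

lemma square_integrable_extension:
  assumes "\<beta> < 1/2" "f \<in> borel_measurable lebesgue"
    and "\<And>x. 3 < norm x \<Longrightarrow> f x = 0"
    and "\<And>x. x \<noteq> 0 \<Longrightarrow> norm x \<le> 3 \<Longrightarrow> \<bar>f x\<bar> \<le> C * (1 / norm x + singular_part \<beta> x)"
  shows "(\<integral>\<^sup>+x. ennreal ((f x)\<^sup>2) \<partial>lebesgue) < \<infinity>"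
proof -
  let ?u = "\<lambda>x::real^3. ennreal (if norm x \<le> 3 then (1 / norm x)\<^sup>2 else 0)"
  let ?v = "\<lambda>x. ennreal (if norm x \<le> 3 then (singular_part \<beta> x)\<^sup>2 else 0)"
  have m1: "?u \<in> borel_measurable lebesgue"
  proof -
    have "?u \<in> borel_measurable borel" by measurable
    then show ?thesis by (simp add: measurable_completion)
  qed
  have m2: "?v \<in> borel_measurable lebesgue"
  proof -
    have S: "{x::real^3. x \<bullet> x \<le> 4 * x $ 1} \<in> sets borel"
      by (intro borel_closed closed_Collect_le continuous_intros)
    have nth [measurable]: "(\<lambda>x::real^3. x $ 1) \<in> borel_measurable borel"
      by (intro borel_measurable_continuous_onI continuous_intros)
    have "singular_part \<beta> \<in> borel_measurable borel"
      unfolding singular_part_def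
    proof (rule measurable_If)
      show "(\<lambda>x::real^3. ln (4 / x $ 1) powr (\<beta> - 1) / x $ 1) \<in> borel_measurable borel" by measurable
      show "{x \<in> space borel. x \<bullet> x \<le> 4 * x $ 1} \<in> sets (borel :: (real^3) measure)" using S by simp
    qed simp
    then have "?v \<in> borel_measurable borel" by measurable
    then show ?thesis by (simp add: measurable_completion)
  qed
  have sq: "(a + b)\<^sup>2 \<le> 2 * (a\<^sup>2 + b\<^sup>2)" for a b :: real
    using sum_squares_bound[of a b] by (simp add: power2_sum)
  have "(\<integral>\<^sup>+x. ennreal ((f x)\<^sup>2) \<partial>lebesgue) \<le> (\<integral>\<^sup>+x. ennreal (2 * C\<^sup>2) * (?u x + ?v x) \<partial>lebesgue)"
  proof (rule nn_integral_mono_AE)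
    show "AE x in lebesgue. ennreal ((f x)\<^sup>2) \<le> ennreal (2 * C\<^sup>2) * (?u x + ?v x)"
      using AE_lebesgue_neq[of 0]
    proof eventually_elim
      case (elim x)
      show ?case
      proof (cases "norm x \<le> 3")
        case True
        let ?n = "1 / norm x" and ?s = "singular_part \<beta> x"
        have "(f x)\<^sup>2 \<le> (C * (?n + ?s))\<^sup>2"
          using power_mono[OF assms(4)[OF elim True], of 2] by simp
        also have "\<dots> = C\<^sup>2 * (?n + ?s)\<^sup>2" by (simp add: power_mult_distrib)
        also have "\<dots> \<le> C\<^sup>2 * (2 * (?n\<^sup>2 + ?s\<^sup>2))"
          by (rule mult_left_mono[OF sq]) simp
        also have "\<dots> = 2 * C\<^sup>2 * (?n\<^sup>2 + ?s\<^sup>2)" by simp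
        finally have "ennreal ((f x)\<^sup>2) \<le> ennreal (2 * C\<^sup>2 * (?n\<^sup>2 + ?s\<^sup>2))" by (rule ennreal_leI)
        also have "\<dots> = ennreal (2 * C\<^sup>2) * (?u x + ?v x)"
          using True by (subst ennreal_mult') (auto simp: ennreal_plus simp del: power_divide)
        finally show ?thesis .
      qed (simp add: assms(3))
    qed
  qed
  also have "\<dots> = ennreal (2 * C\<^sup>2) * ((\<integral>\<^sup>+x. ?u x \<partial>lebesgue) + (\<integral>\<^sup>+x. ?v x \<partial>lebesgue))"
    using m1 m2 by (simp add: nn_integral_cmult nn_integral_add)
  also have "\<dots> < \<infinity>"
    using inverse_norm_square_integrable singular_part_square_integrable[OF assms(1)]
    by (simp add: ennreal_mult_less_top)
  finally show ?thesis .
qed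

text \<open>A point has codimension 3: on the region cut out, the function is at most of order n,
  the gradient of the cut-off of order n and the volume of order n^-3, so the error is of order 1/n.
  It is applied to the extension and again to its first derivatives.\<close>

lemma has_weak_deriv_off_origin:
  assumes f: "smooth_on (- {0}) f" "\<And>x. 3 < norm x \<Longrightarrow> f x = 0" "C \<ge> 0"
      "\<And>x. x \<noteq> 0 \<Longrightarrow> norm x \<le> 3 \<Longrightarrow> \<bar>f x\<bar> \<le> C / norm x"
    and int: "locally_integrable_on f UNIV" "locally_integrable_on (partial_deriv i f) UNIV"
  shows "has_weak_deriv UNIV [i] f (partial_deriv i (f :: real^3 \<Rightarrow> real))"
proof (rule has_weak_deriv_off_zeros[where q = "\<lambda>x. x \<bullet> x"])
  have o: "open (- {0::real^3})" by auto
  show "smooth_on UNIV (\<lambda>x::real^3. x \<bullet> x)" by (rule smooth_on_inner_self) simp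
  show "\<bar>partial_deriv i (\<lambda>x. x \<bullet> x) x\<bar> \<le> 2 * sqrt (x \<bullet> x)" for x :: "real^3"
    using component_le_norm_cart[of x i] by (simp add: partial_deriv_inner_self norm_eq_sqrt_inner[symmetric] abs_mult)
  show "f differentiable (at x)" if "0 < x \<bullet> x" for x
    using smooth_on_imp_differentiable[OF f(1) o] that by auto
  have "continuous_on (- {0}) (partial_deriv i f)"
    by (rule smooth_on_imp_continuous_on[OF smooth_on_partial_deriv[OF f(1)]])
  moreover have "{x::real^3. 0 < x \<bullet> x} = - {0}" by auto
  ultimately show "continuous_on {x. 0 < x \<bullet> x} (partial_deriv i f)" by simp
  show "negligible {x::real^3. x \<bullet> x = 0}" by simp
  show "\<exists>s. (\<forall>n::nat. \<forall>x. norm x \<le> r \<longrightarrow> 1 \<le> (real n)\<^sup>2 * (x \<bullet> x) \<longrightarrow>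
          (real n)\<^sup>2 * (x \<bullet> x) \<le> 2 \<longrightarrow> \<bar>f x\<bar> \<le> s n) \<and>
        (\<lambda>n. real n * s n * measure lebesgue {x::real^3. norm x \<le> r \<and> (real n)\<^sup>2 * (x \<bullet> x) \<le> 2}) \<longlonglongrightarrow> 0"
    for r
  proof (intro exI[of _ "\<lambda>n. C * real n"] conjI allI impI)
    fix n :: nat and x :: "real^3"
    assume "1 \<le> (real n)\<^sup>2 * (x \<bullet> x)"
    then have "1 \<le> (real n * norm x)\<^sup>2" by (simp add: power_mult_distrib power2_norm_eq_inner)
    then have n: "1 \<le> real n * norm x"
      using abs_le_square_iff[of 1 "real n * norm x"] by simp
    then have x: "x \<noteq> 0" by auto
    show "\<bar>f x\<bar> \<le> C * real n"
    proof (cases "norm x \<le> 3")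
      case True
      have "C * 1 \<le> C * (real n * norm x)" using n f(3) by (intro mult_left_mono) auto
      then have "C / norm x \<le> C * real n" using x by (simp add: field_simps)
      then show ?thesis using f(4)[OF x True] by linarith
    qed (use f in simp)
  next
    let ?S = "\<lambda>n::nat. {x::real^3. norm x \<le> r \<and> (real n)\<^sup>2 * (x \<bullet> x) \<le> 2}"
    have S: "measure lebesgue (?S n) \<le> 8 * (2 / real n) * (2 / real n)\<^sup>2" if n: "n > 0" for n
    proof -
      have "?S n \<subseteq> box3 (2 / real n) (2 / real n)"
      proof
        fix x assume "x \<in> ?S n"
        then have "(real n * norm x)\<^sup>2 \<le> 2\<^sup>2" by (simp add: power_mult_distrib power2_norm_eq_inner)
        then have "real n * norm x \<le> 2" by (rule power2_le_imp_le) simp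
        then have "norm x \<le> 2 / real n" using n by (simp add: field_simps)
        then show "x \<in> box3 (2 / real n) (2 / real n)" by (rule norm_le_imp_box3)
      qed
      then have "emeasure lebesgue (?S n) \<le> ennreal (8 * (2 / real n) * (2 / real n)\<^sup>2)"
        by (rule emeasure_subset_box3) auto
      then show ?thesis unfolding measure_def by (intro enn2real_leI) auto
    qed
    show "(\<lambda>n. real n * (C * real n) * measure lebesgue (?S n)) \<longlonglongrightarrow> 0"
    proof (rule Lim_null_comparison[OF always_eventually])
      have "(\<lambda>n. 64 * C / real n) \<longlonglongrightarrow> 0" by (rule lim_const_over_n)
      then show "(\<lambda>n. 64 * C * (1 / real n)) \<longlonglongrightarrow> 0" by simp
      show "\<forall>n. norm (real n * (C * real n) * measure lebesgue (?S n)) \<le> 64 * C * (1 / real n)"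
      proof
        fix n :: nat
        show "norm (real n * (C * real n) * measure lebesgue (?S n)) \<le> 64 * C * (1 / real n)"
        proof (cases "n = 0")
          case False
          have "real n * (C * real n) * measure lebesgue (?S n) \<le> real n * (C * real n) * (8 * (2 / real n) * (2 / real n)\<^sup>2)"
            using S[of n] False f(3) by (intro mult_left_mono) auto
          also have "\<dots> = 64 * C * (1 / real n)" using False by (simp add: power2_eq_square)
          finally show ?thesis using f(3) by (simp add: abs_mult)
        qed simp
      qed
    qed
  qed
qed (use int in auto)

section \<open>Cut-offs\<close>

lemma smooth_compact_support_jet_bound:
  fixes f :: "real^'n::finite \<Rightarrow> real"
  assumes "smooth_on UNIV f" "\<And>x. r < norm x \<Longrightarrow> f x = 0"
  obtains K where "\<And>x. jet_bound f x 1 K"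
proof -
  note c = smooth_on_imp_continuous_on
  have s1: "smooth_on UNIV (partial_deriv i f)" for i by (rule smooth_on_partial_deriv[OF assms(1)])
  have z1: "partial_deriv i f x = 0" if "r < norm x" for i x
    by (rule partial_deriv_eq_0_outside[OF assms(2) that])
  have z2: "partial_deriv i (partial_deriv j f) x = 0" if "r < norm x" for i j x
    by (rule partial_deriv_eq_0_outside[OF z1 that])
  obtain K0 where K0: "K0 \<ge> 0" "\<And>x. \<bar>f x\<bar> \<le> K0"
    using continuous_compact_support_bounded[OF c[OF assms(1)], of r] assms(2) by auto
  have "\<forall>i. \<exists>K\<ge>0. \<forall>x. \<bar>partial_deriv i f x\<bar> \<le> K"
    using continuous_compact_support_bounded[OF c[OF s1], of r] z1 by auto
  then obtain K1 where K1: "\<And>i. K1 i \<ge> 0" "\<And>i x. \<bar>partial_deriv i f x\<bar> \<le> K1 i" by metis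
  have "\<forall>p. \<exists>K\<ge>0. \<forall>x. \<bar>partial_deriv (fst p) (partial_deriv (snd p) f) x\<bar> \<le> K"
    using continuous_compact_support_bounded[OF c[OF smooth_on_partial_deriv[OF s1]], of r] z2 by auto
  then obtain K2 where K2: "\<And>p. K2 p \<ge> 0"
    "\<And>p x. \<bar>partial_deriv (fst p) (partial_deriv (snd p) f) x\<bar> \<le> K2 p" by metis
  have "jet_bound f x 1 (K0 + sum K1 UNIV + sum K2 UNIV)" for x
    unfolding jet_bound_def
  proof (intro conjI allI)
    have s: "0 \<le> sum K1 UNIV" "0 \<le> sum K2 UNIV" using K1 K2 by (auto intro: sum_nonneg)
    show "\<bar>f x\<bar> \<le> K0 + sum K1 UNIV + sum K2 UNIV" using K0(2)[of x] s by linarith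
    fix i
    have "K1 i \<le> sum K1 UNIV" using K1 by (intro member_le_sum) auto
    then show "\<bar>partial_deriv i f x\<bar> * 1 \<le> K0 + sum K1 UNIV + sum K2 UNIV"
      using K1(2)[of i x] s K0(1) by linarith
    fix j
    have "K2 (i, j) \<le> sum K2 UNIV" using K2 by (intro member_le_sum) auto
    then show "\<bar>partial_deriv i (partial_deriv j f) x\<bar> * 1\<^sup>2 \<le> K0 + sum K1 UNIV + sum K2 UNIV"
      using K2(2)[of "(i, j)" x] s K0(1) by simp
  qed
  then show ?thesis using that by blast
qed

definition cutoff :: "real \<Rightarrow> real \<Rightarrow> real^'n::finite \<Rightarrow> real" where
  "cutoff r R x = 1 - step ((x \<bullet> x - r\<^sup>2) / (R\<^sup>2 - r\<^sup>2))"

lemma smooth_on_cutoff: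
  assumes "0 \<le> r" "r < R"
  shows "smooth_on UNIV (cutoff r R)"
proof -
  have "R\<^sup>2 - r\<^sup>2 \<noteq> 0" using power_strict_mono[of r R 2] assms by simp
  then show ?thesis
    unfolding cutoff_def
    by (intro smooth_on_diff smooth_on_const smooth_on_step smooth_on_divide smooth_on_inner_self) auto
qed

lemma cutoff_eq_1:
  assumes "0 \<le> r" "r < R" "norm x \<le> r"
  shows "cutoff r R x = 1"
proof -
  have "(norm x)\<^sup>2 \<le> r\<^sup>2" "r\<^sup>2 < R\<^sup>2" using assms by (auto intro: power_mono power_strict_mono)
  then have "(x \<bullet> x - r\<^sup>2) / (R\<^sup>2 - r\<^sup>2) \<le> 0"
    by (intro divide_nonpos_pos) (auto simp: power2_norm_eq_inner)
  then show ?thesis by (simp add: cutoff_def step_le_0)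
qed

lemma cutoff_eq_0:
  assumes "0 \<le> r" "r < R" "R \<le> norm x"
  shows "cutoff r R x = 0"
proof -
  have "R\<^sup>2 \<le> (norm x)\<^sup>2" "r\<^sup>2 < R\<^sup>2" using assms by (auto intro: power_mono power_strict_mono)
  then have "1 \<le> (x \<bullet> x - r\<^sup>2) / (R\<^sup>2 - r\<^sup>2)"
    by (simp add: power2_norm_eq_inner)
  then show ?thesis by (simp add: cutoff_def step_ge_1)
qed

section \<open>The extension in \<open>H\<^sup>2\<close>\<close>

text \<open>Where \<open>height x = x $ 1\<close> the product collapses to
  \<open>logW \<beta> (x $ 1)\<close>. The outer radius is later kept at most 3, so that the support
  stays where the bounds for \<open>height\<close> hold.\<close>

definition ext1 :: "real \<Rightarrow> real \<Rightarrow> real^3 \<Rightarrow> real" where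
  "ext1 \<beta> R x = cutoff 2 R x * (x $ 1 * logM \<beta> (height x))"

lemma B_eq: "B t = {x. x \<bullet> x < 2 * x $ 1 - 2 * t + t\<^sup>2}"
  unfolding B_def inner_self_eq3 by (auto simp: power2_eq_square algebra_simps)

lemma ext1_eq_logW:
  assumes "x \<in> B 0" "2 < R"
  shows "ext1 \<beta> R x = logW \<beta> (x $ 1)"
proof -
  have x: "x \<bullet> x < 2 * x $ 1" using assms(1) by (simp add: B_eq)
  have pos: "0 < x $ 1" using x inner_ge_zero[of x] by linarith
  then have ne: "x \<noteq> 0" by auto
  have "norm x * norm x < 2 * norm x"
    using x component_le_norm_cart[of x 1] by (simp add: power2_norm_eq_inner[symmetric] power2_eq_square)
  then have "norm x < 2" using ne by simp
  then have "cutoff 2 R x = 1" using assms(2) by (intro cutoff_eq_1) auto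
  moreover have "height x = x $ 1" using x ne by (intro height_inner) (auto simp: gap_def)
  ultimately show ?thesis using pos by (simp add: ext1_def logM_def)
qed

lemma ext1_eq_0: "2 < R \<Longrightarrow> R \<le> norm x \<Longrightarrow> ext1 \<beta> R x = 0"
  by (simp add: ext1_def cutoff_eq_0)

lemma smooth_on_ext1:
  assumes "0 < \<beta>" "2 < R" "R \<le> 3"
  shows "smooth_on (- {0}) (ext1 \<beta> R)"
proof -
  let ?U = "{x::real^3. x \<noteq> 0 \<and> norm x < 4}" and ?V = "{x::real^3. R < norm x}"
  have o: "open ?U" "open ?V"
    by (auto intro!: open_Collect_conj open_Collect_neq open_Collect_less continuous_intros)
  have "smooth_on ?U (ext1 \<beta> R)"
    unfolding ext1_def[abs_def] using assms
    by (intro smooth_on_mult smooth_on_logM_height smooth_on_nth o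
        smooth_on_subset[OF smooth_on_cutoff]) auto
  moreover have "smooth_on ?V (ext1 \<beta> R)"
    by (rule smooth_on_cong[OF o(2) _ smooth_on_const[OF o(2), of 0]])
       (use assms in \<open>auto intro: ext1_eq_0\<close>)
  ultimately have "smooth_on (?U \<union> ?V) (ext1 \<beta> R)" using smooth_on_Un o by blast
  then show ?thesis by (rule smooth_on_subset) (use assms in auto)
qed

text \<open>In the first derivative the factor x_1 absorbs the derivative that falls on the mean. In
  the second one only one of two is absorbed, and \<open>singular_part\<close> survives.\<close>

lemma ext1_bounds:
  assumes "0 < \<beta>" "\<beta> < 1" "2 < R" "R \<le> 3"
  obtains C where "C \<ge> 0" "\<And>x. x \<noteq> 0 \<Longrightarrow> norm x \<le> 3 \<Longrightarrow> \<bar>ext1 \<beta> R x\<bar> \<le> C / norm x"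
    "\<And>x i. x \<noteq> 0 \<Longrightarrow> norm x \<le> 3 \<Longrightarrow> \<bar>partial_deriv i (ext1 \<beta> R) x\<bar> \<le> C / norm x"
    "\<And>x i j. x \<noteq> 0 \<Longrightarrow> norm x \<le> 3 \<Longrightarrow>
      \<bar>partial_deriv i (partial_deriv j (ext1 \<beta> R)) x\<bar> \<le> C * (1 / norm x + singular_part \<beta> x)"
proof -
  let ?N = "\<lambda>x. logM \<beta> (height x)" and ?\<rho> = "cutoff 2 R :: real^3 \<Rightarrow> real"
  have s\<rho>: "smooth_on UNIV ?\<rho>" using assms by (intro smooth_on_cutoff) auto
  have "?\<rho> x = 0" if "R < norm x" for x using that assms by (intro cutoff_eq_0) auto
  then obtain K where K: "\<And>x. jet_bound ?\<rho> x 1 K"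
    using smooth_compact_support_jet_bound[OF s\<rho>] by blast
  have K0: "K \<ge> 0" using K[of 0] unfolding jet_bound_def by linarith
  obtain D where D: "D \<ge> 0" and N: "\<And>x. x \<noteq> 0 \<Longrightarrow> norm x \<le> 3 \<Longrightarrow>
    \<bar>?N x\<bar> \<le> D / norm x \<and>
    (\<forall>i. \<bar>x $ 1 * partial_deriv i ?N x\<bar> \<le> D / norm x) \<and>
    (\<forall>i. \<bar>partial_deriv i ?N x\<bar> \<le> D * (1 / norm x + singular_part \<beta> x)) \<and>
    (\<forall>i j. \<bar>x $ 1 * partial_deriv i (partial_deriv j ?N) x\<bar> \<le> D * (1 / norm x + singular_part \<beta> x))"
    using logM_height_bounds[OF assms(1,2)] by metis
  let ?U = "{x::real^3. x \<noteq> 0 \<and> norm x < 4}"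
  have o: "open ?U"
    by (auto intro!: open_Collect_conj open_Collect_neq open_Collect_less continuous_intros)
  have sN: "smooth_on ?U ?N" using assms(1) o by (intro smooth_on_logM_height) auto
  have s1: "smooth_on ?U (\<lambda>x. x $ 1)" using o by simp
  let ?P = "\<lambda>x. x $ 1 * ?N x"
  have sP: "smooth_on ?U ?P" by (rule smooth_on_mult[OF o s1 sN])
  have s\<rho>': "smooth_on ?U ?\<rho>" by (rule smooth_on_subset[OF s\<rho>]) simp
  note d = smooth_on_imp_differentiable[OF _ o]
  \<comment> \<open>10 = 3 + 2 + 2 + 3 collects the constants of \<open>p2\<close>,
    \<open>p1\<close> (twice) and \<open>p0\<close> in the second-order Leibniz formula.\<close>
  have main: "\<bar>ext1 \<beta> R x\<bar> \<le> (10 * K * D) / norm x \<and>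
      (\<forall>i. \<bar>partial_deriv i (ext1 \<beta> R) x\<bar> \<le> (10 * K * D) / norm x) \<and>
      (\<forall>i j. \<bar>partial_deriv i (partial_deriv j (ext1 \<beta> R)) x\<bar>
        \<le> (10 * K * D) * (1 / norm x + singular_part \<beta> x))"
    if x: "x \<noteq> 0" "norm x \<le> 3" for x
  proof -
    define a where "a = D / norm x"
    define b where "b = D * (1 / norm x + singular_part \<beta> x)"
    have xU: "x \<in> ?U" using x by simp
    have a0: "0 \<le> a" using D by (simp add: a_def)
    have "D * singular_part \<beta> x \<ge> 0" using D singular_part_nonneg by simp
    then have ab: "a \<le> b" by (simp add: a_def b_def algebra_simps)
    have n0: "\<bar>?N x\<bar> \<le> a" and n1: "\<bar>x $ 1 * partial_deriv i ?N x\<bar> \<le> a"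
      and n1': "\<bar>partial_deriv i ?N x\<bar> \<le> b"
      and n2: "\<bar>x $ 1 * partial_deriv i (partial_deriv j ?N) x\<bar> \<le> b" for i j
      using N[OF x] unfolding a_def b_def by auto
    have x13: "\<bar>x $ 1\<bar> \<le> 3" using component_le_norm_cart[of x 1] x by linarith
    have p0: "\<bar>?P x\<bar> \<le> 3 * a"
      unfolding abs_mult using x13 n0 by (intro mult_mono) auto
    have p1: "\<bar>partial_deriv i ?P x\<bar> \<le> 2 * a" for i
    proof -
      have "partial_deriv i ?P x = x $ 1 * partial_deriv i ?N x + (if i = 1 then 1 else 0) * ?N x"
        using partial_deriv_mult[OF d[OF s1 xU] d[OF sN xU], of i] by simp
      then show ?thesis using n0 n1[of i] a0 by (auto split: if_splits)
    qed
    have p2: "\<bar>partial_deriv i (partial_deriv j ?P) x\<bar> \<le> 3 * b" for i j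
    proof -
      have "partial_deriv i (partial_deriv j ?P) x = x $ 1 * partial_deriv i (partial_deriv j ?N) x
          + (if i = 1 then 1 else 0) * partial_deriv j ?N x + (if j = 1 then 1 else 0) * partial_deriv i ?N x"
        using partial_deriv2_mult[OF o xU s1 sN, of i j] by simp
      moreover have "0 \<le> b" using a0 ab by simp
      ultimately show ?thesis using n2[of i j] n1'[of i] n1'[of j] by (auto split: if_splits)
    qed
    have r0: "\<bar>?\<rho> x\<bar> \<le> K" and r1: "\<bar>partial_deriv i ?\<rho> x\<bar> \<le> K"
      and r2: "\<bar>partial_deriv i (partial_deriv j ?\<rho>) x\<bar> \<le> K" for i j
      using K[of x] unfolding jet_bound_def by auto
    have m: "\<bar>u * v\<bar> \<le> K * w" if "\<bar>u\<bar> \<le> K" "\<bar>v\<bar> \<le> w" for u v w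
      unfolding abs_mult using that K0 by (intro mult_mono) auto
    have Ka: "0 \<le> K * a" using K0 a0 by simp
    have Kab: "K * a \<le> K * b" using K0 ab by (intro mult_left_mono)
    have "\<bar>ext1 \<beta> R x\<bar> \<le> 10 * (K * a)"
      using m[OF r0 p0] Ka by (simp add: ext1_def)
    moreover have "\<bar>partial_deriv i (ext1 \<beta> R) x\<bar> \<le> 10 * (K * a)" for i
    proof -
      have "partial_deriv i (ext1 \<beta> R) x = ?\<rho> x * partial_deriv i ?P x + partial_deriv i ?\<rho> x * ?P x"
        unfolding ext1_def[abs_def] by (rule partial_deriv_mult[OF d[OF s\<rho>' xU] d[OF sP xU]])
      then show ?thesis using m[OF r0 p1[of i]] m[OF r1[of i] p0] Ka by linarith
    qed
    moreover have "\<bar>partial_deriv i (partial_deriv j (ext1 \<beta> R)) x\<bar> \<le> 10 * (K * b)" for i j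
    proof -
      have "partial_deriv i (partial_deriv j (ext1 \<beta> R)) x =
          ?\<rho> x * partial_deriv i (partial_deriv j ?P) x + partial_deriv i ?\<rho> x * partial_deriv j ?P x +
          partial_deriv j ?\<rho> x * partial_deriv i ?P x + partial_deriv i (partial_deriv j ?\<rho>) x * ?P x"
        unfolding ext1_def[abs_def] by (rule partial_deriv2_mult[OF o xU s\<rho>' sP])
      then show ?thesis
        using m[OF r0 p2[of i j]] m[OF r1[of i] p1[of j]] m[OF r1[of j] p1[of i]] m[OF r2[of i j] p0] Ka Kab
        by linarith
    qed
    ultimately show ?thesis unfolding a_def b_def by (simp add: mult.assoc)
  qed
  show ?thesis
    by (rule that[of "10 * K * D"]) (use main K0 D in auto)
qed

text \<open>The reversal reflects two orders of differentiation: moving derivatives off the test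
  function differentiates the extension along the head of \<open>I\<close> first, whereas
  \<open>iter_partial_deriv\<close> takes the last entry first.\<close>

lemma ext1_weak_derivs:
  assumes "0 < \<beta>" "\<beta> < 1/2" "2 < R" "R \<le> 3" "length I \<le> 2"
  shows "has_weak_deriv UNIV I (ext1 \<beta> R) (iter_partial_deriv (rev I) (ext1 \<beta> R))" (is ?weak)
    and "(\<integral>\<^sup>+x. ennreal ((iter_partial_deriv (rev I) (ext1 \<beta> R) x)\<^sup>2) \<partial>lebesgue) < \<infinity>" (is ?finite)
proof -
  let ?\<Psi> = "ext1 \<beta> R"
  have "\<beta> < 1" using assms by simp
  obtain C where C: "C \<ge> 0" "\<And>x. x \<noteq> 0 \<Longrightarrow> norm x \<le> 3 \<Longrightarrow> \<bar>?\<Psi> x\<bar> \<le> C / norm x"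
    "\<And>x i. x \<noteq> 0 \<Longrightarrow> norm x \<le> 3 \<Longrightarrow> \<bar>partial_deriv i ?\<Psi> x\<bar> \<le> C / norm x"
    "\<And>x i j. x \<noteq> 0 \<Longrightarrow> norm x \<le> 3 \<Longrightarrow>
      \<bar>partial_deriv i (partial_deriv j ?\<Psi>) x\<bar> \<le> C * (1 / norm x + singular_part \<beta> x)"
    using ext1_bounds[OF assms(1) \<open>\<beta> < 1\<close> assms(3,4)] by blast
  have s0: "smooth_on (- {0}) ?\<Psi>" using assms by (intro smooth_on_ext1) auto
  have z0: "?\<Psi> x = 0" if "3 < norm x" for x using that assms by (intro ext1_eq_0) auto
  have s1: "smooth_on (- {0}) (partial_deriv i ?\<Psi>)" for i by (rule smooth_on_partial_deriv[OF s0])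
  have z1: "partial_deriv i ?\<Psi> x = 0" if "3 < norm x" for i x
    by (rule partial_deriv_eq_0_outside[OF z0 that])
  have s2: "smooth_on (- {0}) (partial_deriv j (partial_deriv i ?\<Psi>))" for i j
    by (rule smooth_on_partial_deriv[OF s1])
  have z2: "partial_deriv j (partial_deriv i ?\<Psi>) x = 0" if "3 < norm x" for i j x
    by (rule partial_deriv_eq_0_outside[OF z1 that])
  have meas: "f \<in> borel_measurable lebesgue" if "smooth_on (- {0}) f" for f :: "real^3 \<Rightarrow> real"
    using borel_measurable_continuous_countable_exceptions[OF _ smooth_on_imp_continuous_on[OF that]]
    by (simp add: measurable_completion)
  have weaker: "C / norm x \<le> C * (1 / norm x + singular_part \<beta> x)" for x
    using mult_nonneg_nonneg[OF C(1) singular_part_nonneg[of \<beta> x]] by (simp add: algebra_simps)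
  have q0: "(\<integral>\<^sup>+x. ennreal ((?\<Psi> x)\<^sup>2) \<partial>lebesgue) < \<infinity>"
    by (rule square_integrable_extension[OF assms(2) meas[OF s0] z0]) (use C(2) weaker in \<open>auto intro: order_trans\<close>)
  have q1: "(\<integral>\<^sup>+x. ennreal ((partial_deriv i ?\<Psi> x)\<^sup>2) \<partial>lebesgue) < \<infinity>" for i
    by (rule square_integrable_extension[OF assms(2) meas[OF s1] z1]) (use C(3) weaker in \<open>auto intro: order_trans\<close>)
  have q2: "(\<integral>\<^sup>+x. ennreal ((partial_deriv j (partial_deriv i ?\<Psi>) x)\<^sup>2) \<partial>lebesgue) < \<infinity>" for i j
    by (rule square_integrable_extension[OF assms(2) meas[OF s2] z2 C(4)])
  note loc0 = locally_integrable_on_square_integrable[OF meas[OF s0] q0]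
  note loc1 = locally_integrable_on_square_integrable[OF meas[OF s1] q1]
  note loc2 = locally_integrable_on_square_integrable[OF meas[OF s2] q2]
  have w1: "has_weak_deriv UNIV [i] ?\<Psi> (partial_deriv i ?\<Psi>)" for i
    by (rule has_weak_deriv_off_origin[OF s0 z0 C(1,2) loc0 loc1])
  have w2: "has_weak_deriv UNIV [j] (partial_deriv i ?\<Psi>) (partial_deriv j (partial_deriv i ?\<Psi>))" for i j
    by (rule has_weak_deriv_off_origin[OF s1 z1 C(1,3) loc1 loc2])
  have "I = [] \<or> (\<exists>i. I = [i]) \<or> (\<exists>i j. I = [i, j])"
    using assms(5) by (cases I rule: remdups_adj.cases) (auto simp: Suc_le_eq)
  then show ?weak ?finite
    using has_weak_deriv_Nil[OF loc0] w1 has_weak_deriv_Cons[OF w1 w2] q0 q1 q2 by auto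
qed

text \<open>If \<open>f\<close> were smooth near 0, its first partial derivative would be continuous
  there. On the positive x_1-axis inside \<open>B 0\<close> that derivative is
  \<open>\<epsilon> * ln (4 / s) powr \<beta>\<close>, which is unbounded as s tends to 0.\<close>

lemma sing_supp_profile:
  fixes f :: "real^3 \<Rightarrow> real"
  assumes "0 < \<beta>" "0 < \<epsilon>" "smooth_on (- {0}) f" "\<And>x. x \<in> B 0 \<Longrightarrow> f x = \<epsilon> * logW \<beta> (x $ 1)"
  shows "sing_supp f = {0}"
proof -
  have "x \<notin> sing_supp f" if "x \<noteq> 0" for x
  proof -
    have "- {0} \<in> {U. open U \<and> smooth_on U f}" using assms(3) by auto
    then show ?thesis using that unfolding sing_supp_def by blast
  qed
  moreover have "0 \<in> sing_supp f"
  proof (rule ccontr)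
    assume "0 \<notin> sing_supp f"
    then obtain U where U: "open U" "smooth_on U f" "0 \<in> U" unfolding sing_supp_def by auto
    have "continuous_on U (partial_deriv 1 f)"
      by (rule smooth_on_imp_continuous_on[OF smooth_on_partial_deriv[OF U(2)]])
    then have "isCont (partial_deriv 1 f) 0" using U by (simp add: continuous_on_eq_continuous_at)
    then obtain d where d: "d > 0" "\<And>x. norm x < d \<Longrightarrow> \<bar>partial_deriv 1 f x - partial_deriv 1 f 0\<bar> < 1"
      unfolding continuous_at_eps_delta by (auto simp: dist_norm dest: spec[of _ 1])
    define b where "b = \<bar>partial_deriv 1 f 0\<bar> + 1"
    \<comment> \<open>Chosen so that \<epsilon> T^\<beta> = b, a value exceeding the derivative at 0
      by at least 1. Taking s \<le> 4 exp(-T) makes the logarithm at least T, and s \<le> 1 keeps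
      the point in \<open>B 0\<close>.\<close>
    define T where "T = (b / \<epsilon>) powr (1 / \<beta>)"
    define s where "s = min 1 (min (d / 2) (4 * exp (- T)))"
    have s: "0 < s" "s \<le> 1" "s < d" "s \<le> 4 * exp (- T)" using d(1) by (auto simp: s_def min_def)
    define x :: "real^3" where "x = s *\<^sub>R axis 1 1"
    have x: "x $ 1 = s" "norm x = s" "x \<bullet> x = s * s"
      using s by (simp_all add: x_def inner_axis_axis)
    have o: "open (B 0)" unfolding B_eq by (intro open_Collect_less continuous_intros)
    have xB: "x \<in> B 0" using s by (simp add: B_eq x)
    have "partial_deriv 1 f x = partial_deriv 1 (\<lambda>x. \<epsilon> * logW \<beta> (x $ 1)) x"
      by (rule partial_deriv_cong[OF o xB assms(4)])
    also have "\<dots> = (\<epsilon> * logw \<beta> (x $ 1)) * partial_deriv 1 (\<lambda>x. x $ 1) x"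
    proof (rule partial_deriv_compose)
      show "(\<lambda>x::real^3. x $ 1) differentiable (at x)"
        using has_derivative_vec_nth_real differentiable_def by blast
      show "((\<lambda>y. \<epsilon> * logW \<beta> y) has_real_derivative \<epsilon> * logw \<beta> (x $ 1)) (at (x $ 1))"
        using s x assms(1) by (intro DERIV_cmult has_real_derivative_logW) auto
    qed
    also have "\<dots> = \<epsilon> * ln (4 / s) powr \<beta>" using s by (simp add: x logw_eq)
    finally have eq: "partial_deriv 1 f x = \<epsilon> * ln (4 / s) powr \<beta>" .
    have "T \<le> ln (4 / s)"
    proof -
      have "exp T \<le> 4 / s" using s by (simp add: exp_minus field_simps)
      then show ?thesis using s by (simp add: ln_ge_iff)
    qed
    then have "T powr \<beta> \<le> ln (4 / s) powr \<beta>"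
      using assms(1) by (intro powr_mono2) (auto simp: T_def)
    moreover have "T powr \<beta> = b / \<epsilon>"
      using assms(1,2) by (simp add: T_def powr_powr b_def)
    ultimately have "b \<le> partial_deriv 1 f x" using assms(2) eq by (simp add: field_simps)
    then show False using d(2)[of x] s x unfolding b_def by linarith
  qed
  ultimately show ?thesis by blast
qed

section \<open>Sobolev norms\<close>

lemma hom_sobolev_norm_le:
  assumes "\<And>I. length I = k \<Longrightarrow> has_weak_deriv \<Omega> I f (G I)"
  shows "hom_sobolev_norm k \<Omega> f \<le>
    ennreal_sqrt (\<Sum>I | length I = k. \<integral>\<^sup>+x\<in>\<Omega>. ennreal ((G I x)\<^sup>2) \<partial>lebesgue)"
  unfolding hom_sobolev_norm_def by (rule INF_lower) (use assms in auto)

lemma finite_lists_length: "finite {I :: 'a::finite list. length I = k}"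
  using finite_lists_length_eq[of "UNIV :: 'a set" k] by simp

lemma locally_integrable_on_imp_borel_measurable:
  fixes f :: "real^'n::finite \<Rightarrow> real"
  assumes "locally_integrable_on f UNIV"
  shows "f \<in> borel_measurable lebesgue"
proof (rule borel_measurable_LIMSEQ_real[where u = "\<lambda>n x. indicator (cball 0 (real n)) x *\<^sub>R f x"])
  show "(\<lambda>x. indicator (cball 0 (real n)) x *\<^sub>R f x) \<in> borel_measurable lebesgue" for n
    using assms unfolding locally_integrable_on_def set_integrable_def
    by (intro borel_measurable_integrable) auto
  fix x :: "real^'n"
  obtain N where "norm x \<le> real N" using real_arch_simple by blast
  then have "eventually (\<lambda>n. indicator (cball 0 (real n)) x *\<^sub>R f x = f x) sequentially"
    by (intro eventually_sequentiallyI[of N]) (auto simp: indicator_def)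
  then show "(\<lambda>n. indicator (cball 0 (real n)) x *\<^sub>R f x) \<longlonglongrightarrow> f x" by (rule tendsto_eventually)
qed

text \<open>The family is linear in \<epsilon>, so one function supplies the constant for all
  \<epsilon>; the summand 1 makes the constant positive.\<close>

lemma hom_sobolev_norm_scaled:
  fixes f :: "real^'n::finite \<Rightarrow> real"
  assumes "\<And>I. length I = k \<Longrightarrow> has_weak_deriv UNIV I f (G I)"
    and "\<And>I. length I = k \<Longrightarrow> (\<integral>\<^sup>+x. ennreal ((G I x)\<^sup>2) \<partial>lebesgue) < \<infinity>"
  obtains C where "C > 0" "\<And>\<epsilon>. 0 < \<epsilon> \<Longrightarrow> hom_sobolev_norm k UNIV (\<lambda>x. \<epsilon> * f x) \<le> ennreal (C * \<epsilon>)"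
proof -
  define S where "S = (\<Sum>I | length I = k. \<integral>\<^sup>+x. ennreal ((G I x)\<^sup>2) \<partial>lebesgue)"
  have S: "S < \<infinity>" unfolding S_def using assms(2) by (simp add: finite_lists_length)
  show ?thesis
  proof (rule that[of "sqrt (enn2real S) + 1"])
    show "0 < sqrt (enn2real S) + 1" by (simp add: add_nonneg_pos)
    fix \<epsilon> :: real assume \<epsilon>: "0 < \<epsilon>"
    have "(\<integral>\<^sup>+x. ennreal ((\<epsilon> * G I x)\<^sup>2) \<partial>lebesgue) = ennreal (\<epsilon>\<^sup>2) * (\<integral>\<^sup>+x. ennreal ((G I x)\<^sup>2) \<partial>lebesgue)"
      if I: "length I = k" for I
    proof -
      have "G I \<in> borel_measurable lebesgue"
        using assms(1)[OF I] by (auto simp: has_weak_deriv_def intro: locally_integrable_on_imp_borel_measurable)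
      then show ?thesis
        by (subst nn_integral_cmult[symmetric]) (auto simp: power_mult_distrib ennreal_mult')
    qed
    then have "(\<Sum>I | length I = k. \<integral>\<^sup>+x\<in>UNIV. ennreal ((\<epsilon> * G I x)\<^sup>2) \<partial>lebesgue) = ennreal (\<epsilon>\<^sup>2) * S"
      by (simp add: S_def sum_distrib_left)
    then have "hom_sobolev_norm k UNIV (\<lambda>x. \<epsilon> * f x) \<le> ennreal_sqrt (ennreal (\<epsilon>\<^sup>2) * S)"
      using hom_sobolev_norm_le[of k UNIV "\<lambda>x. \<epsilon> * f x" "\<lambda>I x. \<epsilon> * G I x"]
        has_weak_deriv_cmult[OF assms(1)] by simp
    also have "\<dots> = ennreal (sqrt (enn2real S) * \<epsilon>)"
      using S \<epsilon> by (auto simp: ennreal_sqrt_def ennreal_mult_eq_top_iff enn2real_mult real_sqrt_mult)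
    also have "\<dots> \<le> ennreal ((sqrt (enn2real S) + 1) * \<epsilon>)"
      using \<epsilon> by (intro ennreal_leI) (simp add: algebra_simps)
    finally show "hom_sobolev_norm k UNIV (\<lambda>x. \<epsilon> * f x) \<le> ennreal ((sqrt (enn2real S) + 1) * \<epsilon>)" .
  qed
qed

lemma chi1_extension:
  assumes "0 < \<alpha>" "\<alpha> < 1/2" "2 < R"
  shows "\<exists>C>0. \<forall>\<epsilon>>0. \<exists>\<Psi>1 :: real^3 \<Rightarrow> real.
          \<Psi>1 \<in> sobolev_space 2 UNIV \<and>
          (\<forall>x\<in>B 0. \<Psi>1 x = chi1 \<alpha> \<epsilon> (x $ 1)) \<and>
          hom_sobolev_norm 2 UNIV \<Psi>1 \<le> ennreal (C * \<epsilon>) \<and>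
          supp \<Psi>1 \<subseteq> {x. norm x \<le> R} \<and>
          sing_supp \<Psi>1 = {0}"
proof -
  \<comment> \<open>A smaller support is also admissible, so the radius is capped at 3, where the
    derivative bounds are available.\<close>
  define r where "r = min R 3"
  have r: "2 < r" "r \<le> 3" "r \<le> R" using assms by (auto simp: r_def)
  note w = ext1_weak_derivs[OF assms(1,2) r(1,2)]
  have bd: "\<exists>C>0. \<forall>\<epsilon>>0. hom_sobolev_norm k UNIV (\<lambda>x. \<epsilon> * ext1 \<alpha> r x) \<le> ennreal (C * \<epsilon>)" if k: "k \<le> 2" for k
  proof (rule hom_sobolev_norm_scaled[where f = "ext1 \<alpha> r" and k = k
        and G = "\<lambda>I. iter_partial_deriv (rev I) (ext1 \<alpha> r)"])
    show "has_weak_deriv UNIV I (ext1 \<alpha> r) (iter_partial_deriv (rev I) (ext1 \<alpha> r))"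
      "(\<integral>\<^sup>+x. ennreal ((iter_partial_deriv (rev I) (ext1 \<alpha> r) x)\<^sup>2) \<partial>lebesgue) < \<infinity>"
      if "length I = k" for I using w[of I] that k by auto
  qed auto
  then obtain C where C: "C > 0" "\<And>\<epsilon>. 0 < \<epsilon> \<Longrightarrow> hom_sobolev_norm 2 UNIV (\<lambda>x. \<epsilon> * ext1 \<alpha> r x) \<le> ennreal (C * \<epsilon>)"
    by blast
  show ?thesis
  proof (intro exI[of _ C] conjI C(1) allI impI)
    fix \<epsilon> :: real assume \<epsilon>: "0 < \<epsilon>"
    let ?\<Psi> = "\<lambda>x. \<epsilon> * ext1 \<alpha> r x"
    have eq: "?\<Psi> x = \<epsilon> * logW \<alpha> (x $ 1)" if "x \<in> B 0" for x
      using ext1_eq_logW[OF that r(1)] by simp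
    have o: "open (- {0::real^3})" by auto
    show "\<exists>\<Psi>1 :: real^3 \<Rightarrow> real.
          \<Psi>1 \<in> sobolev_space 2 UNIV \<and>
          (\<forall>x\<in>B 0. \<Psi>1 x = chi1 \<alpha> \<epsilon> (x $ 1)) \<and>
          hom_sobolev_norm 2 UNIV \<Psi>1 \<le> ennreal (C * \<epsilon>) \<and>
          supp \<Psi>1 \<subseteq> {x. norm x \<le> R} \<and>
          sing_supp \<Psi>1 = {0}"
    proof (intro exI[of _ ?\<Psi>] conjI ballI)
      have "hom_sobolev_norm k UNIV ?\<Psi> < \<infinity>" if "k \<le> 2" for k
        using bd[OF that] \<epsilon> by (metis ennreal_less_top infinity_ennreal_def order_le_less_trans)
      then show "?\<Psi> \<in> sobolev_space 2 UNIV" by (simp add: sobolev_space_def)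
      show "?\<Psi> x = chi1 \<alpha> \<epsilon> (x $ 1)" if "x \<in> B 0" for x using eq[OF that] by (simp add: chi1_eq)
      show "hom_sobolev_norm 2 UNIV ?\<Psi> \<le> ennreal (C * \<epsilon>)" by (rule C(2)[OF \<epsilon>])
      show "supp ?\<Psi> \<subseteq> {x. norm x \<le> R}"
      proof (rule supp_subset)
        show "closed {x::real^3. norm x \<le> R}" by (intro closed_Collect_le continuous_intros)
        show "?\<Psi> x = 0" if "x \<notin> {x. norm x \<le> R}" for x
          using ext1_eq_0[OF r(1), of x] that r by simp
      qed
      have "smooth_on (- {0}) ?\<Psi>"
        using r assms by (intro smooth_on_mult o smooth_on_const smooth_on_ext1)
      then show "sing_supp ?\<Psi> = {0}" by (rule sing_supp_profile[OF assms(1) \<epsilon> _ eq])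
    qed
  qed
qed

section \<open>The extension in the homogeneous \<open>H\<^sup>1\<close>\<close>

lemma negligible_coordinate_plane: "negligible {x::real^'n::finite. x $ i = t}"
  using negligible_standard_hyperplane[of "axis i (1::real)" t]
  by (simp add: cart_eq_inner_axis)

text \<open>The square has a singularity of order -1/2 at the plane. On slabs at distance about 2^-k
  it is of order 2^(k/2) against a volume of order 2^-k.\<close>

lemma plane_singularity_square_integrable:
  fixes f :: "real^3 \<Rightarrow> real"
  assumes "\<And>x. S < norm x \<Longrightarrow> f x = 0" "S > 0"
    and "\<And>x. x $ 1 \<noteq> t \<Longrightarrow> norm x \<le> S \<Longrightarrow> \<bar>f x\<bar> \<le> C * \<bar>x $ 1 - t\<bar> powr (- (1/4))"
  shows "(\<integral>\<^sup>+x. ennreal ((f x)\<^sup>2) \<partial>lebesgue) < \<infinity>"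
proof -
  define m where "m = S + \<bar>t\<bar>"
  have m: "m > 0" using assms(2) by (simp add: m_def)
  define A where "A k = {x::real^3. m / 2 ^ Suc k \<le> \<bar>x $ 1 - t\<bar> \<and> \<bar>x $ 1 - t\<bar> \<le> m / 2 ^ k \<and> norm x \<le> S}" for k :: nat
  define a where "a k = C\<^sup>2 * (m / 2 ^ Suc k) powr (- (1/2))" for k :: nat
  define b where "b k = 2 * (m / 2 ^ k) * (2 * S) * (2 * S)" for k :: nat
  show ?thesis
  proof (rule nn_integral_finite_cover[where A = A and a = a and b = b])
    fix k :: nat
    have "closed (A k)" unfolding A_def
      by (intro closed_Collect_conj closed_Collect_le continuous_intros)
    then show "A k \<in> sets lebesgue" by auto
    let ?Q = "{x::real^3. t - m / 2 ^ k \<le> x $ 1 \<and> x $ 1 \<le> t + m / 2 ^ k \<and> - S \<le> x $ 2 \<and> x $ 2 \<le> S \<and> - S \<le> x $ 3 \<and> x $ 3 \<le> S}"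
    have mk: "0 \<le> m / 2 ^ k" using m by simp
    have "?Q \<in> sets lebesgue"
      by (rule fmeasurableD[OF lmeasurable_compact[OF emeasure_box3(2)]]) (use mk assms(2) in auto)
    moreover have "A k \<subseteq> ?Q"
      using norm_le_imp_box3[of _ S] by (auto simp: A_def abs_le_iff)
    ultimately have "emeasure lebesgue (A k) \<le> emeasure lebesgue ?Q" by (intro emeasure_mono)
    also have "\<dots> = ennreal (b k)"
      by (subst emeasure_box3(1)) (use m mk assms(2) in \<open>auto simp: b_def algebra_simps\<close>)
    finally show "emeasure lebesgue (A k) \<le> ennreal (b k)" .
  next
    fix k :: nat and x :: "real^3" assume "x \<in> A k"
    then have x: "m / 2 ^ Suc k \<le> \<bar>x $ 1 - t\<bar>" "norm x \<le> S" by (auto simp: A_def)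
    have pos: "0 < m / 2 ^ Suc k" using m by simp
    have "\<bar>f x\<bar> \<le> C * \<bar>x $ 1 - t\<bar> powr (- (1/4))"
      by (rule assms(3)) (use x pos in auto)
    then have "(f x)\<^sup>2 \<le> (C * \<bar>x $ 1 - t\<bar> powr (- (1/4)))\<^sup>2"
      using power_mono[of "\<bar>f x\<bar>" _ 2] by simp
    also have "\<dots> = C\<^sup>2 * \<bar>x $ 1 - t\<bar> powr (- (1/2))"
      unfolding power_mult_distrib by (simp add: power2_eq_square powr_add[symmetric] del: powr_minus)
    also have "\<dots> \<le> a k"
      unfolding a_def using x pos by (intro mult_left_mono powr_mono2') auto
    finally show "ennreal ((f x)\<^sup>2) \<le> ennreal (a k)" by (rule ennreal_leI)
  next
    have "AE x in lebesgue. x \<notin> {x::real^3. x $ 1 = t}"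
      using negligible_coordinate_plane[of 1 t] unfolding negligible_iff_null_sets
      by (rule AE_not_in)
    then show "AE x in lebesgue. (\<exists>k. x \<in> A k) \<or> ennreal ((f x)\<^sup>2) = 0"
    proof eventually_elim
      case (elim x)
      show ?case
      proof (cases "norm x \<le> S")
        case True
        have "0 < \<bar>x $ 1 - t\<bar>" using elim by simp
        moreover have "\<bar>x $ 1 - t\<bar> \<le> m"
          using True component_le_norm_cart[of x 1] unfolding m_def by linarith
        ultimately obtain k :: nat where "m / 2 ^ Suc k < \<bar>x $ 1 - t\<bar>" "\<bar>x $ 1 - t\<bar> \<le> m / 2 ^ k"
          using dyadic_scale by blast
        then show ?thesis using True by (intro disjI1 exI[of _ k]) (auto simp: A_def)
      qed (simp add: assms(1))
    qed
  next
    have "a k * b k = (8 * C\<^sup>2 * S\<^sup>2 * m * (m / 2) powr (- (1/2))) * (1 / sqrt 2) ^ k" for k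
    proof -
      have e: "m / 2 ^ Suc k = (m / 2) * (1/2) ^ k" by (simp add: power_divide)
      have "(m / 2 ^ Suc k) powr (- (1/2)) = (m / 2) powr (- (1/2)) * ((1/2) ^ k) powr (- (1/2))"
        by (subst e, subst powr_mult) (use m in auto)
      also have "((1/2::real) ^ k) powr (- (1/2)) = sqrt 2 ^ k"
        by (simp add: powr_minus powr_half_sqrt real_sqrt_power real_sqrt_divide power_divide)
      finally have "(m / 2 ^ Suc k) powr (- (1/2)) = (m / 2) powr (- (1/2)) * sqrt 2 ^ k" .
      moreover have "(2::real) ^ k = sqrt 2 ^ k * sqrt 2 ^ k" by (simp flip: power_mult_distrib)
      ultimately show ?thesis
        unfolding a_def b_def by (simp add: power_divide power2_eq_square)
    qed
    moreover have "summable (\<lambda>k. (8 * C\<^sup>2 * S\<^sup>2 * m * (m / 2) powr (- (1/2))) * (1 / sqrt 2) ^ k)"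
      by (intro summable_mult summable_geometric) simp
    ultimately show "summable (\<lambda>k. a k * b k)" by simp
  qed (use m assms(2) in \<open>auto simp: a_def b_def\<close>)
qed

text \<open>Here the profile itself is cut off: one derivative has to be square integrable, and a
  power of a logarithm is.\<close>

definition ext2 :: "real \<Rightarrow> real \<Rightarrow> real \<Rightarrow> real^3 \<Rightarrow> real" where
  "ext2 \<beta> t r x = cutoff r (r + 1) x * logW \<beta> (x $ 1 - t)"

text \<open>The product rule off the plane \<open>x $ 1 = t\<close>, as candidate for the weak
  derivative across it.\<close>

definition ext2' :: "real \<Rightarrow> real \<Rightarrow> real \<Rightarrow> 3 \<Rightarrow> real^3 \<Rightarrow> real" where
  "ext2' \<beta> t r i x = cutoff r (r + 1) x * ((if i = 1 then 1 else 0) * logw \<beta> (x $ 1 - t))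
    + partial_deriv i (cutoff r (r + 1)) x * logW \<beta> (x $ 1 - t)"

lemma ext2_weak_deriv:
  assumes "0 < \<beta>" "0 < r"
  shows "has_weak_deriv UNIV [i] (ext2 \<beta> t r) (ext2' \<beta> t r i)"
    and "(\<integral>\<^sup>+x. ennreal ((ext2' \<beta> t r i x)\<^sup>2) \<partial>lebesgue) < \<infinity>"
proof -
  let ?\<rho> = "cutoff r (r + 1) :: real^3 \<Rightarrow> real"
  define S where "S = r + 1"
  have S: "S > 0" using assms by (simp add: S_def)
  define m where "m = S + \<bar>t\<bar>"
  have m: "m > 0" using S by (simp add: m_def)
  have s\<rho>: "smooth_on UNIV ?\<rho>" using assms by (intro smooth_on_cutoff) auto
  have z\<rho>: "?\<rho> x = 0" if "S < norm x" for x using that assms unfolding S_def by (intro cutoff_eq_0) auto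
  have z\<rho>': "partial_deriv i ?\<rho> x = 0" if "S < norm x" for x i
    by (rule partial_deriv_eq_0_outside[OF z\<rho> that])
  obtain K where K: "\<And>x. jet_bound ?\<rho> x 1 K"
    using smooth_compact_support_jet_bound[OF s\<rho> z\<rho>] by blast
  have K1: "\<bar>?\<rho> x\<bar> \<le> K" "\<bar>partial_deriv i ?\<rho> x\<bar> \<le> K" for x i
    using K[of x] unfolding jet_bound_def by auto
  have K0: "K \<ge> 0" using K1(1)[of 0] by linarith
  obtain C where C: "C \<ge> 0" "\<And>s. 0 < \<bar>s\<bar> \<Longrightarrow> \<bar>s\<bar> \<le> m \<Longrightarrow> logw \<beta> s \<le> C * \<bar>s\<bar> powr (- (1/4))"
    using logw_bound[OF assms(1), of "1/4" m] m by auto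
  obtain D where D: "D \<ge> 0" "\<And>y. \<bar>y\<bar> \<le> m \<Longrightarrow> \<bar>logW \<beta> y\<bar> \<le> D * \<bar>y\<bar> powr (1/2)"
    using logW_bound[OF assms(1) m] by auto
  \<comment> \<open>Vanishing like \<bar>y\<bar>^(1/2) is weakened to the power -1/4, the shape in
    which \<open>logw\<close> is also bounded, so that both terms of the derivative fit the same
    criterion.\<close>
  have D': "\<bar>logW \<beta> y\<bar> \<le> D * m powr (3/4) * \<bar>y\<bar> powr (- (1/4))" if "\<bar>y\<bar> \<le> m" for y
  proof -
    have "\<bar>y\<bar> powr (1/2) = \<bar>y\<bar> powr (3/4 + - (1/4))" by simp
    also have "\<dots> = \<bar>y\<bar> powr (3/4) * \<bar>y\<bar> powr (- (1/4))" by (rule powr_add)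
    also have "\<dots> \<le> m powr (3/4) * \<bar>y\<bar> powr (- (1/4))"
      using that by (intro mult_right_mono powr_mono2) auto
    finally have "D * \<bar>y\<bar> powr (1/2) \<le> D * (m powr (3/4) * \<bar>y\<bar> powr (- (1/4)))"
      using D(1) by (rule mult_left_mono)
    then show ?thesis using D(2)[OF that] by simp
  qed
  have xm: "\<bar>x $ 1 - t\<bar> \<le> m" if "norm x \<le> S" for x :: "real^3"
    using that component_le_norm_cart[of x 1] unfolding m_def by linarith
  have logWm: "logW \<beta> \<in> borel_measurable borel"
  proof (rule borel_measurable_continuous_countable_exceptions[of "{0}"])
    show "continuous_on (- {0}) (logW \<beta>)"
      by (intro continuous_at_imp_continuous_on ballI DERIV_isCont[OF has_real_derivative_logW[OF assms(1)]]) auto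
  qed simp
  have x1m: "(\<lambda>x::real^3. x $ 1 - t) \<in> borel_measurable borel"
    by (intro borel_measurable_continuous_onI continuous_intros)
  have \<rho>m: "?\<rho> \<in> borel_measurable borel" "partial_deriv i ?\<rho> \<in> borel_measurable borel" for i
    using smooth_on_imp_continuous_on[OF s\<rho>] smooth_on_imp_continuous_on[OF smooth_on_partial_deriv[OF s\<rho>]]
    by (auto intro: borel_measurable_continuous_onI)
  have wm: "(\<lambda>x::real^3. logw \<beta> (x $ 1 - t)) \<in> borel_measurable borel"
    and Wm: "(\<lambda>x::real^3. logW \<beta> (x $ 1 - t)) \<in> borel_measurable borel"
    using measurable_compose[OF x1m borel_measurable_logw] measurable_compose[OF x1m logWm] by auto
  have fm: "ext2 \<beta> t r \<in> borel_measurable lebesgue"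
  proof -
    have "ext2 \<beta> t r \<in> borel_measurable borel"
      unfolding ext2_def[abs_def] by (intro borel_measurable_times \<rho>m Wm)
    then show ?thesis by (simp add: measurable_completion)
  qed
  have gm: "ext2' \<beta> t r i \<in> borel_measurable lebesgue"
  proof -
    have "ext2' \<beta> t r i \<in> borel_measurable borel"
      unfolding ext2'_def[abs_def]
      by (intro borel_measurable_add borel_measurable_times borel_measurable_const \<rho>m Wm wm)
    then show ?thesis by (simp add: measurable_completion)
  qed
  have fz: "ext2 \<beta> t r x = 0" if "S < norm x" for x using z\<rho>[OF that] by (simp add: ext2_def)
  have gz: "ext2' \<beta> t r i x = 0" if "S < norm x" for x
    using z\<rho>[OF that] z\<rho>'[OF that] by (simp add: ext2'_def)
  have fb: "\<bar>ext2 \<beta> t r x\<bar> \<le> K * D * \<bar>x $ 1 - t\<bar> powr (1/2)" if "norm x \<le> S" for x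
  proof -
    have "\<bar>?\<rho> x\<bar> * \<bar>logW \<beta> (x $ 1 - t)\<bar> \<le> K * (D * \<bar>x $ 1 - t\<bar> powr (1/2))"
      by (intro mult_mono K1 D(2) xm that K0) auto
    then show ?thesis by (simp add: ext2_def abs_mult)
  qed
  have f2: "(\<integral>\<^sup>+x. ennreal ((ext2 \<beta> t r x)\<^sup>2) \<partial>lebesgue) < \<infinity>"
  proof (rule plane_singularity_square_integrable[OF fz S])
    show "\<bar>ext2 \<beta> t r x\<bar> \<le> (K * (D * m powr (3/4))) * \<bar>x $ 1 - t\<bar> powr (- (1/4))" if "norm x \<le> S" for x
    proof -
      have "\<bar>?\<rho> x\<bar> * \<bar>logW \<beta> (x $ 1 - t)\<bar> \<le> K * (D * m powr (3/4) * \<bar>x $ 1 - t\<bar> powr (- (1/4)))"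
        by (intro mult_mono K1 D' xm that K0) auto
      then show ?thesis by (simp add: ext2_def abs_mult)
    qed
  qed
  show g2: "(\<integral>\<^sup>+x. ennreal ((ext2' \<beta> t r i x)\<^sup>2) \<partial>lebesgue) < \<infinity>"
  proof (rule plane_singularity_square_integrable[OF gz S])
    fix x :: "real^3" assume x: "x $ 1 \<noteq> t" "norm x \<le> S"
    let ?p = "\<bar>x $ 1 - t\<bar> powr (- (1/4))"
    have 1: "\<bar>?\<rho> x\<bar> * (\<bar>if i = 1 then 1 else 0\<bar> * logw \<beta> (x $ 1 - t)) \<le> K * (1 * (C * ?p))"
      using x by (intro mult_mono K1 C(2) xm K0) (auto simp: logw_nonneg)
    have 2: "\<bar>partial_deriv i ?\<rho> x\<bar> * \<bar>logW \<beta> (x $ 1 - t)\<bar> \<le> K * (D * m powr (3/4) * ?p)"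
      by (intro mult_mono K1 D' xm x K0) auto
    have "\<bar>ext2' \<beta> t r i x\<bar> \<le> \<bar>?\<rho> x\<bar> * (\<bar>if i = 1 then 1 else 0\<bar> * logw \<beta> (x $ 1 - t))
        + \<bar>partial_deriv i ?\<rho> x\<bar> * \<bar>logW \<beta> (x $ 1 - t)\<bar>"
      unfolding ext2'_def by (rule abs_triangle_ineq[THEN order_trans]) (simp add: abs_mult logw_nonneg)
    also have "\<dots> \<le> K * (1 * (C * ?p)) + K * (D * m powr (3/4) * ?p)" using 1 2 by (rule add_mono)
    finally show "\<bar>ext2' \<beta> t r i x\<bar> \<le> (K * C + K * D * m powr (3/4)) * ?p"
      by (simp add: algebra_simps)
  qed
  have "smooth_on UNIV (\<lambda>x::real^3. x $ 1 - t)" by (intro smooth_on_diff smooth_on_nth smooth_on_const) auto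
  then have dx1: "(\<lambda>x::real^3. x $ 1 - t) differentiable (at x)" for x
    by (rule smooth_on_imp_differentiable) auto
  have px1: "partial_deriv i (\<lambda>x::real^3. x $ 1 - t) x = (if i = 1 then 1 else 0)" for i x
  proof -
    have "((\<lambda>x::real^3. x $ 1 - t) has_derivative (\<lambda>h. h $ 1)) (at x)"
      by (auto intro!: derivative_eq_intros)
    from partial_deriv_eq[OF this] show ?thesis by (simp add: axis_def)
  qed
  show "has_weak_deriv UNIV [i] (ext2 \<beta> t r) (ext2' \<beta> t r i)"
  proof (rule has_weak_deriv_off_zeros[where q = "\<lambda>x. (x $ 1 - t) * (x $ 1 - t)"])
    show "smooth_on UNIV (\<lambda>x::real^3. (x $ 1 - t) * (x $ 1 - t))"
      by (intro smooth_on_mult smooth_on_diff smooth_on_nth smooth_on_const) auto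
    show "\<bar>partial_deriv i (\<lambda>x. (x $ 1 - t) * (x $ 1 - t)) x\<bar> \<le> 2 * sqrt ((x $ 1 - t) * (x $ 1 - t))"
      for x :: "real^3"
      unfolding partial_deriv_mult[OF dx1 dx1] px1 by (cases "i = 1") (auto simp: abs_if)
    have d\<rho>: "?\<rho> differentiable (at x)" for x by (rule smooth_on_imp_differentiable[OF s\<rho>]) auto
    have dW: "(logW \<beta> has_real_derivative logw \<beta> (x $ 1 - t)) (at (x $ 1 - t))"
      if "0 < (x $ 1 - t) * (x $ 1 - t)" for x :: "real^3"
      using that by (intro has_real_derivative_logW assms) auto
    note dWx = differentiable_compose_real[OF dx1 dW]
    show "ext2 \<beta> t r differentiable (at x)" if "0 < (x $ 1 - t) * (x $ 1 - t)" for x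
      unfolding ext2_def[abs_def] by (intro differentiable_mult d\<rho> dWx that)
    show "partial_deriv i (ext2 \<beta> t r) x = ext2' \<beta> t r i x" if "0 < (x $ 1 - t) * (x $ 1 - t)" for x
      unfolding ext2_def[abs_def] ext2'_def partial_deriv_mult[OF d\<rho> dWx[OF that]]
        partial_deriv_compose[OF dx1 dW[OF that]] px1 by simp
    show "continuous_on {x. 0 < (x $ 1 - t) * (x $ 1 - t)} (ext2' \<beta> t r i)"
    proof -
      have c: "continuous_on {x::real^3. 0 < (x $ 1 - t) * (x $ 1 - t)} (\<lambda>x. h (x $ 1 - t))"
        if "\<And>y. y \<noteq> 0 \<Longrightarrow> isCont h y" for h :: "real \<Rightarrow> real"
        by (rule continuous_on_compose2[of "- {0}" h])
           (auto intro!: continuous_intros continuous_at_imp_continuous_on that)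
      have "continuous_on UNIV ?\<rho>" "continuous_on UNIV (partial_deriv i ?\<rho>)"
        using smooth_on_imp_continuous_on[OF s\<rho>] smooth_on_imp_continuous_on[OF smooth_on_partial_deriv[OF s\<rho>]] by auto
      then show ?thesis
        unfolding ext2'_def[abs_def]
        using c[of "logw \<beta>", OF isCont_logw[OF _ assms(1)]]
          c[of "logW \<beta>", OF DERIV_isCont[OF has_real_derivative_logW[OF assms(1)]]]
        by (intro continuous_on_add continuous_on_mult continuous_on_const) (auto intro: continuous_on_subset)
    qed
    show "negligible {x::real^3. (x $ 1 - t) * (x $ 1 - t) = 0}"
      using negligible_coordinate_plane by simp
    show "locally_integrable_on (ext2 \<beta> t r) UNIV" "locally_integrable_on (ext2' \<beta> t r i) UNIV"
      by (rule locally_integrable_on_square_integrable[OF fm f2] locally_integrable_on_square_integrable[OF gm g2])+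
    show "\<exists>s. (\<forall>n::nat. \<forall>x. norm x \<le> r' \<longrightarrow> 1 \<le> (real n)\<^sup>2 * ((x $ 1 - t) * (x $ 1 - t)) \<longrightarrow>
          (real n)\<^sup>2 * ((x $ 1 - t) * (x $ 1 - t)) \<le> 2 \<longrightarrow> \<bar>ext2 \<beta> t r x\<bar> \<le> s n) \<and>
        (\<lambda>n. real n * s n * measure lebesgue {x::real^3. norm x \<le> r' \<and> (real n)\<^sup>2 * ((x $ 1 - t) * (x $ 1 - t)) \<le> 2}) \<longlonglongrightarrow> 0"
      for r'
    \<comment> \<open>Within distance 2/n of the plane the function is of order n^(-1/2), because
      \<open>logW\<close> vanishes at 0 at least like a square root. With gradient of order n and
      volume of order 1/n the product still tends to 0.\<close>
    proof (intro exI[of _ "\<lambda>n. K * D * sqrt (2 / real n)"] conjI allI impI)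
      have width: "\<bar>x $ 1 - t\<bar> \<le> 2 / real n"
        if "n > 0" "(real n)\<^sup>2 * ((x $ 1 - t) * (x $ 1 - t)) \<le> 2" for n :: nat and x :: "real^3"
      proof -
        have "(real n * \<bar>x $ 1 - t\<bar>)\<^sup>2 = (real n)\<^sup>2 * ((x $ 1 - t) * (x $ 1 - t))"
          unfolding power_mult_distrib power2_abs by (simp add: power2_eq_square)
        then have "(real n * \<bar>x $ 1 - t\<bar>)\<^sup>2 \<le> 2\<^sup>2" using that(2) by simp
        then have "real n * \<bar>x $ 1 - t\<bar> \<le> 2" by (rule power2_le_imp_le) simp
        then show ?thesis using that(1) by (simp add: field_simps)
      qed
      {
        fix n :: nat and x :: "real^3"
        assume a: "1 \<le> (real n)\<^sup>2 * ((x $ 1 - t) * (x $ 1 - t))" "(real n)\<^sup>2 * ((x $ 1 - t) * (x $ 1 - t)) \<le> 2"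
        then have "n > 0" by (cases n) auto
        note w = width[OF this a(2)]
        show "\<bar>ext2 \<beta> t r x\<bar> \<le> K * D * sqrt (2 / real n)"
        proof (cases "norm x \<le> S")
          case True
          have "\<bar>x $ 1 - t\<bar> powr (1/2) \<le> sqrt (2 / real n)" using w by (simp add: powr_half_sqrt)
          then have "K * D * \<bar>x $ 1 - t\<bar> powr (1/2) \<le> K * D * sqrt (2 / real n)"
            using K0 D(1) by (intro mult_left_mono) auto
          then show ?thesis using fb[OF True] by linarith
        next
          case False
          then show ?thesis using fz[of x] K0 D(1) by simp
        qed
      }
      let ?S = "\<lambda>n::nat. {x::real^3. norm x \<le> r' \<and> (real n)\<^sup>2 * ((x $ 1 - t) * (x $ 1 - t)) \<le> 2}"
      have M: "measure lebesgue (?S n) \<le> 4 / real n * (2 * \<bar>r'\<bar>) * (2 * \<bar>r'\<bar>)" if n: "n > 0" for n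
      proof -
        let ?Q = "{x::real^3. t - 2 / real n \<le> x $ 1 \<and> x $ 1 \<le> t + 2 / real n \<and>
          - \<bar>r'\<bar> \<le> x $ 2 \<and> x $ 2 \<le> \<bar>r'\<bar> \<and> - \<bar>r'\<bar> \<le> x $ 3 \<and> x $ 3 \<le> \<bar>r'\<bar>}"
        have nk: "0 \<le> 2 / real n" by simp
        have "?Q \<in> sets lebesgue"
          by (rule fmeasurableD[OF lmeasurable_compact[OF emeasure_box3(2)]]) (use nk in auto)
        moreover have "?S n \<subseteq> ?Q"
        proof
          fix x assume x: "x \<in> ?S n"
          then have "norm x \<le> \<bar>r'\<bar>" by auto
          then have "x \<in> box3 \<bar>r'\<bar> \<bar>r'\<bar>" by (rule norm_le_imp_box3)
          moreover have "\<bar>x $ 1 - t\<bar> \<le> 2 / real n" using width[OF n] x by auto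
          ultimately show "x \<in> ?Q" by (auto simp: abs_le_iff)
        qed
        ultimately have "emeasure lebesgue (?S n) \<le> emeasure lebesgue ?Q" by (intro emeasure_mono)
        also have "\<dots> = ennreal (4 / real n * (2 * \<bar>r'\<bar>) * (2 * \<bar>r'\<bar>))"
          by (subst emeasure_box3(1)) (use nk in \<open>auto simp: algebra_simps\<close>)
        finally show ?thesis unfolding measure_def by (intro enn2real_leI) auto
      qed
      show "(\<lambda>n. real n * (K * D * sqrt (2 / real n)) * measure lebesgue (?S n)) \<longlonglongrightarrow> 0"
      proof (rule Lim_null_comparison[OF always_eventually])
        have "(\<lambda>n. 16 * K * D * \<bar>r'\<bar> * \<bar>r'\<bar> * sqrt (2 / real n)) \<longlonglongrightarrow> 16 * K * D * \<bar>r'\<bar> * \<bar>r'\<bar> * sqrt 0"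
          by (intro tendsto_mult tendsto_const tendsto_real_sqrt lim_const_over_n)
        then show "(\<lambda>n. 16 * K * D * \<bar>r'\<bar> * \<bar>r'\<bar> * sqrt (2 / real n)) \<longlonglongrightarrow> 0" by simp
        show "\<forall>n. norm (real n * (K * D * sqrt (2 / real n)) * measure lebesgue (?S n))
            \<le> 16 * K * D * \<bar>r'\<bar> * \<bar>r'\<bar> * sqrt (2 / real n)"
        proof
          fix n :: nat
          show "norm (real n * (K * D * sqrt (2 / real n)) * measure lebesgue (?S n))
            \<le> 16 * K * D * \<bar>r'\<bar> * \<bar>r'\<bar> * sqrt (2 / real n)"
          proof (cases "n = 0")
            case False
            have nn: "0 \<le> real n * (K * D * sqrt (2 / real n))" using K0 D(1) by simp
            have "real n * (K * D * sqrt (2 / real n)) * measure lebesgue (?S n)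
                \<le> real n * (K * D * sqrt (2 / real n)) * (4 / real n * (2 * \<bar>r'\<bar>) * (2 * \<bar>r'\<bar>))"
              using M[of n] False nn by (intro mult_left_mono) auto
            also have "\<dots> = 16 * K * D * \<bar>r'\<bar> * \<bar>r'\<bar> * sqrt (2 / real n)" using False by simp
            finally show ?thesis using K0 D(1) by (simp add: abs_mult del: real_sqrt_divide)
          qed simp
        qed
      qed
    qed
  qed auto
qed

section \<open>Blow-up of the second derivative\<close>

lemma continuous_on_zero_extension:
  fixes f :: "'a::t2_space \<Rightarrow> real"
  assumes "continuous_on W f" "open W" "compact K" "K \<subseteq> W" "\<And>x. x \<notin> K \<Longrightarrow> f x = 0"
  shows "continuous_on UNIV f"
proof -
  have o: "open (- K)" using assms(3) compact_imp_closed by auto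
  have "continuous_on (- K) f"
    by (rule continuous_on_eq[OF continuous_on_const[of _ 0]]) (use assms(5) in auto)
  then have "continuous_on (W \<union> - K) f" using continuous_on_open_Un[OF assms(2) o assms(1)] by blast
  moreover have "W \<union> - K = UNIV" using assms(4) by auto
  ultimately show ?thesis by simp
qed

section \<open>Bumps on boxes approaching the point of tangency\<close>

abbreviation (input) slab_box :: "real \<Rightarrow> real \<Rightarrow> real \<Rightarrow> (real^3) set" where
  "slab_box t d s \<equiv> {x. t + d \<le> x $ 1 \<and> x $ 1 \<le> t + 2 * d \<and> s \<le> x $ 2 \<and> x $ 2 \<le> 2 * s \<and> s \<le> x $ 3 \<and> x $ 3 \<le> 2 * s}"

definition box_bump :: "real \<Rightarrow> real \<Rightarrow> real \<Rightarrow> real^3 \<Rightarrow> real" where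
  "box_bump t d s x = bump ((x $ 1 - t) / d - 1) * (bump (x $ 2 / s - 1) * bump (x $ 3 / s - 1))"

lemma smooth_on_box_bump: "0 < d \<Longrightarrow> 0 < s \<Longrightarrow> smooth_on UNIV (box_bump t d s)"
  unfolding box_bump_def[abs_def]
  by (intro smooth_on_mult smooth_on_bump smooth_on_diff smooth_on_divide smooth_on_nth smooth_on_const) auto

lemma box_bump_nonneg: "0 \<le> box_bump t d s x" and box_bump_le_1: "box_bump t d s x \<le> 1"
  unfolding box_bump_def by (auto intro!: mult_nonneg_nonneg mult_le_one bump_nonneg bump_le_1)

lemma box_bump_eq_0:
  assumes "0 < d" "0 < s" "x \<notin> slab_box t d s"
  shows "box_bump t d s x = 0"
proof -
  have "\<not> (0 < (x $ 1 - t) / d - 1 \<and> (x $ 1 - t) / d - 1 < 1) \<or> \<not> (0 < x $ 2 / s - 1 \<and> x $ 2 / s - 1 < 1)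
      \<or> \<not> (0 < x $ 3 / s - 1 \<and> x $ 3 / s - 1 < 1)"
    using assms by (auto simp: field_simps)
  then show ?thesis unfolding box_bump_def using bump_eq_0 by (metis mult_zero_left mult_zero_right)
qed

text \<open>The bound is the cube of the minimum of \<open>bump\<close> on the middle half of its
  interval. By scaling it does not depend on the position or shape of the box.\<close>

lemma box_bump_lower:
  obtains \<kappa> where "\<kappa> > 0" "\<And>t d s x. 0 < d \<Longrightarrow> 0 < s \<Longrightarrow>
    t + 5/4 * d \<le> x $ 1 \<Longrightarrow> x $ 1 \<le> t + 7/4 * d \<Longrightarrow> 5/4 * s \<le> x $ 2 \<Longrightarrow> x $ 2 \<le> 7/4 * s \<Longrightarrow>
    5/4 * s \<le> x $ 3 \<Longrightarrow> x $ 3 \<le> 7/4 * s \<Longrightarrow> \<kappa> \<le> box_bump t d s x"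
proof -
  obtain z where z: "z \<in> {1/4..3/4::real}" "\<And>y. y \<in> {1/4..3/4} \<Longrightarrow> bump z \<le> bump y"
    using continuous_attains_inf[of "{1/4..3/4::real}" bump] continuous_on_bump by auto
  have pos: "0 < bump z" using z(1) by (intro bump_pos) auto
  show ?thesis
  proof (rule that[of "bump z * (bump z * bump z)"])
    show "0 < bump z * (bump z * bump z)" using pos by simp
    fix t d s :: real and x :: "real^3"
    assume a: "0 < d" "0 < s" "t + 5/4 * d \<le> x $ 1" "x $ 1 \<le> t + 7/4 * d" "5/4 * s \<le> x $ 2" "x $ 2 \<le> 7/4 * s"
      "5/4 * s \<le> x $ 3" "x $ 3 \<le> 7/4 * s"
    show "bump z * (bump z * bump z) \<le> box_bump t d s x"
      unfolding box_bump_def using a pos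
      by (intro mult_mono z(2)) (auto simp: field_simps bump_nonneg)
  qed
qed

text \<open>A lower bound for the second weak derivative on one box, from testing against a bump and the
  inequality \<open>2 |g| \<le> \<mu> g\<^sup>2 + 1 / \<mu>\<close>.\<close>

lemma second_weak_deriv_lower_bound:
  assumes "0 < \<beta>" "\<beta> < 1" "0 < c"
  obtains \<theta> where "\<theta> > 0" "\<And>\<Omega> f g t d s. has_weak_deriv \<Omega> [1, 1] f g \<Longrightarrow>
    (\<And>x. x \<in> \<Omega> \<Longrightarrow> f x = c * logW \<beta> (x $ 1 - t)) \<Longrightarrow> 0 < d \<Longrightarrow> d \<le> 1 \<Longrightarrow> 0 < s \<Longrightarrow>
    slab_box t d s \<subseteq> \<Omega> \<Longrightarrow>
    ennreal (\<theta> * (ln (4 / d) powr (2 * \<beta> - 2) * (s\<^sup>2 / d)))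
      \<le> (\<integral>\<^sup>+x. ennreal ((g x)\<^sup>2) * indicator (slab_box t d s) x \<partial>lebesgue)"
proof -
  obtain \<kappa> where \<kappa>: "\<kappa> > 0" "\<And>t d s x. 0 < d \<Longrightarrow> 0 < s \<Longrightarrow>
    t + 5/4 * d \<le> x $ 1 \<Longrightarrow> x $ 1 \<le> t + 7/4 * d \<Longrightarrow> 5/4 * s \<le> x $ 2 \<Longrightarrow> x $ 2 \<le> 7/4 * s \<Longrightarrow>
    5/4 * s \<le> x $ 3 \<Longrightarrow> x $ 3 \<le> 7/4 * s \<Longrightarrow> \<kappa> \<le> box_bump t d s x"
    using box_bump_lower by metis
  \<comment> \<open>16 = 8 * 2: the inner box has an eighth of the volume, and 1/(x_1 - t) is at
    least 1/(2d) on the box.\<close>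
  define \<eta> where "\<eta> = c * \<beta> * \<kappa> / 16"
  have \<eta>: "\<eta> > 0" using assms \<kappa>(1) by (simp add: \<eta>_def)
  have main: "ennreal (\<eta>\<^sup>2 * (ln (4 / d) powr (2 * \<beta> - 2) * (s\<^sup>2 / d)))
      \<le> (\<integral>\<^sup>+x. ennreal ((g x)\<^sup>2) * indicator (slab_box t d s) x \<partial>lebesgue)"
    if weak: "has_weak_deriv \<Omega> [1, 1] f g"
      and f: "\<And>x. x \<in> \<Omega> \<Longrightarrow> f x = c * logW \<beta> (x $ 1 - t)"
      and d: "0 < d" "d \<le> 1" and s: "0 < s" and sub: "slab_box t d s \<subseteq> \<Omega>"
    for \<Omega> f g t d s
  proof -
    let ?\<phi> = "box_bump t d s"
    define Q where "Q = slab_box t d s"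
    define L where "L = ln (4 / d) powr (\<beta> - 1)"
    have L: "L > 0" using d by (simp add: L_def)
    have Qc: "compact Q" unfolding Q_def by (rule emeasure_box3(2)) (use d s in auto)
    have Qm: "emeasure lebesgue Q = ennreal (d * s\<^sup>2)"
      unfolding Q_def by (subst emeasure_box3(1)) (use d s in \<open>auto simp: power2_eq_square\<close>)
    have s\<phi>: "smooth_on UNIV ?\<phi>" by (rule smooth_on_box_bump[OF d(1) s])
    have z\<phi>: "?\<phi> x = 0" if "x \<notin> Q" for x by (rule box_bump_eq_0[OF d(1) s that[unfolded Q_def]])
    have QS: "Q \<subseteq> \<Omega>" using sub by (simp only: Q_def)
    have test: "test_function \<Omega> ?\<phi>" by (rule test_functionI[OF s\<phi> Qc QS z\<phi>])
    have oQ: "open (- Q)" using Qc compact_imp_closed by blast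
    have z\<phi>1: "partial_deriv 1 ?\<phi> x = 0" if "x \<notin> Q" for x
    proof -
      have "partial_deriv 1 ?\<phi> x = partial_deriv 1 (\<lambda>_. 0) x"
        by (rule partial_deriv_cong[OF oQ]) (use that z\<phi> in auto)
      then show ?thesis by simp
    qed
    have z\<phi>2: "partial_deriv 1 (partial_deriv 1 ?\<phi>) x = 0" if "x \<notin> Q" for x
    proof -
      have "partial_deriv 1 (partial_deriv 1 ?\<phi>) x = partial_deriv 1 (\<lambda>_. 0) x"
        by (rule partial_deriv_cong[OF oQ]) (use that z\<phi>1 in auto)
      then show ?thesis by simp
    qed
    \<comment> \<open>In this strip the profile is classically twice differentiable, and it contains
      \<open>Q\<close> because 2d \<le> 2. Outside \<open>Q\<close> the bump annihilates
      everything.\<close>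
    let ?W = "{x::real^3. t < x $ 1 \<and> x $ 1 < t + 4}"
    have oW: "open ?W" by (intro open_Collect_conj open_Collect_less continuous_intros)
    have QW: "Q \<subseteq> ?W" using d by (auto simp: Q_def)
    define u where "u x = c * logW \<beta> (x $ 1 - t)" for x :: "real^3"
    define u1 where "u1 x = c * logw \<beta> (x $ 1 - t)" for x :: "real^3"
    define u2 where "u2 x = c * (- (\<beta> * ln (4 / (x $ 1 - t)) powr (\<beta> - 1) / (x $ 1 - t)))" for x :: "real^3"
    have "smooth_on UNIV (\<lambda>x::real^3. x $ 1 - t)" by (intro smooth_on_diff smooth_on_nth smooth_on_const) auto
    then have dx1: "(\<lambda>x::real^3. x $ 1 - t) differentiable (at x)" for x
      by (rule smooth_on_imp_differentiable) auto
    have px1: "partial_deriv 1 (\<lambda>x::real^3. x $ 1 - t) x = 1" for x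
    proof -
      have "((\<lambda>x::real^3. x $ 1 - t) has_derivative (\<lambda>h. h $ 1)) (at x)"
        by (auto intro!: derivative_eq_intros)
      from partial_deriv_eq[OF this] show ?thesis by (simp add: axis_def)
    qed
    have dW: "((\<lambda>y. c * logW \<beta> y) has_real_derivative c * logw \<beta> (x $ 1 - t)) (at (x $ 1 - t))"
      and dw: "((\<lambda>y. c * logw \<beta> y) has_real_derivative
        c * (- (\<beta> * ln (4 / (x $ 1 - t)) powr (\<beta> - 1) / (x $ 1 - t)))) (at (x $ 1 - t))"
      if "x \<in> ?W" for x
      using that assms by (intro DERIV_cmult has_real_derivative_logW has_real_derivative_logw; simp)+
    have du: "u differentiable (at x)" "partial_deriv 1 u x = u1 x" if "x \<in> ?W" for x
      using differentiable_compose_real[OF dx1 dW[OF that]] partial_deriv_compose[OF dx1 dW[OF that], of 1]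
      unfolding u_def[abs_def] u1_def px1 by auto
    have du1: "u1 differentiable (at x)" "partial_deriv 1 u1 x = u2 x" if "x \<in> ?W" for x
      using differentiable_compose_real[OF dx1 dw[OF that]] partial_deriv_compose[OF dx1 dw[OF that], of 1]
      unfolding u1_def[abs_def] u2_def px1 by auto
    have cu: "continuous_on ?W u" and cu1: "continuous_on ?W u1"
      using du(1) du1(1) by (auto intro!: continuous_at_imp_continuous_on differentiable_imp_continuous_within)
    have cu2: "continuous_on ?W u2"
      unfolding u2_def[abs_def] by (intro continuous_intros) auto
    define \<phi>1 where "\<phi>1 = partial_deriv 1 ?\<phi>"
    define \<phi>2 where "\<phi>2 = partial_deriv 1 \<phi>1"
    have s\<phi>1: "smooth_on UNIV \<phi>1" and s\<phi>2: "smooth_on UNIV \<phi>2"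
      unfolding \<phi>1_def \<phi>2_def by (intro smooth_on_partial_deriv s\<phi>)+
    have d\<phi>: "?\<phi> differentiable (at x)" "\<phi>1 differentiable (at x)" for x
      using smooth_on_imp_differentiable[OF s\<phi>] smooth_on_imp_differentiable[OF s\<phi>1] by auto
    have c\<phi>: "continuous_on A ?\<phi>" "continuous_on A \<phi>2" for A
      using smooth_on_imp_continuous_on[OF s\<phi>] smooth_on_imp_continuous_on[OF s\<phi>2]
      by (auto intro: continuous_on_subset)
    have z: "?\<phi> x = 0" "\<phi>1 x = 0" "\<phi>2 x = 0" if "x \<notin> Q" for x
      using z\<phi>[OF that] z\<phi>1[OF that] z\<phi>2[OF that] by (auto simp: \<phi>1_def \<phi>2_def)
    obtain r where r: "\<And>x. x \<in> Q \<Longrightarrow> norm x \<le> r"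
      using compact_imp_bounded[OF Qc] by (auto simp: bounded_iff)
    have out: "x \<notin> Q" if "r < norm x" for x using r[of x] that by linarith
    have cA: "continuous_on UNIV (\<lambda>x. u x * \<phi>2 x)"
      by (rule continuous_on_zero_extension[OF _ oW Qc QW]) (auto intro!: continuous_on_mult cu c\<phi> simp: z)
    have cB: "continuous_on UNIV (\<lambda>x. u2 x * ?\<phi> x)"
      by (rule continuous_on_zero_extension[OF _ oW Qc QW]) (auto intro!: continuous_on_mult cu2 c\<phi> simp: z)
    have iA: "integrable lborel (\<lambda>x. u x * \<phi>2 x)" and iB: "integrable lborel (\<lambda>x. u2 x * ?\<phi> x)"
      using z out by (auto intro!: integrable_continuous_compact_support[where r = r] cA cB)
    have iA': "integrable lebesgue (\<lambda>x. u x * \<phi>2 x)" and iB': "integrable lebesgue (\<lambda>x. u2 x * ?\<phi> x)"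
      using iA iB by (auto simp: integrable_completion)
    have parts: "(\<integral>x. u x * \<phi>2 x \<partial>lebesgue) = (\<integral>x. u2 x * ?\<phi> x \<partial>lebesgue)"
    proof -
      define v where "v x = (-1) * u1 x" for x
      \<comment> \<open>Performs both integrations by parts at once: the mixed terms
        \<open>u1 * \<phi>1\<close> cancel in its derivative.\<close>
      define H where "H x = u x * \<phi>1 x + v x * ?\<phi> x" for x
      have H: "H differentiable (at x) \<and> partial_deriv 1 H x = u x * \<phi>2 x - u2 x * ?\<phi> x" for x
      proof (cases "x \<in> ?W")
        case True
        note du = du[OF True] and du1 = du1[OF True]
        have m: "v differentiable (at x)" "partial_deriv 1 v x = - u2 x"
          using partial_deriv_mult[OF differentiable_const du1(1), of 1 "-1"] du1
          unfolding v_def[abs_def] by auto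
        note mult = differentiable_mult[OF du(1) d\<phi>(2)] differentiable_mult[OF m(1) d\<phi>(1)]
        have "partial_deriv 1 H x = (u x * partial_deriv 1 \<phi>1 x + partial_deriv 1 u x * \<phi>1 x)
            + (v x * partial_deriv 1 ?\<phi> x + partial_deriv 1 v x * ?\<phi> x)"
          unfolding H_def[abs_def] partial_deriv_add[OF mult]
            partial_deriv_mult[OF du(1) d\<phi>(2)] partial_deriv_mult[OF m(1) d\<phi>(1)] ..
        then have "partial_deriv 1 H x = u x * \<phi>2 x - u2 x * ?\<phi> x"
          unfolding du(2) m(2) by (simp add: \<phi>2_def \<phi>1_def v_def)
        moreover have "H differentiable (at x)"
          unfolding H_def[abs_def] using du(1) m(1) d\<phi> by (intro differentiable_add differentiable_mult)
        ultimately show ?thesis by blast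
      next
        case False
        then have x: "x \<in> - Q" using QW by blast
        have "H differentiable (at x)"
          by (rule differentiable_cong_open[OF oQ x, of _ "\<lambda>_. 0"]) (auto simp: H_def z)
        moreover have "partial_deriv 1 H x = partial_deriv 1 (\<lambda>_. 0) x"
          by (rule partial_deriv_cong[OF oQ x]) (auto simp: H_def z)
        ultimately show ?thesis using x z[of x] by simp
      qed
      then have pH: "partial_deriv 1 H = (\<lambda>x. u x * \<phi>2 x - u2 x * ?\<phi> x)" by blast
      have "integral\<^sup>L lebesgue (partial_deriv 1 H) = 0"
      proof (rule integral_partial_deriv_eq_0[where r = r])
        show "continuous_on UNIV (partial_deriv 1 H)" unfolding pH by (intro continuous_on_diff cA cB)
      qed (use H z out in \<open>auto simp: H_def\<close>)
      then show ?thesis unfolding pH using iA' iB' by simp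
    qed
    define G where "G x = indicator Q x *\<^sub>R g x" for x
    have iG: "integrable lebesgue G"
      using weak Qc QS unfolding has_weak_deriv_def locally_integrable_on_def set_integrable_def G_def[abs_def] by blast
    have weak_eq: "(\<integral>x. u x * \<phi>2 x \<partial>lebesgue) = (\<integral>x. G x * ?\<phi> x \<partial>lebesgue)"
    proof -
      have e1: "(LINT x:\<Omega>|lebesgue. f x * iter_partial_deriv [1, 1] ?\<phi> x) =
          (- 1) ^ length [1, 1::3] * (LINT x:\<Omega>|lebesgue. g x * ?\<phi> x)"
        using weak test unfolding has_weak_deriv_def by blast
      have e2: "indicator \<Omega> x *\<^sub>R (f x * iter_partial_deriv [1, 1] ?\<phi> x) = u x * \<phi>2 x" for x
        using f[of x] z[of x] QS by (cases "x \<in> Q"; cases "x \<in> \<Omega>")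
          (auto simp: u_def \<phi>2_def \<phi>1_def)
      have e3: "indicator \<Omega> x *\<^sub>R (g x * ?\<phi> x) = G x * ?\<phi> x" for x
        using z[of x] QS by (cases "x \<in> Q"; cases "x \<in> \<Omega>") (auto simp: G_def)
      show ?thesis using e1 unfolding set_lebesgue_integral_def e2 e3 by simp
    qed
    define A where "A = \<eta> * L * s\<^sup>2"
    have A: "A > 0" using \<eta> L s by (simp add: A_def)
    define P where "P = {x::real^3. t + 5/4 * d \<le> x $ 1 \<and> x $ 1 \<le> t + 7/4 * d \<and> 5/4 * s \<le> x $ 2 \<and> x $ 2 \<le> 7/4 * s \<and>
      5/4 * s \<le> x $ 3 \<and> x $ 3 \<le> 7/4 * s}"
    have lower: "A \<le> - (\<integral>x. u2 x * ?\<phi> x \<partial>lebesgue)"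
    proof -
      have Rc: "compact P" unfolding P_def by (rule emeasure_box3(2)) (use d s in auto)
      have Rm: "emeasure lebesgue P = ennreal (d * s\<^sup>2 / 8)"
        unfolding P_def by (subst emeasure_box3(1)) (use d s in \<open>auto simp: power2_eq_square algebra_simps\<close>)
      have Rf: "P \<in> lmeasurable" by (rule lmeasurable_compact[OF Rc])
      have mR: "measure lebesgue P = d * s\<^sup>2 / 8" unfolding measure_def Rm using d s by simp
      have "(\<integral>x. indicator P x *\<^sub>R (c * \<beta> * L / (2 * d) * \<kappa>) \<partial>lebesgue) \<le> (\<integral>x. - (u2 x * ?\<phi> x) \<partial>lebesgue)"
      proof (rule integral_mono)
        have "integrable lebesgue (indicator P :: _ \<Rightarrow> real)"
          using Rf by (intro integrable_real_indicator) (auto simp: fmeasurable_def)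
        then show "integrable lebesgue (\<lambda>x. indicator P x *\<^sub>R (c * \<beta> * L / (2 * d) * \<kappa>))"
          by (rule integrable_scaleR_left)
        show "integrable lebesgue (\<lambda>x. - (u2 x * ?\<phi> x))" using iB' by simp
        fix x :: "real^3"
        have u2: "c * \<beta> * L / (2 * d) \<le> - u2 x" if "x \<in> Q"
        proof -
          have x: "d \<le> x $ 1 - t" "x $ 1 - t \<le> 2 * d" using that by (auto simp: Q_def)
          have "L \<le> ln (4 / (x $ 1 - t)) powr (\<beta> - 1)"
            unfolding L_def using x d assms
            by (intro powr_mono2') (auto simp: field_simps)
          then have "L / (2 * d) \<le> ln (4 / (x $ 1 - t)) powr (\<beta> - 1) / (x $ 1 - t)"
            using x d by (intro frac_le) auto
          then have "c * \<beta> * (L / (2 * d)) \<le> c * \<beta> * (ln (4 / (x $ 1 - t)) powr (\<beta> - 1) / (x $ 1 - t))"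
            using assms by (intro mult_left_mono) auto
          then show ?thesis by (simp add: u2_def)
        qed
        have nn: "0 \<le> c * \<beta> * L / (2 * d)" using assms L d by simp
        show "indicator P x *\<^sub>R (c * \<beta> * L / (2 * d) * \<kappa>) \<le> - (u2 x * ?\<phi> x)"
        proof (cases "x \<in> P")
          case True
          then have xQ: "x \<in> Q" using d s by (auto simp: Q_def P_def)
          have "\<kappa> \<le> ?\<phi> x" using True d s by (intro \<kappa>(2)) (auto simp: P_def)
          then have "c * \<beta> * L / (2 * d) * \<kappa> \<le> - u2 x * ?\<phi> x"
            using u2[OF xQ] nn \<kappa>(1) by (intro mult_mono) auto
          then show ?thesis using True by simp
        next
          case False
          have "0 \<le> - u2 x * ?\<phi> x"
          proof (cases "x \<in> Q")
            case True
            show ?thesis by (rule mult_nonneg_nonneg[OF order_trans[OF nn u2[OF True]] box_bump_nonneg])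
          qed (simp add: z)
          then show ?thesis using False by simp
        qed
      qed
      then have "d * s\<^sup>2 / 8 * (c * \<beta> * L / (2 * d) * \<kappa>) \<le> - (\<integral>x. u2 x * ?\<phi> x \<partial>lebesgue)"
        using mR by simp
      moreover have "d * s\<^sup>2 / 8 * (c * \<beta> * L / (2 * d) * \<kappa>) = A"
        using d by (simp add: A_def \<eta>_def)
      ultimately show ?thesis by simp
    qed
    define I where "I = (\<integral>\<^sup>+x. ennreal ((G x)\<^sup>2) \<partial>lebesgue)"
    have I_eq: "(\<integral>\<^sup>+x. ennreal ((g x)\<^sup>2) * indicator Q x \<partial>lebesgue) = I"
      unfolding I_def by (intro nn_integral_cong) (auto simp: G_def indicator_def)
    have val: "\<eta>\<^sup>2 * (ln (4 / d) powr (2 * \<beta> - 2) * (s\<^sup>2 / d)) = A\<^sup>2 / (d * s\<^sup>2)"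
    proof -
      have "L\<^sup>2 = ln (4 / d) powr (2 * \<beta> - 2)"
        unfolding L_def power2_eq_square powr_add[symmetric] by simp
      moreover have "(\<eta> * L * q)\<^sup>2 / (d * q) = \<eta>\<^sup>2 * (L\<^sup>2 * (q / d))" if "q > 0" for q
        using that d by (simp add: field_simps power2_eq_square)
      ultimately show ?thesis using s by (simp add: A_def)
    qed
    show ?thesis
    proof (cases "I = \<infinity>")
      case False
      have Gm: "G \<in> borel_measurable lebesgue" using iG by auto
      have iG2: "integrable lebesgue (\<lambda>x. (G x)\<^sup>2)"
        using False Gm by (intro integrableI_nonneg) (auto simp: I_def top.not_eq_extremum)
      define J where "J = (\<integral>x. (G x)\<^sup>2 \<partial>lebesgue)"
      have IJ: "I = ennreal J"
        unfolding I_def J_def by (rule nn_integral_eq_integral[OF iG2]) simp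
      \<comment> \<open>The balancing value: the constant term becomes
        \<open>d * s\<^sup>2 / \<mu> = A\<close>, half of which is absorbed on the left.\<close>
      define \<mu> where "\<mu> = d * s\<^sup>2 / A"
      have \<mu>: "\<mu> > 0" using d s A by (simp add: \<mu>_def)
      have iQ: "integrable lebesgue (indicator Q :: _ \<Rightarrow> real)"
        using lmeasurable_compact[OF Qc] by (intro integrable_real_indicator) (auto simp: fmeasurable_def)
      have mQ: "measure lebesgue Q = d * s\<^sup>2" unfolding measure_def Qm using d s by simp
      have "A \<le> (\<integral>x. - (G x * ?\<phi> x) \<partial>lebesgue)" using lower parts weak_eq by simp
      also have "\<dots> \<le> (\<integral>x. (\<mu> * (G x)\<^sup>2 + indicator Q x / \<mu>) / 2 \<partial>lebesgue)"
      proof (rule integral_mono)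
        show "integrable lebesgue (\<lambda>x. - (G x * ?\<phi> x))"
        proof (rule Bochner_Integration.integrable_bound[OF iG])
          show "(\<lambda>x. - (G x * ?\<phi> x)) \<in> borel_measurable lebesgue"
            using Gm borel_measurable_lebesgue_continuous[OF c\<phi>(1)] by (intro borel_measurable_uminus borel_measurable_times)
          show "AE x in lebesgue. norm (- (G x * ?\<phi> x)) \<le> norm (G x)"
            by (intro AE_I2) (simp add: abs_mult box_bump_nonneg box_bump_le_1 mult_left_le)
        qed
        show "integrable lebesgue (\<lambda>x. (\<mu> * (G x)\<^sup>2 + indicator Q x / \<mu>) / 2)"
          using iG2 iQ by simp
        fix x :: "real^3"
        show "- (G x * ?\<phi> x) \<le> (\<mu> * (G x)\<^sup>2 + indicator Q x / \<mu>) / 2"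
        proof (cases "x \<in> Q")
          case True
          have "- (G x * ?\<phi> x) \<le> \<bar>G x\<bar> * ?\<phi> x" using box_bump_nonneg[of t d s x]
            by (metis abs_ge_minus_self abs_mult abs_of_nonneg)
          also have "\<dots> \<le> \<bar>G x\<bar>" using box_bump_nonneg[of t d s x] box_bump_le_1[of t d s x] by (intro mult_left_le) auto
          also have "\<dots> \<le> (\<mu> * (G x)\<^sup>2 + 1 / \<mu>) / 2"
          proof -
            have "2 * \<bar>G x\<bar> * (1/\<mu>) \<le> (\<bar>G x\<bar>)\<^sup>2 + (1/\<mu>)\<^sup>2" by (rule sum_squares_bound)
            then have "\<mu> * (2 * \<bar>G x\<bar> * (1/\<mu>)) \<le> \<mu> * ((\<bar>G x\<bar>)\<^sup>2 + (1/\<mu>)\<^sup>2)" using \<mu> by (intro mult_left_mono) auto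
            also have "\<dots> = \<mu> * (G x)\<^sup>2 + 1 / \<mu>" using \<mu> by (simp add: distrib_left power2_eq_square)
            finally show ?thesis using \<mu> by simp
          qed
          finally show ?thesis using True by simp
        next
          case False
          have "0 \<le> \<mu> * (G x)\<^sup>2" using \<mu> by simp
          then show ?thesis using z(1)[OF False] False \<mu> by simp
        qed
      qed
      also have "\<dots> = (\<mu> * J + d * s\<^sup>2 / \<mu>) / 2"
        using iG2 iQ by (simp add: J_def mQ)
      also have "d * s\<^sup>2 / \<mu> = A" using A d s by (simp add: \<mu>_def)
      finally have "A \<le> \<mu> * J" by simp
      then have "A\<^sup>2 / (d * s\<^sup>2) \<le> J"
        using A d s by (simp add: \<mu>_def field_simps power2_eq_square)
      then show ?thesis unfolding Q_def[symmetric] I_eq IJ val by (rule ennreal_leI)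
    qed (use I_eq in \<open>simp add: Q_def\<close>)
  qed
  show ?thesis by (rule that[of "\<eta>\<^sup>2"]) (use \<eta> main in auto)
qed

text \<open>With y = x_1 - t the ball reads y^2 + x_2^2 + x_3^2 < 2 l y. The parabolic scaling s^2 =
  l d/16 follows the tangency and keeps the lateral part below l y/2, and y \<le> l/2 does the same
  for y^2.\<close>

lemma slab_box_subset_B:
  assumes "t < 1" "l = 1 - t" "d = l / 4 / 4 ^ k" "s = l / 8 / 2 ^ k"
  shows "slab_box t d s \<subseteq> B t"
proof
  fix x assume x: "x \<in> slab_box t d s"
  have l: "l > 0" using assms by simp
  have d: "0 < d" "d \<le> l / 4" using l by (auto simp: assms(3) field_simps)
  have s: "0 < s" using l by (simp add: assms(4))
  have s2: "s\<^sup>2 = l * d / 16"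
    by (simp add: assms(3,4) power2_eq_square field_simps) (simp flip: power_mult_distrib)
  define y where "y = x $ 1 - t"
  have y: "d \<le> y" "y \<le> 2 * d" using x by (auto simp: y_def)
  have "(x $ 2)\<^sup>2 \<le> (2 * s)\<^sup>2" "(x $ 3)\<^sup>2 \<le> (2 * s)\<^sup>2"
    using x s by (intro power_mono; auto)+
  then have 1: "(x $ 2)\<^sup>2 + (x $ 3)\<^sup>2 \<le> l * d / 2" by (simp add: power_mult_distrib s2 mult_ac)
  have 2: "l * d \<le> l * y" using l y by (intro mult_left_mono) auto
  have "y * y \<le> (l / 2) * y" using y d by (intro mult_right_mono) auto
  then have 3: "y\<^sup>2 \<le> l * y / 2" by (simp add: power2_eq_square)
  have "0 < l * y" using l d y by simp
  moreover have "(x $ 1 - 1)\<^sup>2 = y\<^sup>2 - 2 * (l * y) + (1 - t)\<^sup>2"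
    unfolding assms(2) y_def by (simp add: power2_eq_square algebra_simps)
  ultimately show "x \<in> B t" unfolding B_def using 1 2 3 by simp
qed

text \<open>Any second weak derivative in x_1 has squared mass at least a multiple of
  (k+1)^(2\<beta>-2) on the k-th of infinitely many disjoint boxes in the ball, and this series
  diverges since 2\<beta> - 2 > -1. If there is no such derivative, the infimum is over the empty
  set and infinite as well.\<close>

lemma hom_sobolev_norm_2_infinite:
  assumes "1/2 < \<beta>" "\<beta> < 1" "0 < c" "0 \<le> t" "t < 1"
    and f: "\<And>x. x \<in> B t \<Longrightarrow> f x = c * logW \<beta> (x $ 1 - t)"
  shows "hom_sobolev_norm 2 (B t) f = \<infinity>"
proof -
  obtain \<theta> where \<theta>: "\<theta> > 0" "\<And>\<Omega> f g t d s. has_weak_deriv \<Omega> [1, 1] f g \<Longrightarrow>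
    (\<And>x. x \<in> \<Omega> \<Longrightarrow> f x = c * logW \<beta> (x $ 1 - t)) \<Longrightarrow> 0 < d \<Longrightarrow> d \<le> 1 \<Longrightarrow> 0 < s \<Longrightarrow>
    slab_box t d s \<subseteq> \<Omega> \<Longrightarrow>
    ennreal (\<theta> * (ln (4 / d) powr (2 * \<beta> - 2) * (s\<^sup>2 / d)))
      \<le> (\<integral>\<^sup>+x. ennreal ((g x)\<^sup>2) * indicator (slab_box t d s) x \<partial>lebesgue)"
    by (rule second_weak_deriv_lower_bound[of \<beta> c]) (use assms in auto)
  define l where "l = 1 - t"
  have l: "0 < l" "l \<le> 1" using assms by (auto simp: l_def)
  define d where "d k = l / 4 / 4 ^ k" for k :: nat
  define s where "s k = l / 8 / 2 ^ k" for k :: nat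
  define Q where "Q k = slab_box t (d k) (s k)" for k
  have d: "0 < d k" "d k \<le> 1" for k
  proof -
    show "0 < d k" using l by (simp add: d_def)
    have "l \<le> 4 * 4 ^ k" using l one_le_power[of "4::real" k] by linarith
    then show "d k \<le> 1" by (simp add: d_def field_simps)
  qed
  have s: "0 < s k" for k using l by (simp add: s_def)
  have QB: "Q k \<subseteq> B t" for k
    unfolding Q_def by (rule slab_box_subset_B[OF assms(5) l_def d_def s_def])
  \<comment> \<open>This quotient is the same for all boxes, so the power of the logarithm alone
    decides about divergence.\<close>
  have ratio: "(s k)\<^sup>2 / d k = l / 16" for k
    using l by (simp add: s_def d_def power2_eq_square field_simps) (simp flip: power_mult_distrib)
  \<comment> \<open>Consecutive values of \<open>d\<close> differ by the factor 4, more than the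
    factor 2 between the ends of the x_1-interval of a box, so the boxes are disjoint.\<close>
  have dec: "2 * d j < d k" if "k < j" for j k
  proof -
    have "d (Suc k) = d k / 4" by (simp add: d_def)
    moreover have "d j \<le> d (Suc k)"
      unfolding d_def using l that by (intro divide_left_mono power_increasing) auto
    ultimately show ?thesis using d(1)[of k] by linarith
  qed
  have disj: False if "j \<noteq> k" "x \<in> Q j" "x \<in> Q k" for j k x
  proof -
    have "d j \<le> x $ 1 - t" "x $ 1 - t \<le> 2 * d j" "d k \<le> x $ 1 - t" "x $ 1 - t \<le> 2 * d k"
      using that by (auto simp: Q_def)
    then show False using dec[of j k] dec[of k j] that(1) by (cases "j < k") auto
  qed
  \<comment> \<open>Makes \<open>ln (4 / d k)\<close>, which is ln (16/l) + k ln 4, at most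
    \<open>e * real (Suc k)\<close>.\<close>
  define e where "e = ln (16 / l) + ln 4"
  have "ln (16 / l) > 0" using l by (intro ln_gt_zero) (simp add: field_simps)
  then have e: "e > 0" by (simp add: e_def add_pos_pos)
  define \<theta>' where "\<theta>' = \<theta> * (e powr (2 * \<beta> - 2) * (l / 16))"
  have \<theta>': "\<theta>' > 0" using \<theta>(1) e l by (simp add: \<theta>'_def)
  have infinite: "(\<integral>\<^sup>+x\<in>B t. ennreal ((g x)\<^sup>2) \<partial>lebesgue) = \<infinity>" if weak: "has_weak_deriv (B t) [1, 1] f g" for g
  proof (rule ccontr)
    let ?T = "\<integral>\<^sup>+x\<in>B t. ennreal ((g x)\<^sup>2) \<partial>lebesgue"
    assume "?T \<noteq> \<infinity>"
    then obtain T where T: "?T = ennreal T" "0 \<le> T" by (cases ?T) auto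
    have box_lower: "ennreal (\<theta>' * real (Suc k) powr (2 * \<beta> - 2))
        \<le> (\<integral>\<^sup>+x. ennreal ((g x)\<^sup>2) * indicator (Q k) x \<partial>lebesgue)" for k
    proof -
      have "ln (4 / d k) = ln (16 / l) + real k * ln 4"
        using l by (simp add: d_def ln_div ln_mult ln_realpow)
      also have "\<dots> \<le> e * real (Suc k)"
      proof -
        have "0 \<le> real k * ln (16 / l)" using l by simp
        then show ?thesis by (simp add: e_def algebra_simps)
      qed
      finally have le: "ln (4 / d k) \<le> e * real (Suc k)" .
      have "0 < ln (4 / d k)" using d[of k] by simp
      then have "(e * real (Suc k)) powr (2 * \<beta> - 2) \<le> ln (4 / d k) powr (2 * \<beta> - 2)"
        using le assms by (intro powr_mono2') auto
      moreover have "(e * real (Suc k)) powr (2 * \<beta> - 2) = e powr (2 * \<beta> - 2) * real (Suc k) powr (2 * \<beta> - 2)"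
        using e by (simp add: powr_mult)
      ultimately have "\<theta> * (e powr (2 * \<beta> - 2) * real (Suc k) powr (2 * \<beta> - 2) * (l / 16))
          \<le> \<theta> * (ln (4 / d k) powr (2 * \<beta> - 2) * (l / 16))"
        using \<theta>(1) l by (intro mult_left_mono mult_right_mono) auto
      then have "ennreal (\<theta>' * real (Suc k) powr (2 * \<beta> - 2))
          \<le> ennreal (\<theta> * (ln (4 / d k) powr (2 * \<beta> - 2) * ((s k)\<^sup>2 / d k)))"
        unfolding ratio \<theta>'_def by (intro ennreal_leI) (simp add: mult_ac)
      also have "\<dots> \<le> (\<integral>\<^sup>+x. ennreal ((g x)\<^sup>2) * indicator (Q k) x \<partial>lebesgue)"
        unfolding Q_def by (rule \<theta>(2)[OF weak f d s QB[unfolded Q_def]])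
      finally show ?thesis .
    qed
    \<comment> \<open>\<open>g\<close> is only locally integrable on the ball, so measurability is
      obtained on each compact box separately.\<close>
    have meas: "(\<lambda>x. ennreal ((g x)\<^sup>2) * indicator (Q k) x) \<in> borel_measurable lebesgue" for k
    proof -
      have "compact (Q k)" unfolding Q_def by (rule emeasure_box3(2)) (use d[of k] s[of k] in auto)
      then have "integrable lebesgue (\<lambda>x. indicator (Q k) x *\<^sub>R g x)"
        using weak QB[of k] unfolding has_weak_deriv_def locally_integrable_on_def set_integrable_def by blast
      then have "(\<lambda>x. indicator (Q k) x *\<^sub>R g x) \<in> borel_measurable lebesgue" by auto
      then have "(\<lambda>x. ennreal ((indicator (Q k) x *\<^sub>R g x)\<^sup>2)) \<in> borel_measurable lebesgue"
        by measurable
      moreover have e: "ennreal ((indicator (Q k) x *\<^sub>R g x)\<^sup>2) = ennreal ((g x)\<^sup>2) * indicator (Q k) x" for x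
        by (auto simp: indicator_def)
      ultimately show ?thesis unfolding e by simp
    qed
    have bounded: "(\<Sum>k<n. \<theta>' * real (Suc k) powr (2 * \<beta> - 2)) \<le> T" for n
    proof -
      have "ennreal (\<Sum>k<n. \<theta>' * real (Suc k) powr (2 * \<beta> - 2)) =
          (\<Sum>k<n. ennreal (\<theta>' * real (Suc k) powr (2 * \<beta> - 2)))"
        using \<theta>' by (subst sum_ennreal) auto
      also have "\<dots> \<le> (\<Sum>k<n. \<integral>\<^sup>+x. ennreal ((g x)\<^sup>2) * indicator (Q k) x \<partial>lebesgue)"
        by (intro sum_mono box_lower)
      also have "\<dots> = (\<integral>\<^sup>+x. (\<Sum>k<n. ennreal ((g x)\<^sup>2) * indicator (Q k) x) \<partial>lebesgue)"
        by (rule nn_integral_sum[symmetric]) (rule meas)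
      also have "\<dots> \<le> ?T"
      proof (rule nn_integral_mono)
        fix x
        have "(\<Sum>k<n. indicator (Q k) x :: ennreal) \<le> indicator (B t) x"
        proof (cases "\<exists>k<n. x \<in> Q k")
          case True
          then obtain k where k: "k < n" "x \<in> Q k" by blast
          have "indicator (Q j) x = (if j = k then 1 else 0 :: ennreal)" for j
            using k(2) disj[of j k x] by (auto simp: indicator_def)
          then show ?thesis using k QB[of k] by (auto simp: indicator_def)
        next
          case False
          then have "(\<Sum>k<n. indicator (Q k) x :: ennreal) = 0" by (intro sum.neutral) auto
          then show ?thesis by simp
        qed
        then show "(\<Sum>k<n. ennreal ((g x)\<^sup>2) * indicator (Q k) x) \<le> ennreal ((g x)\<^sup>2) * indicator (B t) x"
          by (subst sum_distrib_left[symmetric]) (intro mult_left_mono, auto)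
      qed
      finally show ?thesis using T by (simp add: ennreal_le_iff)
    qed
    have "summable (\<lambda>k. \<theta>' * real (Suc k) powr (2 * \<beta> - 2))"
      using \<theta>' bounded by (intro summableI_nonneg_bounded) auto
    then have "summable (\<lambda>k. real (Suc k) powr (2 * \<beta> - 2))"
      using \<theta>' by (simp add: summable_cmult_iff)
    then have "summable (\<lambda>k. real k powr (2 * \<beta> - 2))"
      by (subst (asm) summable_Suc_iff[of "\<lambda>k. real k powr (2 * \<beta> - 2)"])
    then show False using assms(1) by (simp add: summable_real_powr_iff)
  qed
  have "\<infinity> \<le> hom_sobolev_norm 2 (B t) f"
    unfolding hom_sobolev_norm_def
  proof (rule INF_greatest)
    fix G assume "G \<in> {G. \<forall>I. length I = 2 \<longrightarrow> has_weak_deriv (B t) I f (G I)}"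
    then have "has_weak_deriv (B t) [1, 1] f (G [1, 1])" by simp
    then have inf: "(\<integral>\<^sup>+x\<in>B t. ennreal ((G [1, 1] x)\<^sup>2) \<partial>lebesgue) = \<infinity>" by (rule infinite)
    have "(\<integral>\<^sup>+x\<in>B t. ennreal ((G [1, 1] x)\<^sup>2) \<partial>lebesgue)
        \<le> (\<Sum>I | length I = 2. \<integral>\<^sup>+x\<in>B t. ennreal ((G I x)\<^sup>2) \<partial>lebesgue)"
      by (rule member_le_sum) (auto simp: finite_lists_length)
    then have "(\<Sum>I | length I = 2. \<integral>\<^sup>+x\<in>B t. ennreal ((G I x)\<^sup>2) \<partial>lebesgue) = \<infinity>"
      unfolding inf by (simp add: top_unique)
    then show "\<infinity> \<le> ennreal_sqrt (\<Sum>I | length I = 2. \<integral>\<^sup>+x\<in>B t. ennreal ((G I x)\<^sup>2) \<partial>lebesgue)"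
      by (simp add: ennreal_sqrt_def)
  qed
  then show ?thesis by (simp add: top_unique)
qed

lemma chi2_extension:
  assumes "1/4 < \<alpha>" "\<alpha> < 1/2" "0 < \<epsilon>"
  shows "\<exists>\<Psi>2t :: real^3 \<Rightarrow> real.
          \<Psi>2t \<in> hom_sobolev_space 1 UNIV \<and>
          (\<forall>x\<in>B t. \<Psi>2t x = chi2 \<alpha> \<epsilon> (x $ 1 - t)) \<and>
          (0 \<le> t \<and> t < 1 \<longrightarrow> hom_sobolev_norm 2 (B t) \<Psi>2t = \<infinity>)"
proof -
  define c where "c = 2 * \<epsilon>\<^sup>2"
  have c: "c > 0" using assms by (simp add: c_def)
  \<comment> \<open>\<open>B t\<close> is the open ball of radius \<bar>1 - t\<bar> about the first
    unit vector, for t > 1 as well, so the cut-off equals 1 on it.\<close>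
  define r where "r = 1 + \<bar>1 - t\<bar>"
  have r: "r > 0" by (simp add: r_def)
  let ?\<Psi> = "\<lambda>x. c * ext2 (2 * \<alpha>) t r x"
  have eq: "?\<Psi> x = c * logW (2 * \<alpha>) (x $ 1 - t)" if "x \<in> B t" for x
  proof -
    have "(norm (x - axis 1 1))\<^sup>2 < \<bar>1 - t\<bar>\<^sup>2"
      using that unfolding power2_norm_eq_inner inner_self_eq3 by (simp add: B_def axis_def)
    then have "norm (x - axis 1 1) < \<bar>1 - t\<bar>" by (rule power2_less_imp_less) simp
    moreover have "norm x \<le> norm (x - axis 1 1) + norm (axis 1 (1::real) :: real^3)"
      by (metis diff_add_cancel norm_triangle_ineq)
    ultimately have "norm x \<le> r" by (simp add: r_def)
    then show ?thesis using r by (simp add: ext2_def cutoff_eq_1)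
  qed
  have w: "has_weak_deriv UNIV [i] (ext2 (2 * \<alpha>) t r) (ext2' (2 * \<alpha>) t r i)"
    "(\<integral>\<^sup>+x. ennreal ((ext2' (2 * \<alpha>) t r i x)\<^sup>2) \<partial>lebesgue) < \<infinity>" for i
    using ext2_weak_deriv[where \<beta> = "2 * \<alpha>" and r = r and t = t and i = i] assms r by auto
  have "\<exists>C. hom_sobolev_norm 1 UNIV ?\<Psi> \<le> ennreal (C * c)"
  proof (rule hom_sobolev_norm_scaled[where f = "ext2 (2 * \<alpha>) t r" and k = 1
        and G = "\<lambda>I. ext2' (2 * \<alpha>) t r (hd I)"])
    show "has_weak_deriv UNIV I (ext2 (2 * \<alpha>) t r) (ext2' (2 * \<alpha>) t r (hd I))"
      "(\<integral>\<^sup>+x. ennreal ((ext2' (2 * \<alpha>) t r (hd I) x)\<^sup>2) \<partial>lebesgue) < \<infinity>" if "length I = 1" for I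
      using that w by (auto simp: length_Suc_conv)
  qed (use c in blast)
  then have "?\<Psi> \<in> hom_sobolev_space 1 UNIV"
    unfolding hom_sobolev_space_def by (auto intro: order_le_less_trans)
  moreover have "hom_sobolev_norm 2 (B t) ?\<Psi> = \<infinity>" if "0 \<le> t" "t < 1"
    by (rule hom_sobolev_norm_2_infinite[of "2 * \<alpha>" c]) (use assms c that eq in auto)
  moreover have "?\<Psi> x = chi2 \<alpha> \<epsilon> (x $ 1 - t)" if "x \<in> B t" for x
    using eq[OF that] chi2_eq[of \<alpha> \<epsilon> "x $ 1 - t"] assms by (simp add: c_def)
  ultimately show ?thesis by (intro exI[of _ ?\<Psi>]) blast
qed

theorem lemma2p1:
  shows "(\<forall>\<alpha> R :: real. 0 < \<alpha> \<and> \<alpha> < 1/2 \<and> 2 < R \<longrightarrow>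
      (\<exists>C>0. \<forall>\<epsilon>>0. \<exists>\<Psi>1 :: real^3 \<Rightarrow> real.
          \<Psi>1 \<in> sobolev_space 2 UNIV \<and>
          (\<forall>x\<in>B 0. \<Psi>1 x = chi1 \<alpha> \<epsilon> (x $ 1)) \<and>
          hom_sobolev_norm 2 UNIV \<Psi>1 \<le> ennreal (C * \<epsilon>) \<and>
          supp \<Psi>1 \<subseteq> {x. norm x \<le> R} \<and>
          sing_supp \<Psi>1 = {0}))
    \<and> (\<forall>\<alpha> \<epsilon> :: real. 1/4 < \<alpha> \<and> \<alpha> < 1/2 \<and> 0 < \<epsilon> \<longrightarrow>
      (\<forall>y. chi2 \<alpha> \<epsilon> y = 2 * (LBINT s=ereal 0..ereal y. \<epsilon>\<^sup>2 * \<bar>ln \<bar>s / 4\<bar>\<bar> powr (2 * \<alpha>))) \<and>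
      (\<forall>t. \<exists>\<Psi>2t :: real^3 \<Rightarrow> real.
          \<Psi>2t \<in> hom_sobolev_space 1 UNIV \<and>
          (\<forall>x\<in>B t. \<Psi>2t x = chi2 \<alpha> \<epsilon> (x $ 1 - t)) \<and>
          (0 \<le> t \<and> t < 1 \<longrightarrow> hom_sobolev_norm 2 (B t) \<Psi>2t = \<infinity>)))"
proof (intro conjI allI impI, goal_cases)
  case (1 \<alpha> R)
  then show ?case by (intro chi1_extension) auto
next
  case (2 \<alpha> \<epsilon> y)
  then show ?case by (simp add: chi2_eq logW_def logw_def)
next
  case (3 \<alpha> \<epsilon> t)
  then show ?case by (intro chi2_extension) auto
qed

end
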